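(* Let $0<i<d-1$, let $X=\mathbb{Z}^d$ or let $X=\Lambda\subset\mathbb{Z}^d$ be a box, let $q\ge 2$ be an integer, let $\beta\in[0,\infty)$, and let $\gamma,\gamma'\in Z_{i-1}(X;\mathbb{Z}_q)$ be $(i-1)$-cycles in $X$. Let $\#\in\{\mathbf{f},\mathbf{w}\}$, let $\nu=\nu^{\#}_{X,\beta,q,i-1}$ be $(i-1)$-dimensional $q$-state Potts lattice gauge theory on $X$ with boundary condition $\#$, and let $\mu=\mu^{\#}_{X,p,q,i}$ be the $i$-dimensional plaquette random cluster model on $X$ with boundary condition $\#$ and $p=1-e^{-\beta}$. Then $$\mathrm{Cov}_{\nu}\left(W_{\gamma},W_{\gamma'}^{-1}\right)=\mu\left(V^{\#}_{\gamma,\gamma'}\right)+\mathrm{Cov}_{\mu}\left(V^{\#}_{\gamma},V^{\#}_{\gamma'}\right).$$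
   Context: $\mathbb{Z}^d$ is regarded as the cubical complex obtained by subdividing $\mathbb{R}^d$ into unit cubes with integer vertices; cells are oriented, and $X^{(j)}$ is the set of $j$-cells of a subcomplex $X$. A box is $\Lambda=\prod_{k=1}^d[a_k,b_k]$ with $a_k,b_k\in\mathbb{Z}$, and $\Lambda_N=[-N,N]^d$; $\partial\Lambda$ is the subcomplex of cells contained in the topological boundary of $\Lambda$. $\mathbb{Z}_q$ is the additive group of integers mod $q$; $\mathbb{Z}(q)$ is the multiplicative group of complex $q$-th roots of unity. $C_j(X;\mathbb{Z}_q)$, $Z_j(X;\mathbb{Z}_q)$ are the cellular $j$-chains and $j$-cycles, and $H_j,H^j$ are cellular homology and cohomology. $C^j(X;\mathbb{Z}(q))$ is the group of functions $f$ on oriented $j$-cells with values in $\mathbb{Z}(q)$ and $f(-\sigma)=f(\sigma)^{-1}$; for a chain $\gamma=\sum_\sigma a_\sigma\sigma$ put $f(\gamma)=\prod_\sigma f(\sigma)^{a_\sigma}$, and $\delta f(\sigma)=f(\partial\sigma)$. Potts lattice gauge theory (PLGT). For a box $\Lambda$ and $f\in C^{j}(\Lambda;\mathbb{Z}(q))$ let $H(f)=-\sum_{\sigma\in\Lambda^{(j+1)}}I_{\{\delta f(\sigma)=1\}}$. The $j$-dimensional PLGT with free boundary conditions is $\nu^{\mathbf f}_{\Lambda,\beta,q,j}(f)\propto e^{-\beta H(f)}$; with wired boundary conditions, $\nu^{\mathbf w}_{\Lambda,\beta,q,j}(f)\propto I_{\{\delta f|_{\partial\Lambda}=1\}}e^{-\beta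 H(f)}$. On $\mathbb{Z}^d$ the measures are weak limits of those on $\Lambda_N$ as $N\to\infty$. The Wilson loop variable of a $j$-cycle $\gamma$ is $W_\gamma(f)=f(\gamma)$. Plaquette random cluster model (PRCM). An $i$-dimensional percolation subcomplex of $X$ is a subcomplex containing all cells of $X$ of dimension less than $i$, some of the $i$-cells, and no higher-dimensional cells. Let $|P|$ be the number of $i$-cells of $P$. The $i$-dimensional PRCM on a box $\Lambda$ is the random $i$-dimensional percolation subcomplex $P$ with law $\mu^{\mathbf f}_{\Lambda,p,q,i}(P)\propto p^{|P|}(1-p)^{|\Lambda^{(i)}|-|P|}\,|H^{i-1}(P;\mathbb{Z}_q)|$ (free) or $\mu^{\mathbf w}_{\Lambda,p,q,i}(P)\propto p^{|P|}(1-p)^{|\Lambda^{(i)}|-|P|}\,|H^{i-1}(P\cup\partial\Lambda;\mathbb{Z}_q)|$ (wired). On $\mathbb{Z}^d$ they are the weak limits of the measures on $\Lambda_N$. Events. For $\gamma,\gamma'\in Z_{i-1}(X;\mathbb{Z}_q)$: $V^{\mathbf f}_\gamma$ is the event that $[\gamma]=0$ in $H_{i-1}(P;\mathbb{Z}_q)$, and $V^{\mathbf f}_{\gamma,\gamma'}$ is the event that $[\gamma]=[\gamma']\neq 0$ in $H_{i-1}(P;\mathbb{Z}_q)$. The events $V^{\mathbf w}_\gamma$ and $V^{\mathbf w}_{\gamma,\gamma'}$ are defined in the same way with $H_{i-1}(P\cup\partial\Lambda;\mathbb{Z}_q)$ when $X=\Lambda$, and, when $X=\mathbb{Z}^d$,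 as the events that the corresponding condition holds in $H_{i-1}(P\cup\partial\Lambda_N;\mathbb{Z}_q)$ for all sufficiently large $N$. For random variables $A,B$, $\mathrm{Cov}(A,B)=\mathbb{E}(AB)-\mathbb{E}(A)\mathbb{E}(B)$ (no complex conjugation), and the covariance of two events is that of their indicators. *)

theory Defs
  imports "HOL-Probability.Probability" "HOL-Algebra.Elementary_Groups"
begin

section \<open>The cubical complex\<close>

text \<open>
  A cube of the cubical structure on \<open>\<real>\<^sup>d\<close> is a list of \<open>d\<close> elementary intervals: the entry
  \<open>(a, False)\<close> stands for the point \<open>{a}\<close> and \<open>(a, True)\<close> for the unit interval \<open>[a, a + 1]\<close>.
  Every cube carries the orientation given by the increasing order of the coordinates. A chain is
  therefore a function on cubes, and a function \<open>f\<close> on oriented cubes with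
  \<open>f (- \<sigma>) = inverse (f \<sigma>)\<close> is given by its values on the positively oriented ones.
\<close>

type_synonym cell = "(int \<times> bool) list"

type_synonym box = "(int \<times> int) list"

definition cell_dim :: "cell \<Rightarrow> nat" where
  "cell_dim \<sigma> = card {k. k < length \<sigma> \<and> snd (\<sigma> ! k)}"

definition cells :: "nat \<Rightarrow> cell set \<Rightarrow> cell set" where
  "cells j X = {\<sigma> \<in> X. cell_dim \<sigma> = j}"

definition lattice_cells :: "nat \<Rightarrow> cell set" where
  "lattice_cells d = {\<sigma>. length \<sigma> = d}"

definition box_cells :: "box \<Rightarrow> cell set" where
  "box_cells \<Lambda> = {\<sigma>. length \<sigma> = length \<Lambda> \<and>
     (\<forall>k<length \<Lambda>. fst (\<Lambda> ! k) \<le> fst (\<sigma> ! k) \<and> fst (\<sigma> ! k) + of_bool (snd (\<sigma> ! k)) \<le> snd (\<Lambda> ! k))}"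

definition centered_box :: "nat \<Rightarrow> nat \<Rightarrow> box" where
  "centered_box d N = replicate d (- int N, int N)"

definition cell_body :: "cell \<Rightarrow> (nat \<Rightarrow> real) set" where
  "cell_body \<sigma> = {x \<in> topspace (Euclidean_space (length \<sigma>)). \<forall>k<length \<sigma>.
     of_int (fst (\<sigma> ! k)) \<le> x k \<and> x k \<le> of_int (fst (\<sigma> ! k)) + of_bool (snd (\<sigma> ! k))}"

definition box_body :: "box \<Rightarrow> (nat \<Rightarrow> real) set" where
  "box_body \<Lambda> = {x \<in> topspace (Euclidean_space (length \<Lambda>)). \<forall>k<length \<Lambda>.
     of_int (fst (\<Lambda> ! k)) \<le> x k \<and> x k \<le> of_int (snd (\<Lambda> ! k))}"

definition box_boundary :: "box \<Rightarrow> cell set" where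
  "box_boundary \<Lambda> =
     {\<sigma> \<in> box_cells \<Lambda>. cell_body \<sigma> \<subseteq> Euclidean_space (length \<Lambda>) frontier_of box_body \<Lambda>}"

text \<open>
  \<open>bd \<sigma> \<tau>\<close> is the coefficient of \<open>\<tau>\<close> in the cellular boundary of \<open>\<sigma>\<close>, that is, in
  \<open>\<Sum>\<^sub>k (-1)\<^sup>s (\<sigma> with k-th factor [a, a + 1] replaced by {a + 1} - \<sigma> with it replaced by {a})\<close>,
  where \<open>k\<close> runs over the nondegenerate coordinates of \<open>\<sigma>\<close> and \<open>s\<close> counts the nondegenerate
  coordinates before \<open>k\<close>.
\<close>

definition bd :: "cell \<Rightarrow> cell \<Rightarrow> int" where
  "bd \<sigma> \<tau> = (\<Sum>k | k < length \<sigma> \<and> snd (\<sigma> ! k).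
     (- 1) ^ card {l. l < k \<and> snd (\<sigma> ! l)} *
       (of_bool (\<tau> = \<sigma>[k := (fst (\<sigma> ! k) + 1, False)]) - of_bool (\<tau> = \<sigma>[k := (fst (\<sigma> ! k), False)])))"


section \<open>Homology and cohomology with coefficients in the integers mod q\<close>

text \<open>
  Chains and cochains are extended by 0 outside of the complex, so the chains of a subcomplex are
  chains of the whole complex. The homology is unreduced: every 0-chain is a cycle.
\<close>

definition chain_group :: "nat \<Rightarrow> nat \<Rightarrow> cell set \<Rightarrow> (cell \<Rightarrow> int) monoid" where
  "chain_group q j X =
     \<lparr>carrier = {c. range c \<subseteq> carrier (integer_mod_group q) \<and>
        {\<sigma>. c \<sigma> \<noteq> 0} \<subseteq> cells j X \<and> finite {\<sigma>. c \<sigma> \<noteq> 0}},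
      monoid.mult = (\<lambda>c c' \<sigma>. c \<sigma> \<otimes>\<^bsub>integer_mod_group q\<^esub> c' \<sigma>), one = (\<lambda>_. 0)\<rparr>"

definition chain_boundary :: "nat \<Rightarrow> (cell \<Rightarrow> int) \<Rightarrow> (cell \<Rightarrow> int)" where
  "chain_boundary q c = (\<lambda>\<tau>. (\<Sum>\<sigma> | c \<sigma> \<noteq> 0. c \<sigma> * bd \<sigma> \<tau>) mod int q)"

definition cycles :: "nat \<Rightarrow> nat \<Rightarrow> cell set \<Rightarrow> (cell \<Rightarrow> int) set" where
  "cycles q j X = {c \<in> carrier (chain_group q j X). chain_boundary q c = (\<lambda>_. 0)}"

definition boundaries :: "nat \<Rightarrow> nat \<Rightarrow> cell set \<Rightarrow> (cell \<Rightarrow> int) set" where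
  "boundaries q j X = chain_boundary q ` carrier (chain_group q (Suc j) X)"

definition cycle_group :: "nat \<Rightarrow> nat \<Rightarrow> cell set \<Rightarrow> (cell \<Rightarrow> int) monoid" where
  "cycle_group q j X = (chain_group q j X)\<lparr>carrier := cycles q j X\<rparr>"

definition homology :: "nat \<Rightarrow> nat \<Rightarrow> cell set \<Rightarrow> (cell \<Rightarrow> int) set monoid" where
  "homology q j X = cycle_group q j X Mod boundaries q j X"

definition homology_class :: "nat \<Rightarrow> nat \<Rightarrow> cell set \<Rightarrow> (cell \<Rightarrow> int) \<Rightarrow> (cell \<Rightarrow> int) set" where
  "homology_class q j X c = boundaries q j X #>\<^bsub>cycle_group q j X\<^esub> c"

definition cochain_group :: "nat \<Rightarrow> nat \<Rightarrow> cell set \<Rightarrow> (cell \<Rightarrow> int) monoid" where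
  "cochain_group q j X =
     \<lparr>carrier = {\<phi>. range \<phi> \<subseteq> carrier (integer_mod_group q) \<and> {\<sigma>. \<phi> \<sigma> \<noteq> 0} \<subseteq> cells j X},
      monoid.mult = (\<lambda>\<phi> \<psi> \<sigma>. \<phi> \<sigma> \<otimes>\<^bsub>integer_mod_group q\<^esub> \<psi> \<sigma>), one = (\<lambda>_. 0)\<rparr>"

definition coboundary :: "nat \<Rightarrow> nat \<Rightarrow> cell set \<Rightarrow> (cell \<Rightarrow> int) \<Rightarrow> (cell \<Rightarrow> int)" where
  "coboundary q j X \<phi> = (\<lambda>\<sigma>. if \<sigma> \<in> cells (Suc j) X
     then (\<Sum>\<tau> | bd \<sigma> \<tau> \<noteq> 0. bd \<sigma> \<tau> * \<phi> \<tau>) mod int q else 0)"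

definition cocycles :: "nat \<Rightarrow> nat \<Rightarrow> cell set \<Rightarrow> (cell \<Rightarrow> int) set" where
  "cocycles q j X = {\<phi> \<in> carrier (cochain_group q j X). coboundary q j X \<phi> = (\<lambda>_. 0)}"

fun coboundaries :: "nat \<Rightarrow> nat \<Rightarrow> cell set \<Rightarrow> (cell \<Rightarrow> int) set" where
  "coboundaries q 0 X = {\<lambda>_. 0}"
| "coboundaries q (Suc j) X = coboundary q j X ` carrier (cochain_group q j X)"

definition cohomology :: "nat \<Rightarrow> nat \<Rightarrow> cell set \<Rightarrow> (cell \<Rightarrow> int) set monoid" where
  "cohomology q j X = (cochain_group q j X)\<lparr>carrier := cocycles q j X\<rparr> Mod coboundaries q j X"


section \<open>Finite Gibbs measures, weak limits, covariance\<close>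

datatype boundary_condition = Free | Wired

datatype region = Lattice | Box box

definition region_in_dim :: "nat \<Rightarrow> region \<Rightarrow> bool" where
  "region_in_dim d X = (case X of Lattice \<Rightarrow> True
     | Box \<Lambda> \<Rightarrow> length \<Lambda> = d \<and> (\<forall>(a, b)\<in>set \<Lambda>. a \<le> b))"

definition region_cells :: "nat \<Rightarrow> region \<Rightarrow> cell set" where
  "region_cells d X = (case X of Lattice \<Rightarrow> lattice_cells d | Box \<Lambda> \<Rightarrow> box_cells \<Lambda>)"

definition gibbs :: "'a set \<Rightarrow> ('a \<Rightarrow> real) \<Rightarrow> 'a pmf" where
  "gibbs A w = embed_pmf (\<lambda>x. if x \<in> A then w x / sum w A else 0)"

text \<open>
  Below, \<open>weak_limit\<close> is used on \<open>cell \<Rightarrow> complex\<close> and \<open>cell \<Rightarrow> bool\<close> with the product topology;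
  the configurations on a box are embedded there by their trivial extension.
\<close>

definition weak_limit :: "(nat \<Rightarrow> 'a::topological_space pmf) \<Rightarrow> 'a measure \<Rightarrow> bool" where
  "weak_limit M L \<longleftrightarrow> prob_space L \<and> sets L = sets borel \<and>
     (\<forall>g :: 'a \<Rightarrow> real. continuous_on UNIV g \<and> bounded (range g) \<longrightarrow>
        (\<lambda>N. measure_pmf.expectation (M N) g) \<longlonglongrightarrow> (\<integral>x. g x \<partial>L))"

definition covariance ::
    "'a measure \<Rightarrow> ('a \<Rightarrow> 'b::{real_normed_algebra, banach, second_countable_topology}) \<Rightarrow> ('a \<Rightarrow> 'b) \<Rightarrow> 'b" where
  "covariance M A B = (\<integral>x. A x * B x \<partial>M) - (\<integral>x. A x \<partial>M) * (\<integral>x. B x \<partial>M)"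

definition event_covariance :: "'a measure \<Rightarrow> 'a set \<Rightarrow> 'a set \<Rightarrow> real" where
  "event_covariance M A B = covariance M (indicator A) (indicator B)"


section \<open>Potts lattice gauge theory\<close>

definition spin_cochains :: "nat \<Rightarrow> nat \<Rightarrow> cell set \<Rightarrow> (cell \<Rightarrow> complex) set" where
  "spin_cochains q j X = {f. (\<forall>\<sigma>\<in>cells j X. f \<sigma> ^ q = 1) \<and> (\<forall>\<sigma>. \<sigma> \<notin> cells j X \<longrightarrow> f \<sigma> = 1)}"

definition on_chain :: "(cell \<Rightarrow> complex) \<Rightarrow> (cell \<Rightarrow> int) \<Rightarrow> complex" where
  "on_chain f c = (\<Prod>\<sigma> | c \<sigma> \<noteq> 0. f \<sigma> powi c \<sigma>)"

definition spin_coboundary :: "(cell \<Rightarrow> complex) \<Rightarrow> cell \<Rightarrow> complex" where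
  "spin_coboundary f \<sigma> = on_chain f (bd \<sigma>)"

definition wilson :: "(cell \<Rightarrow> int) \<Rightarrow> (cell \<Rightarrow> complex) \<Rightarrow> complex" where
  "wilson \<gamma> f = on_chain f \<gamma>"

definition plgt_energy :: "box \<Rightarrow> nat \<Rightarrow> (cell \<Rightarrow> complex) \<Rightarrow> real" where
  "plgt_energy \<Lambda> j f = - (\<Sum>\<sigma>\<in>cells (Suc j) (box_cells \<Lambda>). of_bool (spin_coboundary f \<sigma> = 1))"

fun plgt_weight :: "boundary_condition \<Rightarrow> box \<Rightarrow> real \<Rightarrow> nat \<Rightarrow> (cell \<Rightarrow> complex) \<Rightarrow> real" where
  "plgt_weight Free \<Lambda> \<beta> j f = exp (- \<beta> * plgt_energy \<Lambda> j f)"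
| "plgt_weight Wired \<Lambda> \<beta> j f =
     of_bool (\<forall>\<sigma>\<in>cells (Suc j) (box_boundary \<Lambda>). spin_coboundary f \<sigma> = 1) * exp (- \<beta> * plgt_energy \<Lambda> j f)"

definition plgt_box :: "boundary_condition \<Rightarrow> box \<Rightarrow> real \<Rightarrow> nat \<Rightarrow> nat \<Rightarrow> (cell \<Rightarrow> complex) pmf" where
  "plgt_box bc \<Lambda> \<beta> q j = gibbs (spin_cochains q j (box_cells \<Lambda>)) (plgt_weight bc \<Lambda> \<beta> j)"

definition is_plgt ::
    "boundary_condition \<Rightarrow> nat \<Rightarrow> region \<Rightarrow> real \<Rightarrow> nat \<Rightarrow> nat \<Rightarrow> (cell \<Rightarrow> complex) measure \<Rightarrow> bool" where
  "is_plgt bc d X \<beta> q j \<nu> \<longleftrightarrow> (case X of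
       Lattice \<Rightarrow> weak_limit (\<lambda>N. plgt_box bc (centered_box d N) \<beta> q j) \<nu>
     | Box \<Lambda> \<Rightarrow> \<nu> = measure_pmf (plgt_box bc \<Lambda> \<beta> q j))"


section \<open>Plaquette random cluster model\<close>

text \<open>
  A random subcomplex is represented by its membership predicate \<open>\<omega> :: cell \<Rightarrow> bool\<close>, the complex
  itself being \<open>Collect \<omega>\<close>. The sets below are automatically closed under taking faces when \<open>X\<close> is.
\<close>

definition percolation_subcomplexes :: "nat \<Rightarrow> cell set \<Rightarrow> cell set set" where
  "percolation_subcomplexes i X = {P. {\<sigma> \<in> X. cell_dim \<sigma> < i} \<subseteq> P \<and> P \<subseteq> {\<sigma> \<in> X. cell_dim \<sigma> \<le> i}}"

fun with_boundary :: "boundary_condition \<Rightarrow> box \<Rightarrow> cell set \<Rightarrow> cell set" where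
  "with_boundary Free \<Lambda> P = P"
| "with_boundary Wired \<Lambda> P = P \<union> box_boundary \<Lambda>"

definition prcm_weight :: "boundary_condition \<Rightarrow> box \<Rightarrow> real \<Rightarrow> nat \<Rightarrow> nat \<Rightarrow> cell set \<Rightarrow> real" where
  "prcm_weight bc \<Lambda> p q i P =
     p ^ card (cells i P) * (1 - p) ^ (card (cells i (box_cells \<Lambda>)) - card (cells i P)) *
     real (card (carrier (cohomology q (i - 1) (with_boundary bc \<Lambda> P))))"

definition prcm_box :: "boundary_condition \<Rightarrow> box \<Rightarrow> real \<Rightarrow> nat \<Rightarrow> nat \<Rightarrow> (cell \<Rightarrow> bool) pmf" where
  "prcm_box bc \<Lambda> p q i = gibbs {\<omega>. Collect \<omega> \<in> percolation_subcomplexes i (box_cells \<Lambda>)}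
     (\<lambda>\<omega>. prcm_weight bc \<Lambda> p q i (Collect \<omega>))"

definition is_prcm ::
    "boundary_condition \<Rightarrow> nat \<Rightarrow> region \<Rightarrow> real \<Rightarrow> nat \<Rightarrow> nat \<Rightarrow> (cell \<Rightarrow> bool) measure \<Rightarrow> bool" where
  "is_prcm bc d X p q i \<mu> \<longleftrightarrow> (case X of
       Lattice \<Rightarrow> weak_limit (\<lambda>N. prcm_box bc (centered_box d N) p q i) \<mu>
     | Box \<Lambda> \<Rightarrow> \<mu> = measure_pmf (prcm_box bc \<Lambda> p q i))"

text \<open>
  For \<open>Free\<close> boundary conditions the quantifier over \<open>N\<close> is vacuous. For \<open>Wired\<close> ones on the lattice,
  the boundary of each centered box is added to the full infinite subcomplex.
\<close>

definition subcomplex_event ::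
    "boundary_condition \<Rightarrow> nat \<Rightarrow> region \<Rightarrow> (cell set \<Rightarrow> bool) \<Rightarrow> (cell \<Rightarrow> bool) set" where
  "subcomplex_event bc d X C = {\<omega>. case X of
       Lattice \<Rightarrow> (\<forall>\<^sub>F N in sequentially. C (with_boundary bc (centered_box d N) (Collect \<omega>)))
     | Box \<Lambda> \<Rightarrow> C (with_boundary bc \<Lambda> (Collect \<omega>))}"

definition V_null ::
    "boundary_condition \<Rightarrow> nat \<Rightarrow> region \<Rightarrow> nat \<Rightarrow> nat \<Rightarrow> (cell \<Rightarrow> int) \<Rightarrow> (cell \<Rightarrow> bool) set" where
  "V_null bc d X q j \<gamma> = subcomplex_event bc d X
     (\<lambda>P. homology_class q j P \<gamma> = \<one>\<^bsub>homology q j P\<^esub>)"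

definition V_pair ::
    "boundary_condition \<Rightarrow> nat \<Rightarrow> region \<Rightarrow> nat \<Rightarrow> nat \<Rightarrow> (cell \<Rightarrow> int) \<Rightarrow> (cell \<Rightarrow> int) \<Rightarrow> (cell \<Rightarrow> bool) set" where
  "V_pair bc d X q j \<gamma> \<gamma>' = subcomplex_event bc d X
     (\<lambda>P. homology_class q j P \<gamma> = homology_class q j P \<gamma>' \<and>
          homology_class q j P \<gamma> \<noteq> \<one>\<^bsub>homology q j P\<^esub>)"


section \<open>Combinatorial description of the boundary of a box\<close>

lemma mem_box_boundary_iff:
  "\<sigma> \<in> box_boundary \<Lambda> \<longleftrightarrow> \<sigma> \<in> box_cells \<Lambda> \<and>
     (\<exists>k<length \<Lambda>. \<not> snd (\<sigma> ! k) \<and> (fst (\<sigma> ! k) = fst (\<Lambda> ! k) \<or> fst (\<sigma> ! k) = snd (\<Lambda> ! k)))"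
proof (cases "\<sigma> \<in> box_cells \<Lambda>")
  case False
  then show ?thesis by (simp add: box_boundary_def)
next
  case \<sigma>: True
  define n E where "n = length \<Lambda>" and "E = Euclidean_space n"
  have len: "length \<sigma> = n"
    and lo: "\<And>k. k < n \<Longrightarrow> fst (\<Lambda> ! k) \<le> fst (\<sigma> ! k)"
    and hi: "\<And>k. k < n \<Longrightarrow> fst (\<sigma> ! k) + of_bool (snd (\<sigma> ! k)) \<le> snd (\<Lambda> ! k)"
    using \<sigma> by (auto simp: box_cells_def n_def)
  have top: "topspace E = {x. \<forall>i\<ge>n. x i = 0}"
    by (simp add: E_def topspace_Euclidean_space)
  have sub: "cell_body \<sigma> \<subseteq> box_body \<Lambda>"
  proof
    fix x assume x: "x \<in> cell_body \<sigma>"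
    have "of_int (fst (\<Lambda> ! k)) \<le> x k \<and> x k \<le> of_int (snd (\<Lambda> ! k))" if k: "k < n" for k
    proof -
      have "real_of_int (fst (\<Lambda> ! k)) \<le> of_int (fst (\<sigma> ! k))"
        using lo[OF k] by simp
      moreover have "of_int (fst (\<sigma> ! k)) + of_bool (snd (\<sigma> ! k)) \<le> real_of_int (snd (\<Lambda> ! k))"
        using hi[OF k] by (metis of_int_add of_int_le_iff of_int_of_bool)
      moreover have "of_int (fst (\<sigma> ! k)) \<le> x k" "x k \<le> of_int (fst (\<sigma> ! k)) + of_bool (snd (\<sigma> ! k))"
        using x k by (auto simp: cell_body_def len)
      ultimately show ?thesis by linarith
    qed
    then show "x \<in> box_body \<Lambda>"
      using x by (auto simp: cell_body_def box_body_def len n_def)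
  qed
  have "cell_body \<sigma> \<subseteq> E frontier_of box_body \<Lambda> \<longleftrightarrow>
     (\<exists>k<n. \<not> snd (\<sigma> ! k) \<and> (fst (\<sigma> ! k) = fst (\<Lambda> ! k) \<or> fst (\<sigma> ! k) = snd (\<Lambda> ! k)))"
    (is "?L \<longleftrightarrow> ?R")
  proof
    assume ?R
    then obtain k where k: "k < n" "\<not> snd (\<sigma> ! k)"
      and v: "fst (\<sigma> ! k) = fst (\<Lambda> ! k) \<or> fst (\<sigma> ! k) = snd (\<Lambda> ! k)" by blast
    show ?L
    proof
      fix x assume x: "x \<in> cell_body \<sigma>"
      then have xb: "x \<in> box_body \<Lambda>" and xt: "x \<in> topspace E"
        using sub by (auto simp: cell_body_def len E_def)
      have xk: "x k = of_int (fst (\<sigma> ! k))"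
        using x k by (force simp: cell_body_def len)
      have cl: "x \<in> E closure_of box_body \<Lambda>"
        using xb xt unfolding in_closure_of by auto
      have "x \<notin> E interior_of box_body \<Lambda>"
      proof
        assume "x \<in> E interior_of box_body \<Lambda>"
        then obtain U where U: "openin E U" "x \<in> U" "U \<subseteq> box_body \<Lambda>"
          by (auto simp: interior_of_def)
        have c: "continuous_map euclideanreal E (\<lambda>t. x(k := t))"
          unfolding E_def Euclidean_space_def continuous_map_in_subtopology
          using xt k top by (auto simp: continuous_map_componentwise_UNIV)
        have "openin euclideanreal {t \<in> topspace euclideanreal. x(k := t) \<in> U}"
          using openin_continuous_map_preimage[OF c U(1)] .
        then have "open {t. x(k := t) \<in> U}" by simp
        moreover have "x k \<in> {t. x(k := t) \<in> U}" using U(2) by simp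
        ultimately obtain e where e: "e > 0" "ball (x k) e \<subseteq> {t. x(k := t) \<in> U}"
          by (meson open_contains_ball)
        have "x k - e/2 \<in> ball (x k) e" "x k + e/2 \<in> ball (x k) e"
          using e(1) by (auto simp: dist_real_def)
        then have "x(k := x k - e/2) \<in> box_body \<Lambda>" "x(k := x k + e/2) \<in> box_body \<Lambda>"
          using e(2) U(3) by blast+
        then have "of_int (fst (\<Lambda> ! k)) \<le> x k - e/2" "x k + e/2 \<le> of_int (snd (\<Lambda> ! k))"
          using k(1) by (auto simp: box_body_def n_def dest!: spec[of _ k])
        with v xk e(1) show False by auto
      qed
      with cl show "x \<in> E frontier_of box_body \<Lambda>" by (simp add: frontier_of_def)
    qed
  next
    assume L: ?L
    show ?R
    proof (rule ccontr)
      assume nR: "\<not> ?R"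
      define m where "m k = (if k < n then of_int (fst (\<sigma> ! k)) + of_bool (snd (\<sigma> ! k)) / 2 else 0 :: real)" for k
      define U where "U = {x \<in> topspace E. \<forall>k\<in>{..<n}. x k \<in> {of_int (fst (\<Lambda> ! k))<..<of_int (snd (\<Lambda> ! k))}}"
      have op: "openin E {x \<in> topspace E. x k \<in> {a<..<b}}" for k and a b :: real
      proof (rule openin_continuous_map_preimage)
        show "continuous_map E euclideanreal (\<lambda>x. x k)"
          unfolding E_def Euclidean_space_def
          by (intro continuous_map_from_subtopology continuous_map_product_projection) auto
      qed auto
      have "U = (\<Inter>k\<in>{..<n}. {x \<in> topspace E. x k \<in> {of_int (fst (\<Lambda> ! k))<..<of_int (snd (\<Lambda> ! k))}}) \<inter> topspace E"
        by (auto simp: U_def)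
      moreover have "openin E \<dots>"
        by (rule openin_INT) (use op in auto)
      ultimately have "openin E U" by simp
      moreover have "U \<subseteq> box_body \<Lambda>"
        by (auto simp: U_def box_body_def E_def n_def less_imp_le)
      moreover have "m \<in> U"
      proof -
        have "real_of_int (fst (\<Lambda> ! k)) < m k \<and> m k < of_int (snd (\<Lambda> ! k))" if k: "k < n" for k
          using lo[OF k] hi[OF k] nR k by (cases "snd (\<sigma> ! k)") (force simp: m_def)+
        moreover have "m \<in> topspace E" by (simp add: top m_def)
        ultimately show ?thesis by (simp add: U_def)
      qed
      ultimately have "m \<in> E interior_of box_body \<Lambda>" by (auto simp: interior_of_def)
      moreover have "m \<in> cell_body \<sigma>"
        by (auto simp: cell_body_def len m_def topspace_Euclidean_space)
      ultimately show False using L by (auto simp: frontier_of_def)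
    qed
  qed
  with \<sigma> show ?thesis by (simp add: box_boundary_def E_def n_def)
qed

end

theory Submission
  imports Defs "HOL-Algebra.SndIsomorphismGrp"
begin

text \<open>
  Call a chain of dimension \<open>i - 1\<close> bounding in a set \<open>A\<close> of plaquettes if it is the boundary of a
  chain on \<open>A\<close> with coefficients mod \<open>q\<close>, and let \<open>B A\<close> be the group of these chains. The heart
  of the proof is the identity \<open>E (W\<^sub>c) = \<mu> (c \<in> B P)\<close> for a single chain \<open>c\<close>, which is
  \<open>integral_wilson_eq_measure\<close>. Spins are almost surely \<open>q\<close>-th roots of unity, so
  \<open>W\<^sub>\<gamma> W\<^sub>\<gamma>'\<^sup>-\<^sup>1\<close> and \<open>W\<^sub>\<gamma>'\<^sup>-\<^sup>1\<close> are the Wilson variables of \<open>\<gamma> - \<gamma>'\<close> and \<open>- \<gamma>'\<close>. The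
  covariance is therefore \<open>\<mu> (\<gamma> - \<gamma>' \<in> B P) - \<mu> (\<gamma> \<in> B P) \<mu> (\<gamma>' \<in> B P)\<close>, and the event
  \<open>\<gamma> - \<gamma>' \<in> B P\<close> is the disjoint union of \<open>V_pair\<close> and the intersection of the two \<open>V_null\<close>.

  On a box the identity is an exact computation. Expanding every Boltzmann factor as
  \<open>p [\<delta>f \<sigma> = 1] + (1 - p)\<close> turns the gauge theory into a sum over sets \<open>A\<close> of plaquettes, in
  which the spins enter through the sum of \<open>f c\<close> over the \<open>f\<close> that are flat on \<open>A\<close>
  (\<open>plgt_weight_expansion\<close>). Flat spin configurations are the characters that are trivial on \<open>B A\<close>;
  evaluating the sum of \<open>f (c + b)\<close> over all \<open>f\<close> and all \<open>b \<in> B A\<close> in both orders shows that the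
  sum over flat \<open>f\<close> is a constant times \<open>[c \<in> B A] / |B A|\<close> (\<open>sum_flat_spins\<close>). For \<open>c = 0\<close> this
  counts cocycles, so that the order of the cohomology group in the law of the random cluster model is
  a constant multiple of \<open>1 / |B A|\<close> as well (\<open>prcm_weight_eq\<close>), and the two expressions agree.

  On the lattice the left-hand side converges because a Wilson variable is a bounded continuous
  function of finitely many spins. The right-hand side is the probability of a nonlocal event, and it
  remains to exclude a loss of mass at infinity. The inequality
  \<open>|B (A \<union> A')| |B (A \<inter> A')| \<le> |B A| |B A'|\<close> makes the weights \<open>1 / |B A|\<close> satisfy the lattice
  condition of the four functions theorem, for every \<open>q\<close>. Hence the laws on growing boxes increase
  stochastically for free and decrease for wired boundary conditions. The local events ``\<open>c\<close> bounds inside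
  the box of radius \<open>N\<close>'' are monotone in \<open>N\<close> in the same direction, and the limit is squeezed
  (\<open>prcm_lattice_limit\<close>).

  Topology enters in the wired case. For \<open>i < d\<close> a chain on the surface of a box that bounds in the box bounds in
  the surface already, which follows by sweeping relative cycles along one coordinate axis after the
  other (\<open>relative_cycle_bounds\<close>). Consequently a chain that bounds in a small
  box with all its plaquettes, and also bounds in a configuration on a wired larger box, bounds in the
  part of this configuration in the wired small box (\<open>bounding_localize\<close>), and filling the complement of a box has, up to a constant factor, the effect of wiring its surface
  (\<open>card_bounding_glue\<close>).
\<close>

section \<open>Pointwise arithmetic modulo q\<close>

text \<open>All groups of chains, cycles, boundaries, cochains and cocycles are subgroups of this one, so that
  the orders of their sums, intersections and quotients can be compared within a single group.\<close>

definition mod_functions :: "nat \<Rightarrow> ('a \<Rightarrow> int) monoid" where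
  "mod_functions q =
     \<lparr>carrier = {c. range c \<subseteq> carrier (integer_mod_group q)},
      monoid.mult = (\<lambda>c c' \<sigma>. c \<sigma> \<otimes>\<^bsub>integer_mod_group q\<^esub> c' \<sigma>), one = (\<lambda>_. 0)\<rparr>"

lemma mult_mod_functions [simp]:
  "monoid.mult (mod_functions q) = (\<lambda>c c' \<sigma>. (c \<sigma> + c' \<sigma>) mod int q)"
  by (simp add: mod_functions_def)

lemma one_mod_functions [simp]: "\<one>\<^bsub>mod_functions q\<^esub> = (\<lambda>_. 0)"
  by (simp add: mod_functions_def)

lemma carrier_mod_functions_iff:
  "q > 0 \<Longrightarrow> c \<in> carrier (mod_functions q) \<longleftrightarrow> (\<forall>\<sigma>. 0 \<le> c \<sigma> \<and> c \<sigma> < int q)"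
  by (simp add: mod_functions_def carrier_integer_mod_group image_subset_iff)

lemma mod_mem_mod_functions: "q > 0 \<Longrightarrow> (\<lambda>\<sigma>. f \<sigma> mod int q) \<in> carrier (mod_functions q)"
  by (simp add: carrier_mod_functions_iff)

lemma mod_functions_mod_eq:
  "q > 0 \<Longrightarrow> c \<in> carrier (mod_functions q) \<Longrightarrow> c \<sigma> mod int q = c \<sigma>"
  by (simp add: carrier_mod_functions_iff)

lemma comm_group_mod_functions:
  assumes "q > 0"
  shows "comm_group (mod_functions q :: ('a \<Rightarrow> int) monoid)"
proof (rule comm_groupI)
  fix x :: "'a \<Rightarrow> int" assume x: "x \<in> carrier (mod_functions q)"
  have "(\<lambda>\<sigma>. (- x \<sigma>) mod int q) \<otimes>\<^bsub>mod_functions q\<^esub> x = \<one>\<^bsub>mod_functions q\<^esub>"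
    by (simp add: fun_eq_iff mod_add_left_eq)
  then show "\<exists>y\<in>carrier (mod_functions q). y \<otimes>\<^bsub>mod_functions q\<^esub> x = \<one>\<^bsub>mod_functions q\<^esub>"
    using mod_mem_mod_functions[OF assms] by (rule bexI)
qed (use assms in \<open>auto simp: carrier_mod_functions_iff mod_add_left_eq mod_add_right_eq ac_simps\<close>)

lemma inv_mod_functions:
  assumes "q > 0" "x \<in> carrier (mod_functions q)"
  shows "inv\<^bsub>mod_functions q\<^esub> x = (\<lambda>\<sigma>. (- x \<sigma>) mod int q)"
proof -
  interpret comm_group "mod_functions q :: ('a \<Rightarrow> int) monoid"
    using comm_group_mod_functions[OF assms(1)] .
  show ?thesis
    by (rule inv_equality) (use assms in \<open>auto simp: fun_eq_iff mod_add_left_eq mod_mem_mod_functions\<close>)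
qed

lemma subgroup_mod_functionsI:
  assumes q: "q > 0" and sub: "S \<subseteq> carrier (mod_functions q)" and zero: "(\<lambda>_. 0) \<in> S"
    and diff: "\<And>x y. x \<in> S \<Longrightarrow> y \<in> S \<Longrightarrow> (\<lambda>\<sigma>. (x \<sigma> - y \<sigma>) mod int q) \<in> S"
  shows "subgroup S (mod_functions q)"
proof -
  interpret comm_group "mod_functions q :: ('a \<Rightarrow> int) monoid"
    using comm_group_mod_functions[OF q] .
  have neg: "(\<lambda>\<sigma>. (- x \<sigma>) mod int q) \<in> S" if "x \<in> S" for x
    using diff[OF zero that] by simp
  show ?thesis
  proof (rule subgroupI)
    show "S \<subseteq> carrier (mod_functions q)" by (fact sub)
    show "S \<noteq> {}" using zero by blast
    show "inv\<^bsub>mod_functions q\<^esub> a \<in> S" if "a \<in> S" for a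
      using neg[OF that] inv_mod_functions[OF q subsetD[OF sub that]] by simp
    show "a \<otimes>\<^bsub>mod_functions q\<^esub> b \<in> S" if "a \<in> S" "b \<in> S" for a b
      using diff[OF that(1) neg[OF that(2)]] by (simp add: mod_diff_right_eq)
  qed
qed

text \<open>Combine the second isomorphism theorem with Lagrange's theorem.\<close>

lemma (in comm_group) card_set_mult:
  assumes H: "subgroup H G" and K: "subgroup K G" and fin: "finite H" "finite K"
  shows "card (H <#> K) * card (H \<inter> K) = card H * card K"
proof -
  interpret second_isomorphism_grp H G K
    using H K by (simp add: second_isomorphism_grp_def second_isomorphism_grp_axioms_def
        subgroup_imp_normal)
  have "card (carrier (G\<lparr>carrier := K\<rparr> Mod (H \<inter> K))) = card (carrier (G\<lparr>carrier := H <#> K\<rparr> Mod H))"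
    using normal_intersection_quotient_isom by (auto simp: iso_def intro: bij_betw_same_card)
  moreover have cK: "card (carrier (G\<lparr>carrier := K\<rparr> Mod (H \<inter> K))) * card (H \<inter> K) = card K"
  proof -
    interpret K: group "G\<lparr>carrier := K\<rparr>" using K by (rule subgroup_imp_group)
    have "subgroup (H \<inter> K) (G\<lparr>carrier := K\<rparr>)"
      using subgroup_incl[OF subgroups_Inter_pair[OF H K] K] by auto
    from K.lagrange[OF this] show ?thesis by (simp add: FactGroup_def order_def)
  qed
  moreover have "card (carrier (G\<lparr>carrier := H <#> K\<rparr> Mod H)) * card H = card (H <#> K)"
  proof -
    have HK: "subgroup (H <#> K) G" by (rule normal_set_mult_subgroup)
    interpret K: group "G\<lparr>carrier := H <#> K\<rparr>" using HK by (rule subgroup_imp_group)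
    have "subgroup H (G\<lparr>carrier := H <#> K\<rparr>)"
      using subgroup_incl[OF H HK] H_contained_in_set_mult by auto
    from K.lagrange[OF this] show ?thesis by (simp add: FactGroup_def order_def)
  qed
  ultimately have "card (H <#> K) * card (H \<inter> K) =
      card (carrier (G\<lparr>carrier := K\<rparr> Mod (H \<inter> K))) * card H * card (H \<inter> K)" by presburger
  also have "\<dots> = card H * (card (carrier (G\<lparr>carrier := K\<rparr> Mod (H \<inter> K))) * card (H \<inter> K))"
    by (simp only: ac_simps)
  finally show ?thesis by (simp only: cK)
qed

section \<open>The cubical boundary map\<close>

lemma cell_dim_Nil [simp]: "cell_dim [] = 0"
  by (simp add: cell_dim_def)

lemma cell_dim_Cons [simp]: "cell_dim (x # \<sigma>) = of_bool (snd x) + cell_dim \<sigma>"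
proof -
  have eq: "{k. k < length (x # \<sigma>) \<and> snd ((x # \<sigma>) ! k)} =
      (if snd x then {0} else {}) \<union> Suc ` {k. k < length \<sigma> \<and> snd (\<sigma> ! k)}"
    by (auto simp: less_Suc_eq_0_disj nth_Cons' split: if_splits)
  show ?thesis
    unfolding cell_dim_def eq by (subst card_Un_disjoint) (auto simp: card_image)
qed

lemma cell_dim_le_length: "cell_dim \<sigma> \<le> length \<sigma>"
  by (induction \<sigma>) auto

lemma bd_Nil_left [simp]: "bd [] \<tau> = 0"
  by (simp add: bd_def)

lemma bd_Cons_Nil [simp]: "bd (x # \<sigma>) [] = 0"
proof -
  have "\<And>k v. [] \<noteq> (x # \<sigma>)[k := v]" by (metis length_list_update list.size(3) list.simps(3) length_0_conv)
  then show ?thesis by (simp add: bd_def del: list_update.simps)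
qed

text \<open>This is the Leibniz rule for the product of an elementary interval with a cube. It replaces the
  explicit signs of the boundary map by a recursion, and every topological argument below is an
  induction on the list of coordinates through it.\<close>

lemma bd_Cons:
  "bd ((a, t) # \<sigma>) ((b, u) # \<tau>) =
     of_bool (t \<and> \<not> u \<and> \<sigma> = \<tau>) * (of_bool (b = a + 1) - of_bool (b = a)) +
     (if t then - 1 else 1) * of_bool (a = b \<and> t = u) * bd \<sigma> \<tau>"
proof -
  define f where "f = (\<lambda>(\<sigma> :: cell) \<tau> k. (- 1 :: int) ^ card {l. l < k \<and> snd (\<sigma> ! l)} *
       (of_bool (\<tau> = \<sigma>[k := (fst (\<sigma> ! k) + 1, False)]) - of_bool (\<tau> = \<sigma>[k := (fst (\<sigma> ! k), False)])))"
  have bd: "bd \<sigma> \<tau> = (\<Sum>k | k < length \<sigma> \<and> snd (\<sigma> ! k). f \<sigma> \<tau> k)" for \<sigma> \<tau>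
    by (simp add: bd_def f_def)
  let ?\<sigma> = "(a, t) # \<sigma>" and ?\<tau> = "(b, u) # \<tau>" and ?K = "{k. k < length \<sigma> \<and> snd (\<sigma> ! k)}"
  have eq: "{k. k < length ?\<sigma> \<and> snd (?\<sigma> ! k)} = (if t then {0} else {}) \<union> Suc ` ?K"
    by (auto simp: less_Suc_eq_0_disj nth_Cons' split: if_splits)
  have card: "card {l. l < Suc k \<and> snd (?\<sigma> ! l)} = of_bool t + card {l. l < k \<and> snd (\<sigma> ! l)}" for k
  proof -
    have "{l. l < Suc k \<and> snd (?\<sigma> ! l)} = (if t then {0} else {}) \<union> Suc ` {l. l < k \<and> snd (\<sigma> ! l)}"
      by (auto simp: less_Suc_eq_0_disj nth_Cons' split: if_splits)
    then show ?thesis by (simp only:) (subst card_Un_disjoint, auto simp: card_image)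
  qed
  have suc: "f ?\<sigma> ?\<tau> (Suc k) = (if t then - 1 else 1) * of_bool (a = b \<and> t = u) * f \<sigma> \<tau> k" for k
    by (auto simp: f_def card)
  have zero: "f ?\<sigma> ?\<tau> 0 = of_bool (\<not> u \<and> \<sigma> = \<tau>) * (of_bool (b = a + 1) - of_bool (b = a))"
    by (auto simp: f_def)
  have "bd ?\<sigma> ?\<tau> = (\<Sum>k\<in>(if t then {0} else {}). f ?\<sigma> ?\<tau> k) + (\<Sum>k\<in>Suc ` ?K. f ?\<sigma> ?\<tau> k)"
    unfolding bd eq by (rule sum.union_disjoint) auto
  also have "(\<Sum>k\<in>Suc ` ?K. f ?\<sigma> ?\<tau> k) = (if t then - 1 else 1) * of_bool (a = b \<and> t = u) * bd \<sigma> \<tau>"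
    by (simp add: sum.reindex suc bd sum_distrib_left)
  finally show ?thesis using zero by (cases t) simp_all
qed

lemma bd_nonzeroD:
  assumes "bd \<sigma> \<tau> \<noteq> 0"
  shows "length \<sigma> = length \<tau>" "cell_dim \<sigma> = Suc (cell_dim \<tau>)"
proof -
  have "bd \<sigma> \<tau> \<noteq> 0 \<Longrightarrow> length \<sigma> = length \<tau> \<and> cell_dim \<sigma> = Suc (cell_dim \<tau>)"
  proof (induction \<sigma> arbitrary: \<tau>)
    case (Cons x \<sigma>)
    then show ?case
      by (cases x; cases \<tau>; cases "hd \<tau>") (auto simp: bd_Cons split: if_splits)
  qed simp
  with assms show "length \<sigma> = length \<tau>" "cell_dim \<sigma> = Suc (cell_dim \<tau>)" by auto
qed

lemma finite_faces: "finite {\<tau>. bd \<sigma> \<tau> \<noteq> 0}"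
proof (induction \<sigma>)
  case (Cons x \<sigma>)
  obtain a t where x: "x = (a, t)" by (cases x)
  have "{\<tau>. bd (x # \<sigma>) \<tau> \<noteq> 0} \<subseteq>
      {(a + 1, False) # \<sigma>, (a, False) # \<sigma>} \<union> (#) (a, t) ` {\<tau>. bd \<sigma> \<tau> \<noteq> 0}"
  proof
    fix \<tau> assume "\<tau> \<in> {\<tau>. bd (x # \<sigma>) \<tau> \<noteq> 0}"
    then show "\<tau> \<in> {(a + 1, False) # \<sigma>, (a, False) # \<sigma>} \<union> (#) (a, t) ` {\<tau>. bd \<sigma> \<tau> \<noteq> 0}"
      by (cases \<tau>; cases "hd \<tau>") (auto simp: x bd_Cons split: if_splits)
  qed
  with Cons.IH show ?case by (meson finite.emptyI finite.insertI finite_UnI finite_imageI finite_subset)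
qed simp

lemma finite_cofaces: "finite {\<sigma>. bd \<sigma> \<tau> \<noteq> 0}"
proof (induction \<tau>)
  case Nil
  have "{\<sigma>. bd \<sigma> [] \<noteq> 0} = {}" using bd_nonzeroD(1)[of _ "[]"] by fastforce
  then show ?case by simp
next
  case (Cons x \<tau>)
  obtain b u where x: "x = (b, u)" by (cases x)
  have "{\<sigma>. bd \<sigma> (x # \<tau>) \<noteq> 0} \<subseteq>
      {(b - 1, True) # \<tau>, (b, True) # \<tau>} \<union> (#) (b, u) ` {\<sigma>. bd \<sigma> \<tau> \<noteq> 0}"
  proof
    fix \<sigma> assume "\<sigma> \<in> {\<sigma>. bd \<sigma> (x # \<tau>) \<noteq> 0}"
    then show "\<sigma> \<in> {(b - 1, True) # \<tau>, (b, True) # \<tau>} \<union> (#) (b, u) ` {\<sigma>. bd \<sigma> \<tau> \<noteq> 0}"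
      by (cases \<sigma>; cases "hd \<sigma>") (auto simp: x bd_Cons split: if_splits)
  qed
  with Cons.IH show ?case by (meson finite.emptyI finite.insertI finite_UnI finite_imageI finite_subset)
qed

definition int_coboundary :: "(cell \<Rightarrow> int) \<Rightarrow> cell \<Rightarrow> int" where
  "int_coboundary g \<sigma> = (\<Sum>\<tau> | bd \<sigma> \<tau> \<noteq> 0. bd \<sigma> \<tau> * g \<tau>)"

text \<open>The sum runs over the cofaces of a fixed cell, of which there are finitely many, so that
  the boundary makes sense for chains with infinite support as well.\<close>

definition int_boundary :: "(cell \<Rightarrow> int) \<Rightarrow> cell \<Rightarrow> int" where
  "int_boundary c \<tau> = (\<Sum>\<sigma> | bd \<sigma> \<tau> \<noteq> 0. c \<sigma> * bd \<sigma> \<tau>)"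

lemma int_coboundary_eq_sum:
  "finite F \<Longrightarrow> (\<And>\<tau>. bd \<sigma> \<tau> \<noteq> 0 \<Longrightarrow> g \<tau> \<noteq> 0 \<Longrightarrow> \<tau> \<in> F) \<Longrightarrow> int_coboundary g \<sigma> = (\<Sum>\<tau>\<in>F. bd \<sigma> \<tau> * g \<tau>)"
  unfolding int_coboundary_def by (rule sum.mono_neutral_cong) (auto intro: finite_faces)

lemma int_boundary_eq_sum:
  "finite F \<Longrightarrow> (\<And>\<sigma>. bd \<sigma> \<tau> \<noteq> 0 \<Longrightarrow> c \<sigma> \<noteq> 0 \<Longrightarrow> \<sigma> \<in> F) \<Longrightarrow> int_boundary c \<tau> = (\<Sum>\<sigma>\<in>F. c \<sigma> * bd \<sigma> \<tau>)"
  unfolding int_boundary_def by (rule sum.mono_neutral_cong) (auto intro: finite_cofaces)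

lemma chain_boundary_eq_int_boundary:
  "finite {\<sigma>. c \<sigma> \<noteq> 0} \<Longrightarrow> chain_boundary q c = (\<lambda>\<tau>. int_boundary c \<tau> mod int q)"
  unfolding chain_boundary_def by (subst int_boundary_eq_sum[where F = "{\<sigma>. c \<sigma> \<noteq> 0}"]) auto

lemma int_coboundary_diff: "int_coboundary (\<lambda>\<tau>. g \<tau> - h \<tau>) \<sigma> = int_coboundary g \<sigma> - int_coboundary h \<sigma>"
  by (simp add: int_coboundary_def right_diff_distrib sum_subtractf)

lemma int_boundary_diff: "int_boundary (\<lambda>\<sigma>. c \<sigma> - c' \<sigma>) \<tau> = int_boundary c \<tau> - int_boundary c' \<tau>"
  by (simp add: int_boundary_def left_diff_distrib sum_subtractf)

lemma int_boundary_add: "int_boundary (\<lambda>\<sigma>. c \<sigma> + c' \<sigma>) \<tau> = int_boundary c \<tau> + int_boundary c' \<tau>"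
  by (simp add: int_boundary_def distrib_right sum.distrib)

lemma int_boundary_uminus: "int_boundary (\<lambda>\<sigma>. - c \<sigma>) \<tau> = - int_boundary c \<tau>"
  by (simp add: int_boundary_def sum_negf)

lemma int_boundary_zero [simp]: "int_boundary (\<lambda>_. 0) \<tau> = 0"
  by (simp add: int_boundary_def)

lemma int_boundary_cong:
  "(\<And>\<sigma>. bd \<sigma> \<tau> \<noteq> 0 \<Longrightarrow> c \<sigma> = c' \<sigma>) \<Longrightarrow> int_boundary c \<tau> = int_boundary c' \<tau>"
  by (simp add: int_boundary_def)

lemma int_boundary_mod: "int_boundary (\<lambda>\<sigma>. c \<sigma> mod int q) \<tau> mod int q = int_boundary c \<tau> mod int q"
proof -
  have "int_boundary c \<tau> mod int q = (\<Sum>\<sigma> | bd \<sigma> \<tau> \<noteq> 0. (c \<sigma> mod int q) * bd \<sigma> \<tau> mod int q) mod int q"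
    unfolding int_boundary_def mod_mult_left_eq by (rule mod_sum_eq[symmetric])
  also have "\<dots> = int_boundary (\<lambda>\<sigma>. c \<sigma> mod int q) \<tau> mod int q"
    unfolding int_boundary_def by (rule mod_sum_eq)
  finally show ?thesis by simp
qed

lemma int_coboundary_mod:
  "int_coboundary (\<lambda>\<tau>. g \<tau> mod int q) \<sigma> mod int q = int_coboundary g \<sigma> mod int q"
proof -
  have "int_coboundary g \<sigma> mod int q = (\<Sum>\<tau> | bd \<sigma> \<tau> \<noteq> 0. bd \<sigma> \<tau> * (g \<tau> mod int q) mod int q) mod int q"
    unfolding int_coboundary_def mod_mult_right_eq by (rule mod_sum_eq[symmetric])
  also have "\<dots> = int_coboundary (\<lambda>\<tau>. g \<tau> mod int q) \<sigma> mod int q"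
    unfolding int_coboundary_def by (rule mod_sum_eq)
  finally show ?thesis by simp
qed

lemma int_coboundary_Nil [simp]: "int_coboundary g [] = 0"
  by (simp add: int_coboundary_def)

lemma int_coboundary_Cons:
  "int_coboundary g ((a, t) # \<sigma>) =
     (if t then g ((a + 1, False) # \<sigma>) - g ((a, False) # \<sigma>) - int_coboundary (\<lambda>\<tau>. g ((a, True) # \<tau>)) \<sigma>
      else int_coboundary (\<lambda>\<tau>. g ((a, False) # \<tau>)) \<sigma>)"
proof -
  define E where "E = (if t then {(a + 1, False) # \<sigma>, (a, False) # \<sigma>} else {})"
  define F where "F = (#) (a, t) ` {\<tau>. bd \<sigma> \<tau> \<noteq> 0}"
  have "int_coboundary g ((a, t) # \<sigma>) = (\<Sum>\<tau>\<in>E \<union> F. bd ((a, t) # \<sigma>) \<tau> * g \<tau>)"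
  proof (rule int_coboundary_eq_sum)
    show "finite (E \<union> F)" using finite_faces by (auto simp: E_def F_def)
    fix \<tau> assume "bd ((a, t) # \<sigma>) \<tau> \<noteq> 0"
    then show "\<tau> \<in> E \<union> F"
      by (cases \<tau>; cases "hd \<tau>") (auto simp: E_def F_def bd_Cons split: if_splits)
  qed
  also have "\<dots> = (\<Sum>\<tau>\<in>E. bd ((a, t) # \<sigma>) \<tau> * g \<tau>) + (\<Sum>\<tau>\<in>F. bd ((a, t) # \<sigma>) \<tau> * g \<tau>)"
    by (rule sum.union_disjoint) (use finite_faces in \<open>auto simp: E_def F_def\<close>)
  also have "(\<Sum>\<tau>\<in>F. bd ((a, t) # \<sigma>) \<tau> * g \<tau>) =
      (if t then - 1 else 1) * int_coboundary (\<lambda>\<tau>. g ((a, t) # \<tau>)) \<sigma>"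
    by (auto simp: F_def sum.reindex int_coboundary_def bd_Cons sum_negf)
  finally show ?thesis by (auto simp: E_def bd_Cons)
qed

lemma int_boundary_Nil [simp]: "int_boundary c [] = 0"
  by (auto simp: int_boundary_def dest: bd_nonzeroD(1) intro!: sum.neutral)

lemma int_boundary_Cons:
  "int_boundary c ((b, u) # \<tau>) =
     (if u then - int_boundary (\<lambda>\<sigma>. c ((b, True) # \<sigma>)) \<tau>
      else c ((b - 1, True) # \<tau>) - c ((b, True) # \<tau>) + int_boundary (\<lambda>\<sigma>. c ((b, False) # \<sigma>)) \<tau>)"
proof -
  define E where "E = (if u then {} else {(b - 1, True) # \<tau>, (b, True) # \<tau>})"
  define F where "F = (#) (b, u) ` {\<sigma>. bd \<sigma> \<tau> \<noteq> 0}"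
  have "int_boundary c ((b, u) # \<tau>) = (\<Sum>\<sigma>\<in>E \<union> F. c \<sigma> * bd \<sigma> ((b, u) # \<tau>))"
  proof (rule int_boundary_eq_sum)
    show "finite (E \<union> F)" using finite_cofaces by (auto simp: E_def F_def)
    fix \<sigma> assume "bd \<sigma> ((b, u) # \<tau>) \<noteq> 0"
    then show "\<sigma> \<in> E \<union> F"
      by (cases \<sigma>; cases "hd \<sigma>") (auto simp: E_def F_def bd_Cons split: if_splits)
  qed
  also have "\<dots> = (\<Sum>\<sigma>\<in>E. c \<sigma> * bd \<sigma> ((b, u) # \<tau>)) + (\<Sum>\<sigma>\<in>F. c \<sigma> * bd \<sigma> ((b, u) # \<tau>))"
    by (rule sum.union_disjoint) (use finite_cofaces in \<open>auto simp: E_def F_def\<close>)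
  also have "(\<Sum>\<sigma>\<in>F. c \<sigma> * bd \<sigma> ((b, u) # \<tau>)) =
      (if u then - 1 else 1) * int_boundary (\<lambda>\<sigma>. c ((b, u) # \<sigma>)) \<tau>"
    by (auto simp: F_def sum.reindex int_boundary_def bd_Cons sum_negf)
  finally show ?thesis by (auto simp: E_def bd_Cons)
qed

lemma int_coboundary_coboundary: "int_coboundary (int_coboundary g) \<sigma> = 0"
proof (induction \<sigma> arbitrary: g)
  case (Cons x \<sigma>)
  obtain a t where x: "x = (a, t)" by (cases x)
  show ?case
    by (cases t) (simp_all add: x int_coboundary_Cons int_coboundary_diff Cons.IH)
qed simp

lemma int_boundary_boundary: "int_boundary (int_boundary c) \<tau> = 0"
proof (induction \<tau> arbitrary: c)
  case (Cons x \<tau>)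
  obtain a t where x: "x = (a, t)" by (cases x)
  show ?case
    by (cases t) (simp_all add: x int_boundary_Cons int_boundary_diff int_boundary_add
        int_boundary_uminus Cons.IH)
qed simp

section \<open>Chains that bound in a set of plaquettes\<close>

definition chains_on :: "nat \<Rightarrow> cell set \<Rightarrow> (cell \<Rightarrow> int) set" where
  "chains_on q A = {c \<in> carrier (mod_functions q). {\<sigma>. c \<sigma> \<noteq> 0} \<subseteq> A \<and> finite {\<sigma>. c \<sigma> \<noteq> 0}}"

text \<open>The group of boundaries of a complex depends only on the set \<open>A\<close> of its cells of top dimension.
  Keeping only \<open>A\<close> allows arbitrary unions and intersections of percolation subcomplexes.\<close>

definition bounding :: "nat \<Rightarrow> cell set \<Rightarrow> (cell \<Rightarrow> int) set" where
  "bounding q A = chain_boundary q ` chains_on q A"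

lemma carrier_chain_group: "carrier (chain_group q j X) = chains_on q (cells j X)"
  by (auto simp: chain_group_def chains_on_def mod_functions_def)

lemma boundaries_eq_bounding: "boundaries q j X = bounding q (cells (Suc j) X)"
  by (simp add: boundaries_def bounding_def carrier_chain_group)

lemma chains_onI:
  assumes "q > 0" and fin: "finite {\<sigma>. c \<sigma> \<noteq> 0}" and "\<And>\<sigma>. c \<sigma> mod int q \<noteq> 0 \<Longrightarrow> \<sigma> \<in> A"
  shows "(\<lambda>\<sigma>. c \<sigma> mod int q) \<in> chains_on q A"
proof -
  have "finite {\<sigma>. c \<sigma> mod int q \<noteq> 0}" by (rule finite_subset[OF _ fin]) auto
  moreover have "{\<sigma>. c \<sigma> mod int q \<noteq> 0} \<subseteq> A" using assms(3) by blast
  ultimately show ?thesis using mod_mem_mod_functions[OF assms(1)] by (simp add: chains_on_def)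
qed

lemma finite_chain: "c \<in> chains_on q A \<Longrightarrow> finite {\<sigma>. c \<sigma> \<noteq> 0}"
  by (simp add: chains_on_def)

lemma chains_on_mono: "A \<subseteq> B \<Longrightarrow> chains_on q A \<subseteq> chains_on q B"
  by (auto simp: chains_on_def)

lemma bounding_mono: "A \<subseteq> B \<Longrightarrow> bounding q A \<subseteq> bounding q B"
  using chains_on_mono[of A B q] by (auto simp: bounding_def)

lemma finite_support_int_boundary:
  assumes "finite {\<sigma>. c \<sigma> \<noteq> 0}"
  shows "finite {\<tau>. int_boundary c \<tau> \<noteq> 0}"
proof (rule finite_subset)
  show "{\<tau>. int_boundary c \<tau> \<noteq> 0} \<subseteq> (\<Union>\<sigma>\<in>{\<sigma>. c \<sigma> \<noteq> 0}. {\<tau>. bd \<sigma> \<tau> \<noteq> 0})"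
  proof
    fix \<tau> assume "\<tau> \<in> {\<tau>. int_boundary c \<tau> \<noteq> 0}"
    then have "\<exists>\<sigma>. bd \<sigma> \<tau> \<noteq> 0 \<and> c \<sigma> \<noteq> 0"
      unfolding int_boundary_def using sum.neutral[of "{\<sigma>. bd \<sigma> \<tau> \<noteq> 0}" "\<lambda>\<sigma>. c \<sigma> * bd \<sigma> \<tau>"] by fastforce
    then show "\<tau> \<in> (\<Union>\<sigma>\<in>{\<sigma>. c \<sigma> \<noteq> 0}. {\<tau>. bd \<sigma> \<tau> \<noteq> 0})" by blast
  qed
  show "finite (\<Union>\<sigma>\<in>{\<sigma>. c \<sigma> \<noteq> 0}. {\<tau>. bd \<sigma> \<tau> \<noteq> 0})"
    using assms finite_faces by auto
qed

lemma mem_boundingE: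
  assumes "b \<in> bounding q A"
  obtains c where "c \<in> chains_on q A" "b = (\<lambda>\<tau>. int_boundary c \<tau> mod int q)"
proof -
  from assms obtain c where c: "c \<in> chains_on q A" "b = chain_boundary q c"
    unfolding bounding_def by (rule imageE)
  show thesis
    by (rule that[OF c(1)]) (simp only: c(2) chain_boundary_eq_int_boundary[OF finite_chain[OF c(1)]])
qed

text \<open>Working with integer representatives of chains avoids reductions modulo \<open>q\<close>.\<close>

lemma mem_boundingI:
  assumes "q > 0" "finite {\<sigma>. c \<sigma> \<noteq> 0}" "\<And>\<sigma>. c \<sigma> mod int q \<noteq> 0 \<Longrightarrow> \<sigma> \<in> A"
  shows "(\<lambda>\<tau>. int_boundary c \<tau> mod int q) \<in> bounding q A"
proof -
  have c: "(\<lambda>\<sigma>. c \<sigma> mod int q) \<in> chains_on q A" using assms by (rule chains_onI)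
  then have "chain_boundary q (\<lambda>\<sigma>. c \<sigma> mod int q) = (\<lambda>\<tau>. int_boundary c \<tau> mod int q)"
    by (simp add: chain_boundary_eq_int_boundary[OF finite_chain[OF c]] int_boundary_mod)
  with c show ?thesis unfolding bounding_def by (metis image_eqI)
qed

lemma chains_on_zero [simp]: "q > 0 \<Longrightarrow> (\<lambda>_. 0) \<in> chains_on q A"
  using chains_onI[of q "\<lambda>_. 0" A] by simp

lemma bounding_zero [simp]: "q > 0 \<Longrightarrow> (\<lambda>_. 0) \<in> bounding q A"
  using mem_boundingI[of q "\<lambda>_. 0" A] by simp

lemma finite_support_diff:
  fixes c c' :: "cell \<Rightarrow> int"
  assumes "finite {\<sigma>. c \<sigma> \<noteq> 0}" "finite {\<sigma>. c' \<sigma> \<noteq> 0}"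
  shows "finite {\<sigma>. c \<sigma> - c' \<sigma> \<noteq> 0}"
  by (rule finite_subset[of _ "{\<sigma>. c \<sigma> \<noteq> 0} \<union> {\<sigma>. c' \<sigma> \<noteq> 0}"]) (use assms in auto)

lemma chains_on_diff:
  assumes "q > 0" "c \<in> chains_on q A" "c' \<in> chains_on q A"
  shows "(\<lambda>\<sigma>. (c \<sigma> - c' \<sigma>) mod int q) \<in> chains_on q A"
proof (rule chains_onI)
  show "finite {\<sigma>. c \<sigma> - c' \<sigma> \<noteq> 0}" using assms finite_chain by (intro finite_support_diff) auto
  fix \<sigma> assume "(c \<sigma> - c' \<sigma>) mod int q \<noteq> 0"
  then have "c \<sigma> \<noteq> 0 \<or> c' \<sigma> \<noteq> 0" by auto
  then show "\<sigma> \<in> A" using assms by (auto simp: chains_on_def)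
qed fact

lemma bounding_diff:
  assumes q: "q > 0" and "b \<in> bounding q A" "b' \<in> bounding q A"
  shows "(\<lambda>\<sigma>. (b \<sigma> - b' \<sigma>) mod int q) \<in> bounding q A"
proof -
  obtain c c' where c: "c \<in> chains_on q A" "c' \<in> chains_on q A"
    and b: "b = (\<lambda>\<tau>. int_boundary c \<tau> mod int q)" "b' = (\<lambda>\<tau>. int_boundary c' \<tau> mod int q)"
    using assms by (elim mem_boundingE)
  have "(\<lambda>\<sigma>. (b \<sigma> - b' \<sigma>) mod int q) = (\<lambda>\<tau>. int_boundary (\<lambda>\<sigma>. c \<sigma> - c' \<sigma>) \<tau> mod int q)"
    by (simp add: b int_boundary_diff mod_diff_eq)
  also have "\<dots> \<in> bounding q A"
  proof (rule mem_boundingI[OF q])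
    show "finite {\<sigma>. c \<sigma> - c' \<sigma> \<noteq> 0}" using c finite_chain by (intro finite_support_diff) auto
    fix \<sigma> assume "(c \<sigma> - c' \<sigma>) mod int q \<noteq> 0"
    then have "c \<sigma> \<noteq> 0 \<or> c' \<sigma> \<noteq> 0" by auto
    then show "\<sigma> \<in> A" using c by (auto simp: chains_on_def)
  qed
  finally show ?thesis .
qed

lemma bounding_subset: "q > 0 \<Longrightarrow> bounding q A \<subseteq> carrier (mod_functions q)"
  by (auto elim!: mem_boundingE simp: mod_mem_mod_functions)

lemma subgroup_bounding: "q > 0 \<Longrightarrow> subgroup (bounding q A) (mod_functions q)"
  by (rule subgroup_mod_functionsI) (auto simp: bounding_subset bounding_diff)

lemma bounding_uminus: "q > 0 \<Longrightarrow> b \<in> bounding q A \<Longrightarrow> (\<lambda>\<sigma>. (- b \<sigma>) mod int q) \<in> bounding q A"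
  using bounding_diff[of q "\<lambda>_. 0" A b] by simp

lemma bounding_add:
  assumes "q > 0" "b \<in> bounding q A" "b' \<in> bounding q A"
  shows "(\<lambda>\<sigma>. (b \<sigma> + b' \<sigma>) mod int q) \<in> bounding q A"
  using bounding_diff[OF assms(1,2) bounding_uminus[OF assms(1,3)]] by (simp add: mod_diff_right_eq)

lemma finite_chains_on:
  assumes "finite A" "q > 0"
  shows "finite (chains_on q A)"
proof (rule finite_subset)
  show "chains_on q A \<subseteq> {c. \<forall>\<sigma>. (\<sigma> \<in> A \<longrightarrow> c \<sigma> \<in> {0..<int q}) \<and> (\<sigma> \<notin> A \<longrightarrow> c \<sigma> = 0)}"
    using assms by (auto simp: chains_on_def carrier_mod_functions_iff)
  show "finite {c. \<forall>\<sigma>. (\<sigma> \<in> A \<longrightarrow> c \<sigma> \<in> {0..<int q}) \<and> (\<sigma> \<notin> A \<longrightarrow> c \<sigma> = 0)}"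
    by (rule finite_set_of_finite_funs) (use assms in auto)
qed

lemma finite_bounding: "finite A \<Longrightarrow> q > 0 \<Longrightarrow> finite (bounding q A)"
  unfolding bounding_def by (intro finite_imageI finite_chains_on)

lemma card_bounding_pos: "finite A \<Longrightarrow> q > 0 \<Longrightarrow> card (bounding q A) > 0"
  using bounding_zero finite_bounding by (metis card_gt_0_iff empty_iff)

text \<open>A chain on a union of sets splits into a chain on each of them, so boundary groups add up.\<close>

lemma bounding_Un:
  assumes q: "q > 0"
  shows "bounding q (A \<union> B) = bounding q A <#>\<^bsub>mod_functions q\<^esub> bounding q B"
proof
  show "bounding q (A \<union> B) \<subseteq> bounding q A <#>\<^bsub>mod_functions q\<^esub> bounding q B"
  proof
    fix b assume "b \<in> bounding q (A \<union> B)"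
    then obtain c where c: "c \<in> chains_on q (A \<union> B)" and b: "b = (\<lambda>\<tau>. int_boundary c \<tau> mod int q)"
      by (rule mem_boundingE)
    define c1 c2 where "c1 = (\<lambda>\<sigma>. if \<sigma> \<in> A then c \<sigma> else 0)" and "c2 = (\<lambda>\<sigma>. if \<sigma> \<in> A then 0 else c \<sigma>)"
    have split: "c = (\<lambda>\<sigma>. c1 \<sigma> + c2 \<sigma>)" by (auto simp: c1_def c2_def)
    have fin: "finite {\<sigma>. c1 \<sigma> \<noteq> 0}" "finite {\<sigma>. c2 \<sigma> \<noteq> 0}"
      by (rule finite_subset[OF _ finite_chain[OF c]], auto simp: c1_def c2_def)+
    have "(\<lambda>\<tau>. int_boundary c1 \<tau> mod int q) \<in> bounding q A"
      by (rule mem_boundingI[OF q fin(1)]) (auto simp: c1_def split: if_splits)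
    moreover have "(\<lambda>\<tau>. int_boundary c2 \<tau> mod int q) \<in> bounding q B"
    proof (rule mem_boundingI[OF q fin(2)])
      show "\<sigma> \<in> B" if "c2 \<sigma> mod int q \<noteq> 0" for \<sigma>
      proof -
        have "\<sigma> \<notin> A" "c \<sigma> \<noteq> 0" using that by (auto simp: c2_def split: if_splits)
        then show ?thesis using c by (auto simp: chains_on_def)
      qed
    qed
    moreover have "b = (\<lambda>\<sigma>. (int_boundary c1 \<sigma> mod int q + int_boundary c2 \<sigma> mod int q) mod int q)"
      unfolding b split by (simp add: int_boundary_add mod_add_eq)
    ultimately show "b \<in> bounding q A <#>\<^bsub>mod_functions q\<^esub> bounding q B"
      unfolding set_mult_def mult_mod_functions by blast
  qed
  show "bounding q A <#>\<^bsub>mod_functions q\<^esub> bounding q B \<subseteq> bounding q (A \<union> B)"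
    using bounding_mono[of A "A \<union> B" q] bounding_mono[of B "A \<union> B" q]
    by (auto simp: set_mult_def intro!: bounding_add[OF q])
qed

lemma card_bounding_Un:
  assumes "q > 0" "finite A" "finite B"
  shows "card (bounding q (A \<union> B)) * card (bounding q A \<inter> bounding q B) =
    card (bounding q A) * card (bounding q B)"
proof -
  interpret comm_group "mod_functions q :: (cell \<Rightarrow> int) monoid"
    using assms(1) by (rule comm_group_mod_functions)
  show ?thesis
    using card_set_mult[OF subgroup_bounding subgroup_bounding] assms
    by (simp add: bounding_Un finite_bounding)
qed

text \<open>Boundary groups turn unions into sums, but only \<open>bounding q (A \<inter> B) \<subseteq> bounding q A \<inter> bounding q B\<close>
  holds for intersections. The resulting inequality says that \<open>1 / card (bounding q A)\<close> is
  log-supermodular, which is the source of the positive association of the random cluster model for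
  every \<open>q\<close>.\<close>

lemma card_bounding_submodular:
  assumes "q > 0" "finite A" "finite B"
  shows "card (bounding q (A \<union> B)) * card (bounding q (A \<inter> B)) \<le> card (bounding q A) * card (bounding q B)"
proof -
  have "card (bounding q (A \<inter> B)) \<le> card (bounding q A \<inter> bounding q B)"
    using assms bounding_mono[of "A \<inter> B"] by (intro card_mono) (auto simp: finite_bounding)
  then have "card (bounding q (A \<union> B)) * card (bounding q (A \<inter> B)) \<le>
      card (bounding q (A \<union> B)) * card (bounding q A \<inter> bounding q B)" by (rule mult_le_mono2)
  then show ?thesis by (simp only: card_bounding_Un[OF assms])
qed

lemma card_bounding_mono:
  "q > 0 \<Longrightarrow> finite B \<Longrightarrow> A \<subseteq> B \<Longrightarrow> card (bounding q A) \<le> card (bounding q B)"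
  by (simp add: bounding_mono card_mono finite_bounding)

section \<open>Relative homology of a box\<close>

text \<open>These are the cells of the box that do not lie in its boundary, hence the generators of the
  relative chain complex of the pair.\<close>

definition inner_cell :: "box \<Rightarrow> cell \<Rightarrow> bool" where
  "inner_cell \<Lambda> \<sigma> \<longleftrightarrow>
     list_all2 (\<lambda>(l, h) (a, t). if t then l \<le> a \<and> a + 1 \<le> h else l < a \<and> a < h) \<Lambda> \<sigma>"

lemma inner_cell_Cons [simp]:
  "inner_cell ((l, h) # \<Lambda>) ((a, t) # \<sigma>) \<longleftrightarrow>
     (if t then l \<le> a \<and> a + 1 \<le> h else l < a \<and> a < h) \<and> inner_cell \<Lambda> \<sigma>"
  by (simp add: inner_cell_def)

lemma inner_cell_length: "inner_cell \<Lambda> \<sigma> \<Longrightarrow> length \<sigma> = length \<Lambda>"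
  by (auto simp: inner_cell_def dest: list_all2_lengthD)

lemma inner_cell_iff: "inner_cell \<Lambda> \<sigma> \<longleftrightarrow> \<sigma> \<in> box_cells \<Lambda> - box_boundary \<Lambda>"
proof (cases "length \<sigma> = length \<Lambda>")
  case True
  have "(if t then l \<le> a \<and> a + 1 \<le> h else l < a \<and> a < h) \<longleftrightarrow>
      l \<le> a \<and> a + of_bool t \<le> h \<and> \<not> (\<not> t \<and> (a = l \<or> a = h))" for l h a :: int and t
    by auto
  then show ?thesis
    using True unfolding Diff_iff mem_box_boundary_iff
    by (auto simp: inner_cell_def list_all2_conv_all_nth box_cells_def case_prod_unfold)
next
  case False
  then show ?thesis using inner_cell_length[of \<Lambda> \<sigma>] by (auto simp: box_cells_def)
qed

lemma box_boundary_subset: "box_boundary \<Lambda> \<subseteq> box_cells \<Lambda>"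
  by (auto simp: box_boundary_def)

lemma inner_cell_coface:
  "inner_cell \<Lambda> \<tau> \<Longrightarrow> bd \<sigma> \<tau> \<noteq> 0 \<Longrightarrow> inner_cell \<Lambda> \<sigma>"
proof (induction \<sigma> arbitrary: \<Lambda> \<tau>)
  case (Cons x \<sigma>)
  obtain a t where x: "x = (a, t)" by (cases x)
  obtain y \<tau>' where \<tau>: "\<tau> = y # \<tau>'" using Cons.prems(2) by (cases \<tau>) auto
  obtain b u where y: "y = (b, u)" by (cases y)
  obtain l h \<Lambda>' where \<Lambda>: "\<Lambda> = (l, h) # \<Lambda>'"
    using inner_cell_length[OF Cons.prems(1)] by (cases \<Lambda>) (auto simp: \<tau>)
  show ?case
  proof (cases "t \<and> \<not> u \<and> \<sigma> = \<tau>' \<and> (b = a + 1 \<or> b = a)")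
    case True
    then show ?thesis using Cons.prems(1) by (auto simp: x y \<tau> \<Lambda>)
  next
    case False
    then have "a = b" "t = u" "bd \<sigma> \<tau>' \<noteq> 0"
      using Cons.prems(2) by (auto simp: x y \<tau> bd_Cons split: if_splits)
    then show ?thesis using Cons.prems(1) Cons.IH[of \<Lambda>' \<tau>'] by (auto simp: x y \<tau> \<Lambda>)
  qed
qed simp

lemma mem_box_cells_iff:
  "\<sigma> \<in> box_cells \<Lambda> \<longleftrightarrow> list_all2 (\<lambda>(l, h) (a, t). l \<le> a \<and> a + of_bool t \<le> h) \<Lambda> \<sigma>"
  by (auto simp: box_cells_def list_all2_conv_all_nth case_prod_unfold)

lemma box_cells_Cons [simp]:
  "(a, t) # \<sigma> \<in> box_cells ((l, h) # \<Lambda>) \<longleftrightarrow> l \<le> a \<and> a + of_bool t \<le> h \<and> \<sigma> \<in> box_cells \<Lambda>"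
  by (simp add: mem_box_cells_iff)

lemma box_cells_face:
  "\<sigma> \<in> box_cells \<Lambda> \<Longrightarrow> bd \<sigma> \<tau> \<noteq> 0 \<Longrightarrow> \<tau> \<in> box_cells \<Lambda>"
proof (induction \<sigma> arbitrary: \<Lambda> \<tau>)
  case (Cons x \<sigma>)
  obtain a t where x: "x = (a, t)" by (cases x)
  obtain y \<tau>' where \<tau>: "\<tau> = y # \<tau>'" using Cons.prems(2) by (cases \<tau>) auto
  obtain b u where y: "y = (b, u)" by (cases y)
  have "length \<Lambda> = Suc (length \<sigma>)" using Cons.prems(1) by (simp add: box_cells_def)
  then obtain l h \<Lambda>' where \<Lambda>: "\<Lambda> = (l, h) # \<Lambda>'"
    by (cases \<Lambda>) auto
  show ?case
  proof (cases "t \<and> \<not> u \<and> \<sigma> = \<tau>' \<and> (b = a + 1 \<or> b = a)")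
    case True
    then show ?thesis using Cons.prems(1) by (auto simp: x y \<tau> \<Lambda>)
  next
    case False
    then have "a = b" "t = u" "bd \<sigma> \<tau>' \<noteq> 0"
      using Cons.prems(2) by (auto simp: x y \<tau> bd_Cons split: if_splits)
    then show ?thesis using Cons.prems(1) Cons.IH[of \<Lambda>' \<tau>'] by (auto simp: x y \<tau> \<Lambda>)
  qed
qed simp

lemma finite_box_cells: "finite (box_cells \<Lambda>)"
proof (rule finite_subset)
  let ?A = "(\<Union>(l, h)\<in>set \<Lambda>. {l..h}) \<times> (UNIV :: bool set)"
  show "box_cells \<Lambda> \<subseteq> {\<sigma>. set \<sigma> \<subseteq> ?A \<and> length \<sigma> = length \<Lambda>}"
  proof
    fix \<sigma> assume \<sigma>: "\<sigma> \<in> box_cells \<Lambda>"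
    have "x \<in> ?A" if "x \<in> set \<sigma>" for x
    proof -
      obtain k where k: "k < length \<sigma>" "x = \<sigma> ! k" using \<open>x \<in> set \<sigma>\<close> by (auto simp: in_set_conv_nth)
      then have "\<Lambda> ! k \<in> set \<Lambda>" "fst (\<Lambda> ! k) \<le> fst x" "fst x \<le> snd (\<Lambda> ! k)"
        using \<sigma> by (auto simp: box_cells_def intro: order_trans[rotated])
      then show ?thesis
        by (cases x) (auto simp: case_prod_unfold intro!: bexI[of _ "\<Lambda> ! k"])
    qed
    then show "\<sigma> \<in> {\<sigma>. set \<sigma> \<subseteq> ?A \<and> length \<sigma> = length \<Lambda>}" using \<sigma> by (auto simp: box_cells_def)
  qed
  show "finite {\<sigma>. set \<sigma> \<subseteq> ?A \<and> length \<sigma> = length \<Lambda>}"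
    by (rule finite_lists_length_eq) auto
qed

text \<open>A relative cycle whose dimension is less than that of the box is a relative boundary. In the first
  coordinate, every cell over an inner lattice point is swept downwards until it has left the box; this
  subtracts a boundary and leaves only cells over unit intervals. Being a cycle, the remaining chain
  has the same cross-section over each unit interval, so it is the product of the whole interval with a
  relative cycle in one dimension less, and induction applies to this cross-section. Congruence
  modulo \<open>m\<close> instead of equality gives coefficients mod \<open>q\<close> without passing to a quotient.\<close>

lemma relative_cycle_bounds:
  fixes m :: int
  assumes "\<And>\<tau>. inner_cell \<Lambda> \<tau> \<Longrightarrow> m dvd int_boundary c \<tau>"
    and "\<And>\<sigma>. inner_cell \<Lambda> \<sigma> \<Longrightarrow> cell_dim \<sigma> = length \<Lambda> \<Longrightarrow> m dvd c \<sigma>"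
  shows "\<exists>e. \<forall>\<sigma>. inner_cell \<Lambda> \<sigma> \<longrightarrow> m dvd c \<sigma> - int_boundary e \<sigma>"
  using assms
proof (induction \<Lambda> arbitrary: c)
  case Nil
  have "m dvd c \<sigma> - int_boundary (\<lambda>_. 0) \<sigma>" if "inner_cell [] \<sigma>" for \<sigma>
    using Nil.prems(2)[OF that] inner_cell_length[OF that] by simp
  then show ?case by blast
next
  case (Cons x \<Lambda>)
  obtain l h where x: "x = (l, h)" by (cases x)
  \<comment> \<open>the chain traced out by the sweep\<close>
  define e1 where "e1 = (\<lambda>\<sigma>. case \<sigma> of [] \<Rightarrow> 0
    | y # \<tau> \<Rightarrow> if snd y then \<Sum>a\<in>{fst y<..<h}. c ((a, False) # \<tau>) else 0)"
  define c1 where "c1 = (\<lambda>\<sigma>. c \<sigma> - int_boundary e1 \<sigma>)"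
  have c1_point: "c1 ((a, False) # \<tau>) = 0" if "a < h" for a \<tau>
  proof -
    have "{a - 1<..<h} = insert a {a<..<h}" using that by auto
    then show ?thesis by (simp add: c1_def int_boundary_Cons e1_def)
  qed
  have bd_c1: "int_boundary c1 = int_boundary c"
    by (simp add: fun_eq_iff c1_def int_boundary_diff int_boundary_boundary)
  have adjacent: "m dvd c1 ((a - 1, True) # \<tau>) - c1 ((a, True) # \<tau>)"
    if "l < a" "a < h" "inner_cell \<Lambda> \<tau>" for a \<tau>
  proof -
    have "m dvd int_boundary c1 ((a, False) # \<tau>)"
      unfolding bd_c1 by (rule Cons.prems(1)) (use that in \<open>simp add: x\<close>)
    then show ?thesis by (simp add: int_boundary_Cons c1_point[OF that(2)])
  qed
  have const: "m dvd c1 ((b, True) # \<tau>) - c1 ((l, True) # \<tau>)"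
    if "l \<le> b" "b + 1 \<le> h" "inner_cell \<Lambda> \<tau>" for b \<tau>
    using that(1,2)
  proof (induction b rule: int_ge_induct)
    case (step b)
    then have "m dvd c1 ((b, True) # \<tau>) - c1 ((l, True) # \<tau>)" by simp
    moreover have "m dvd c1 ((b, True) # \<tau>) - c1 ((b + 1, True) # \<tau>)"
      using adjacent[of "b + 1" \<tau>] step.hyps step.prems that(3) by simp
    ultimately have "m dvd (c1 ((b, True) # \<tau>) - c1 ((l, True) # \<tau>)) -
        (c1 ((b, True) # \<tau>) - c1 ((b + 1, True) # \<tau>))" by (rule dvd_diff)
    then show ?case by simp
  qed simp
  show ?case
  proof (cases "l < h")
    case True
    have "\<exists>e. \<forall>\<sigma>. inner_cell \<Lambda> \<sigma> \<longrightarrow> m dvd c1 ((l, True) # \<sigma>) - int_boundary e \<sigma>"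
    proof (rule Cons.IH)
      show "m dvd int_boundary (\<lambda>\<sigma>. c1 ((l, True) # \<sigma>)) \<tau>" if "inner_cell \<Lambda> \<tau>" for \<tau>
        using Cons.prems(1)[of "(l, True) # \<tau>"] that True
        by (simp add: x flip: bd_c1) (simp add: int_boundary_Cons)
      show "m dvd c1 ((l, True) # \<sigma>)" if \<sigma>: "inner_cell \<Lambda> \<sigma>" "cell_dim \<sigma> = length \<Lambda>" for \<sigma>
      proof -
        have "bd \<rho> \<sigma> = 0" for \<rho>
          using bd_nonzeroD[of \<rho> \<sigma>] cell_dim_le_length[of \<rho>] inner_cell_length[OF \<sigma>(1)] \<sigma>(2) by fastforce
        then have "int_boundary (\<lambda>\<rho>. e1 ((l, True) # \<rho>)) \<sigma> = 0" by (simp add: int_boundary_def)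
        then have "int_boundary e1 ((l, True) # \<sigma>) = 0" by (simp add: int_boundary_Cons)
        then show ?thesis using Cons.prems(2)[of "(l, True) # \<sigma>"] \<sigma> True by (simp add: x c1_def)
      qed
    qed
    then obtain e where e: "\<And>\<sigma>. inner_cell \<Lambda> \<sigma> \<Longrightarrow> m dvd c1 ((l, True) # \<sigma>) - int_boundary e \<sigma>" by blast
    \<comment> \<open>minus the product of the interval with \<open>e\<close>: the boundary map passes the interval with a sign\<close>
    define e2 where "e2 = (\<lambda>\<sigma>. case \<sigma> of [] \<Rightarrow> 0 | y # \<tau> \<Rightarrow> if snd y then - e \<tau> else 0)"
    have "m dvd c \<sigma> - int_boundary (\<lambda>\<rho>. e1 \<rho> + e2 \<rho>) \<sigma>" if \<sigma>: "inner_cell (x # \<Lambda>) \<sigma>" for \<sigma>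
    proof -
      obtain a t \<tau> where \<sigma>': "\<sigma> = (a, t) # \<tau>"
        using inner_cell_length[OF \<sigma>] by (cases \<sigma>) auto
      have eq: "c \<sigma> - int_boundary (\<lambda>\<rho>. e1 \<rho> + e2 \<rho>) \<sigma> = c1 \<sigma> - int_boundary e2 \<sigma>"
        by (simp add: c1_def int_boundary_add)
      show ?thesis
      proof (cases t)
        case True
        then have "m dvd c1 ((a, True) # \<tau>) - c1 ((l, True) # \<tau>)" "m dvd c1 ((l, True) # \<tau>) - int_boundary e \<tau>"
          using \<sigma> const[of a \<tau>] e[of \<tau>] by (auto simp: x \<sigma>')
        from dvd_add[OF this] show ?thesis
          unfolding eq using True by (simp add: \<sigma>' int_boundary_Cons e2_def int_boundary_uminus)
      next
        case False
        then show ?thesis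
          unfolding eq using \<sigma> c1_point[of a \<tau>] by (simp add: x \<sigma>' int_boundary_Cons e2_def)
      qed
    qed
    then show ?thesis by blast
  next
    case False
    have "\<not> inner_cell (x # \<Lambda>) \<sigma>" for \<sigma>
      using False by (cases \<sigma>; cases "hd \<sigma>") (auto simp: x inner_cell_def)
    then show ?thesis by blast
  qed
qed

text \<open>The \<open>j\<close>-th homology of the surface of a box embeds into that of the box when \<open>j + 1\<close> is less than
  the dimension: a chain \<open>c\<close> in the box with boundary on the surface is a relative cycle, so it
  differs by a boundary from a chain on the surface, and this does not change the boundary of \<open>c\<close>.\<close>

lemma bounding_in_box_boundary:
  assumes q: "q > 0" and j: "Suc j < length \<Lambda>"
    and b: "b \<in> bounding q (cells (Suc j) (box_cells \<Lambda>))"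
    and inner: "\<And>\<tau>. inner_cell \<Lambda> \<tau> \<Longrightarrow> b \<tau> = 0"
  shows "b \<in> bounding q (cells (Suc j) (box_boundary \<Lambda>))"
proof -
  obtain c where c: "c \<in> chains_on q (cells (Suc j) (box_cells \<Lambda>))"
    and bc: "b = (\<lambda>\<tau>. int_boundary c \<tau> mod int q)" using b by (rule mem_boundingE)
  have supp: "\<sigma> \<in> box_cells \<Lambda> \<and> cell_dim \<sigma> = Suc j" if "c \<sigma> \<noteq> 0" for \<sigma>
    using c that by (auto simp: chains_on_def cells_def)
  have "\<exists>e. \<forall>\<sigma>. inner_cell \<Lambda> \<sigma> \<longrightarrow> int q dvd c \<sigma> - int_boundary e \<sigma>"
  proof (rule relative_cycle_bounds)
    show "int q dvd int_boundary c \<tau>" if "inner_cell \<Lambda> \<tau>" for \<tau>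
      using inner[OF that] by (simp add: bc dvd_eq_mod_eq_0)
    show "int q dvd c \<sigma>" if "inner_cell \<Lambda> \<sigma>" "cell_dim \<sigma> = length \<Lambda>" for \<sigma>
      using supp[of \<sigma>] that j by (cases "c \<sigma> = 0") auto
  qed
  then obtain e where e: "\<And>\<sigma>. inner_cell \<Lambda> \<sigma> \<Longrightarrow> int q dvd c \<sigma> - int_boundary e \<sigma>" by blast
  define e' where "e' = (\<lambda>\<rho>. if inner_cell \<Lambda> \<rho> \<and> cell_dim \<rho> = Suc (Suc j) then e \<rho> else 0)"
  have fin_e': "finite {\<rho>. e' \<rho> \<noteq> 0}"
    by (rule finite_subset[OF _ finite_box_cells[of \<Lambda>]]) (auto simp: e'_def inner_cell_iff split: if_splits)
  have e'_supp: "\<sigma> \<in> box_cells \<Lambda> \<and> cell_dim \<sigma> = Suc j" if "int_boundary e' \<sigma> \<noteq> 0" for \<sigma>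
  proof -
    have "\<exists>\<rho>. bd \<rho> \<sigma> \<noteq> 0 \<and> e' \<rho> \<noteq> 0"
    proof (rule ccontr)
      assume "\<nexists>\<rho>. bd \<rho> \<sigma> \<noteq> 0 \<and> e' \<rho> \<noteq> 0"
      then have "int_boundary e' \<sigma> = int_boundary (\<lambda>_. 0) \<sigma>" by (intro int_boundary_cong) blast
      with that show False by simp
    qed
    then obtain \<rho> where \<rho>: "bd \<rho> \<sigma> \<noteq> 0" "e' \<rho> \<noteq> 0" by blast
    then show ?thesis
      using bd_nonzeroD(2)[OF \<rho>(1)] box_cells_face[OF _ \<rho>(1)]
      by (auto simp: e'_def inner_cell_iff split: if_splits)
  qed
  have e'_inner: "int_boundary e' \<sigma> = int_boundary e \<sigma>" if "inner_cell \<Lambda> \<sigma>" "cell_dim \<sigma> = Suc j" for \<sigma>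
    by (rule int_boundary_cong) (use that inner_cell_coface bd_nonzeroD(2) in \<open>auto simp: e'_def\<close>)
  have "(\<lambda>\<tau>. int_boundary (\<lambda>\<sigma>. c \<sigma> - int_boundary e' \<sigma>) \<tau> mod int q) \<in> bounding q (cells (Suc j) (box_boundary \<Lambda>))"
  proof (rule mem_boundingI[OF q])
    show "finite {\<sigma>. c \<sigma> - int_boundary e' \<sigma> \<noteq> 0}"
      by (intro finite_support_diff finite_support_int_boundary fin_e' finite_chain[OF c])
    fix \<sigma> assume nz: "(c \<sigma> - int_boundary e' \<sigma>) mod int q \<noteq> 0"
    then have *: "\<sigma> \<in> box_cells \<Lambda> \<and> cell_dim \<sigma> = Suc j"
      using supp[of \<sigma>] e'_supp[of \<sigma>] by (cases "c \<sigma> = 0"; cases "int_boundary e' \<sigma> = 0") simp_all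
    have "\<not> inner_cell \<Lambda> \<sigma>"
      using nz e[of \<sigma>] e'_inner[of \<sigma>] * by (auto simp: dvd_eq_mod_eq_0)
    with * show "\<sigma> \<in> cells (Suc j) (box_boundary \<Lambda>)" by (auto simp: cells_def inner_cell_iff)
  qed
  then show ?thesis by (simp add: bc int_boundary_diff int_boundary_boundary)
qed

text \<open>Cut a filling of \<open>\<gamma>\<close> at the surface of the box. The inner part has boundary \<open>\<gamma>\<close> up to a chain on the
  surface, and this chain bounds in the box because \<open>\<gamma>\<close> does; hence it bounds in the surface. The
  assumption that \<open>\<gamma>\<close> bounds in the box replaces information on the homology of the complement of the box.\<close>

lemma bounding_localize:
  assumes q: "q > 0" and j: "Suc j < length \<Lambda>"
    and box: "\<gamma> \<in> bounding q (cells (Suc j) (box_cells \<Lambda>))"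
    and Q: "\<gamma> \<in> bounding q Q" "Q \<subseteq> {\<sigma>. cell_dim \<sigma> = Suc j}"
  shows "\<gamma> \<in> bounding q (Q \<inter> cells (Suc j) (box_cells \<Lambda>) \<union> cells (Suc j) (box_boundary \<Lambda>))"
proof -
  let ?S = "cells (Suc j) (box_cells \<Lambda>)" and ?T = "cells (Suc j) (box_boundary \<Lambda>)"
  obtain c where c: "c \<in> chains_on q Q" and \<gamma>: "\<gamma> = (\<lambda>\<tau>. int_boundary c \<tau> mod int q)"
    using Q(1) by (rule mem_boundingE)
  define c' where "c' = (\<lambda>\<sigma>. if \<sigma> \<in> ?S then c \<sigma> else 0)"
  define b' where "b' = (\<lambda>\<tau>. int_boundary c' \<tau> mod int q)"
  have b': "b' \<in> bounding q (Q \<inter> ?S)"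
    unfolding b'_def
  proof (rule mem_boundingI[OF q])
    show "finite {\<sigma>. c' \<sigma> \<noteq> 0}"
      by (rule finite_subset[OF _ finite_chain[OF c]]) (auto simp: c'_def)
    show "\<sigma> \<in> Q \<inter> ?S" if "c' \<sigma> mod int q \<noteq> 0" for \<sigma>
    proof -
      have "\<sigma> \<in> ?S" "c \<sigma> \<noteq> 0" using that by (auto simp: c'_def split: if_splits)
      then show ?thesis using c by (auto simp: chains_on_def)
    qed
  qed
  have "(\<lambda>\<sigma>. (\<gamma> \<sigma> - b' \<sigma>) mod int q) \<in> bounding q ?T"
  proof (rule bounding_in_box_boundary[OF q j])
    show "(\<lambda>\<sigma>. (\<gamma> \<sigma> - b' \<sigma>) mod int q) \<in> bounding q ?S"
      using b' bounding_mono[of "Q \<inter> ?S" ?S q] by (intro bounding_diff[OF q box]) auto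
    show "(\<gamma> \<tau> - b' \<tau>) mod int q = 0" if \<tau>: "inner_cell \<Lambda> \<tau>" for \<tau>
    proof -
      have "int_boundary c \<tau> = int_boundary c' \<tau>"
      proof (rule int_boundary_cong)
        show "c \<sigma> = c' \<sigma>" if "bd \<sigma> \<tau> \<noteq> 0" for \<sigma>
          using inner_cell_coface[OF \<tau> that] c Q(2) by (auto simp: c'_def cells_def inner_cell_iff chains_on_def)
      qed
      then show ?thesis by (simp add: \<gamma> b'_def)
    qed
  qed
  then have "(\<lambda>\<sigma>. ((\<gamma> \<sigma> - b' \<sigma>) mod int q + b' \<sigma>) mod int q) \<in> bounding q (Q \<inter> ?S \<union> ?T)"
    using b' bounding_mono[of ?T "Q \<inter> ?S \<union> ?T" q] bounding_mono[of "Q \<inter> ?S" "Q \<inter> ?S \<union> ?T" q]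
    by (intro bounding_add[OF q]) auto
  then show ?thesis by (simp add: mod_add_left_eq \<gamma>)
qed

text \<open>This is Mayer-Vietoris for the box and its complement, which meet in the surface: a chain that bounds
  on both sides lies on the surface and bounds there, so the boundary groups of the two sides
  intersect exactly in that of the surface.\<close>

lemma card_bounding_glue:
  assumes q: "q > 0" and j: "Suc j < length \<Lambda>" and A: "A \<subseteq> cells (Suc j) (box_cells \<Lambda>)"
    and K: "finite K" "cells (Suc j) (box_boundary \<Lambda>) \<subseteq> K" "\<And>\<sigma>. \<sigma> \<in> K \<Longrightarrow> \<not> inner_cell \<Lambda> \<sigma>"
  shows "card (bounding q (A \<union> K)) * card (bounding q (cells (Suc j) (box_boundary \<Lambda>))) =
    card (bounding q (A \<union> cells (Suc j) (box_boundary \<Lambda>))) * card (bounding q K)"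
proof -
  let ?S = "cells (Suc j) (box_cells \<Lambda>)" and ?T = "cells (Suc j) (box_boundary \<Lambda>)"
  have TS: "?T \<subseteq> ?S" using box_boundary_subset by (auto simp: cells_def)
  have fin: "finite (A \<union> ?T)"
    using A TS finite_box_cells[of \<Lambda>] by (auto intro: finite_subset simp: cells_def)
  have "bounding q (A \<union> ?T) \<inter> bounding q K = bounding q ?T"
  proof
    show "bounding q (A \<union> ?T) \<inter> bounding q K \<subseteq> bounding q ?T"
    proof
      fix b assume b: "b \<in> bounding q (A \<union> ?T) \<inter> bounding q K"
      show "b \<in> bounding q ?T"
      proof (rule bounding_in_box_boundary[OF q j])
        show "b \<in> bounding q ?S" using b A TS bounding_mono[of "A \<union> ?T" ?S q] by auto
        obtain c where c: "c \<in> chains_on q K" "b = (\<lambda>\<tau>. int_boundary c \<tau> mod int q)"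
          using b by (auto elim: mem_boundingE)
        fix \<tau> assume \<tau>: "inner_cell \<Lambda> \<tau>"
        have "int_boundary c \<tau> = int_boundary (\<lambda>_. 0) \<tau>"
          by (rule int_boundary_cong) (use inner_cell_coface[OF \<tau>] K(3) c(1) in \<open>auto simp: chains_on_def\<close>)
        then show "b \<tau> = 0" by (simp add: c(2))
      qed
    qed
    show "bounding q ?T \<subseteq> bounding q (A \<union> ?T) \<inter> bounding q K"
      using bounding_mono K(2) by (metis Int_subset_iff Un_upper2)
  qed
  moreover have "A \<union> ?T \<union> K = A \<union> K" using K(2) by auto
  ultimately show ?thesis using card_bounding_Un[OF q fin K(1)] by simp
qed

section \<open>Characters and the order of the group of cocycles\<close>

definition root_spins :: "nat \<Rightarrow> (cell \<Rightarrow> complex) set" where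
  "root_spins q = {f. \<forall>\<sigma>. f \<sigma> ^ q = 1}"

lemma spin_cochains_root_spins: "f \<in> spin_cochains q j X \<Longrightarrow> f \<in> root_spins q"
  by (auto simp: spin_cochains_def root_spins_def)

lemma root_spins_nonzero: "q > 0 \<Longrightarrow> f \<in> root_spins q \<Longrightarrow> f \<sigma> \<noteq> 0"
  by (auto simp: root_spins_def) (metis power_0_left zero_neq_one less_irrefl)

lemma root_powi_mod:
  fixes z :: complex
  assumes "q > 0" "z ^ q = 1"
  shows "z powi (k mod int q) = z powi k"
proof -
  have z: "z \<noteq> 0" using assms by (auto simp: power_0_left)
  have "z powi k = z powi (int q * (k div int q) + k mod int q)" by simp
  also have "\<dots> = z powi (int q * (k div int q)) * z powi (k mod int q)"
    using z by (intro power_int_add) auto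
  also have "z powi (int q * (k div int q)) = 1"
    using assms(2) by (simp add: power_int_mult)
  finally show ?thesis by simp
qed

lemma on_chain_eq_prod:
  assumes "finite F" "\<And>\<sigma>. c \<sigma> \<noteq> 0 \<Longrightarrow> \<sigma> \<in> F"
  shows "on_chain f c = (\<Prod>\<sigma>\<in>F. f \<sigma> powi c \<sigma>)"
  unfolding on_chain_def by (rule prod.mono_neutral_left) (use assms in auto)

lemma on_chain_zero [simp]: "on_chain f (\<lambda>_. 0) = 1"
  by (simp add: on_chain_def)

lemma on_chain_mod:
  assumes q: "q > 0" and f: "f \<in> root_spins q" and fin: "finite {\<sigma>. c \<sigma> \<noteq> 0}"
  shows "on_chain f (\<lambda>\<sigma>. c \<sigma> mod int q) = on_chain f c"
proof -
  have "on_chain f (\<lambda>\<sigma>. c \<sigma> mod int q) = (\<Prod>\<sigma> | c \<sigma> \<noteq> 0. f \<sigma> powi (c \<sigma> mod int q))"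
    by (rule on_chain_eq_prod[OF fin]) auto
  also have "\<dots> = on_chain f c"
    unfolding on_chain_def using f by (intro prod.cong root_powi_mod[OF q]) (auto simp: root_spins_def)
  finally show ?thesis .
qed

lemma on_chain_diff:
  assumes nz: "\<And>\<sigma>. f \<sigma> \<noteq> 0" and fin: "finite {\<sigma>. c \<sigma> \<noteq> 0}" "finite {\<sigma>. c' \<sigma> \<noteq> 0}"
  shows "on_chain f (\<lambda>\<sigma>. c \<sigma> - c' \<sigma>) = on_chain f c * inverse (on_chain f c')"
proof -
  let ?F = "{\<sigma>. c \<sigma> \<noteq> 0} \<union> {\<sigma>. c' \<sigma> \<noteq> 0}"
  have F: "finite ?F" using fin by simp
  have "on_chain f c = (\<Prod>\<sigma>\<in>?F. f \<sigma> powi c \<sigma>)" "on_chain f c' = (\<Prod>\<sigma>\<in>?F. f \<sigma> powi c' \<sigma>)"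
    "on_chain f (\<lambda>\<sigma>. c \<sigma> - c' \<sigma>) = (\<Prod>\<sigma>\<in>?F. f \<sigma> powi (c \<sigma> - c' \<sigma>))"
    by (rule on_chain_eq_prod[OF F]; auto)+
  then show ?thesis
    by (simp add: power_int_diff nz prod_dividef) (simp add: divide_inverse)
qed

lemma on_chain_add:
  assumes nz: "\<And>\<sigma>. f \<sigma> \<noteq> 0" and fin: "finite {\<sigma>. c \<sigma> \<noteq> 0}" "finite {\<sigma>. c' \<sigma> \<noteq> 0}"
  shows "on_chain f (\<lambda>\<sigma>. c \<sigma> + c' \<sigma>) = on_chain f c * on_chain f c'"
proof -
  let ?F = "{\<sigma>. c \<sigma> \<noteq> 0} \<union> {\<sigma>. c' \<sigma> \<noteq> 0}"
  have F: "finite ?F" using fin by simp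
  have "on_chain f c = (\<Prod>\<sigma>\<in>?F. f \<sigma> powi c \<sigma>)" "on_chain f c' = (\<Prod>\<sigma>\<in>?F. f \<sigma> powi c' \<sigma>)"
    "on_chain f (\<lambda>\<sigma>. c \<sigma> + c' \<sigma>) = (\<Prod>\<sigma>\<in>?F. f \<sigma> powi (c \<sigma> + c' \<sigma>))"
    by (rule on_chain_eq_prod[OF F]; auto)+
  then show ?thesis by (simp add: power_int_add nz prod.distrib)
qed

text \<open>The cellular form of Stokes' theorem.\<close>

lemma on_chain_int_boundary:
  assumes nz: "\<And>\<sigma>. f \<sigma> \<noteq> 0" and fin: "finite {\<sigma>. c \<sigma> \<noteq> 0}"
  shows "on_chain f (int_boundary c) = (\<Prod>\<sigma> | c \<sigma> \<noteq> 0. spin_coboundary f \<sigma> powi c \<sigma>)"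
proof -
  define S where "S = {\<sigma>. c \<sigma> \<noteq> 0}"
  define F where "F = (\<Union>\<sigma>\<in>S. {\<tau>. bd \<sigma> \<tau> \<noteq> 0})"
  have S: "finite S" using fin by (simp add: S_def)
  have F: "finite F" using S finite_faces by (simp add: F_def)
  have bnd: "int_boundary c \<tau> = (\<Sum>\<sigma>\<in>S. c \<sigma> * bd \<sigma> \<tau>)" for \<tau>
    by (rule int_boundary_eq_sum[OF S]) (auto simp: S_def)
  have powi_sum: "f \<tau> powi (\<Sum>\<sigma>\<in>S'. g \<sigma>) = (\<Prod>\<sigma>\<in>S'. f \<tau> powi g \<sigma>)" if "finite S'" for S' g \<tau>
    using that by (induction S' rule: finite_induct) (simp_all add: power_int_add nz)
  have powi_prod: "(\<Prod>\<tau>\<in>F'. h \<tau>) powi k = (\<Prod>\<tau>\<in>F'. h \<tau> powi k)"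
    if "finite F'" for F' and h :: "cell \<Rightarrow> complex" and k
    using that by (induction F' rule: finite_induct) (simp_all add: power_int_mult_distrib)
  have "on_chain f (int_boundary c) = (\<Prod>\<tau>\<in>F. f \<tau> powi int_boundary c \<tau>)"
  proof (rule on_chain_eq_prod[OF F])
    fix \<tau> assume "int_boundary c \<tau> \<noteq> 0"
    then obtain \<sigma> where "\<sigma> \<in> S" "c \<sigma> * bd \<sigma> \<tau> \<noteq> 0" unfolding bnd by (rule sum.not_neutral_contains_not_neutral)
    then show "\<tau> \<in> F" by (auto simp: F_def)
  qed
  also have "\<dots> = (\<Prod>\<tau>\<in>F. \<Prod>\<sigma>\<in>S. f \<tau> powi (c \<sigma> * bd \<sigma> \<tau>))"
    by (simp add: bnd powi_sum[OF S])
  also have "\<dots> = (\<Prod>\<sigma>\<in>S. \<Prod>\<tau>\<in>F. f \<tau> powi (c \<sigma> * bd \<sigma> \<tau>))" by (rule prod.swap)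
  also have "\<dots> = (\<Prod>\<sigma>\<in>S. spin_coboundary f \<sigma> powi c \<sigma>)"
  proof (rule prod.cong[OF refl])
    fix \<sigma> assume "\<sigma> \<in> S"
    then have "spin_coboundary f \<sigma> = (\<Prod>\<tau>\<in>F. f \<tau> powi bd \<sigma> \<tau>)"
      unfolding spin_coboundary_def by (intro on_chain_eq_prod[OF F]) (auto simp: F_def)
    then show "(\<Prod>\<tau>\<in>F. f \<tau> powi (c \<sigma> * bd \<sigma> \<tau>)) = spin_coboundary f \<sigma> powi c \<sigma>"
      by (simp add: powi_prod[OF F] power_int_mult[symmetric] mult.commute)
  qed
  finally show ?thesis by (simp add: S_def)
qed

definition flat_on :: "cell set \<Rightarrow> (cell \<Rightarrow> complex) \<Rightarrow> bool" where
  "flat_on A f \<longleftrightarrow> (\<forall>\<sigma>\<in>A. spin_coboundary f \<sigma> = 1)"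

text \<open>By Stokes' theorem the spin configurations that are flat on \<open>A\<close> form the annihilator of the group
  of boundaries of \<open>A\<close>.\<close>

lemma flat_on_iff_trivial_on_bounding:
  assumes q: "q \<ge> 2" and f: "f \<in> root_spins q"
  shows "flat_on A f \<longleftrightarrow> (\<forall>b\<in>bounding q A. on_chain f b = 1)"
proof
  have nz: "\<And>\<sigma>. f \<sigma> \<noteq> 0" using root_spins_nonzero[OF _ f] q by simp
  have key: "on_chain f (\<lambda>\<tau>. int_boundary c \<tau> mod int q) = (\<Prod>\<sigma> | c \<sigma> \<noteq> 0. spin_coboundary f \<sigma> powi c \<sigma>)"
    if "finite {\<sigma>. c \<sigma> \<noteq> 0}" for c
    using on_chain_mod[OF _ f finite_support_int_boundary[OF that]] on_chain_int_boundary[OF nz that] q by simp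
  show "\<forall>b\<in>bounding q A. on_chain f b = 1" if "flat_on A f"
  proof
    fix b assume "b \<in> bounding q A"
    then obtain c where c: "c \<in> chains_on q A" "b = (\<lambda>\<tau>. int_boundary c \<tau> mod int q)" by (rule mem_boundingE)
    have "(\<Prod>\<sigma> | c \<sigma> \<noteq> 0. spin_coboundary f \<sigma> powi c \<sigma>) = 1"
      using c(1) that by (intro prod.neutral) (auto simp: flat_on_def chains_on_def subset_iff)
    then show "on_chain f b = 1" using key[OF finite_chain[OF c(1)]] c(2) by simp
  qed
  show "flat_on A f" if triv: "\<forall>b\<in>bounding q A. on_chain f b = 1"
    unfolding flat_on_def
  proof
    fix \<sigma> assume \<sigma>: "\<sigma> \<in> A"
    let ?c = "\<lambda>\<rho>. of_bool (\<rho> = \<sigma>) :: int"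
    have supp: "{\<rho>. ?c \<rho> \<noteq> 0} = {\<sigma>}" by auto
    have "(\<lambda>\<tau>. int_boundary ?c \<tau> mod int q) \<in> bounding q A"
      by (rule mem_boundingI) (use q \<sigma> supp in \<open>auto split: if_splits\<close>)
    with triv key[of ?c] show "spin_coboundary f \<sigma> = 1" by (simp add: supp)
  qed
qed

text \<open>Orthogonality of characters on the group of boundaries: if \<open>f b0 \<noteq> 1\<close>, translation by \<open>b0\<close>
  multiplies the sum by \<open>f b0\<close> and leaves it unchanged, so it vanishes.\<close>

lemma sum_on_chain_bounding:
  assumes q: "q \<ge> 2" and f: "f \<in> root_spins q" and A: "finite A"
    and fin: "\<And>b. b \<in> bounding q A \<Longrightarrow> finite {\<sigma>. b \<sigma> \<noteq> 0}"
  shows "(\<Sum>b\<in>bounding q A. on_chain f b) = of_nat (card (bounding q A)) * of_bool (flat_on A f)"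
proof (cases "flat_on A f")
  case True
  then have "\<forall>b\<in>bounding q A. on_chain f b = 1" using flat_on_iff_trivial_on_bounding[OF q f] by blast
  with True show ?thesis by simp
next
  case False
  then obtain b0 where b0: "b0 \<in> bounding q A" "on_chain f b0 \<noteq> 1"
    using flat_on_iff_trivial_on_bounding[OF q f] by blast
  have q0: "q > 0" using q by simp
  have nz: "\<And>\<sigma>. f \<sigma> \<noteq> 0" using root_spins_nonzero[OF q0 f] .
  have red: "(\<lambda>\<sigma>. b \<sigma> mod int q) = b" if "b \<in> bounding q A" for b
    using bounding_subset[OF q0, of A] that by (auto simp: mod_functions_mod_eq[OF q0])
  have bij: "bij_betw (\<lambda>b \<sigma>. (b \<sigma> + b0 \<sigma>) mod int q) (bounding q A) (bounding q A)"
    by (rule bij_betw_byWitness[where f' = "\<lambda>b \<sigma>. (b \<sigma> - b0 \<sigma>) mod int q"])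
      (auto simp: mod_diff_left_eq mod_add_left_eq red intro!: bounding_add[OF q0] bounding_diff[OF q0] b0(1))
  have "(\<Sum>b\<in>bounding q A. on_chain f b) = (\<Sum>b\<in>bounding q A. on_chain f (\<lambda>\<sigma>. (b \<sigma> + b0 \<sigma>) mod int q))"
    by (rule sum.reindex_bij_betw[OF bij, symmetric])
  also have "\<dots> = (\<Sum>b\<in>bounding q A. on_chain f b * on_chain f b0)"
  proof (rule sum.cong[OF refl])
    fix b assume b: "b \<in> bounding q A"
    have "finite {\<sigma>. b \<sigma> + b0 \<sigma> \<noteq> 0}"
      by (rule finite_subset[of _ "{\<sigma>. b \<sigma> \<noteq> 0} \<union> {\<sigma>. b0 \<sigma> \<noteq> 0}"]) (use fin b b0 in auto)
    then show "on_chain f (\<lambda>\<sigma>. (b \<sigma> + b0 \<sigma>) mod int q) = on_chain f b * on_chain f b0"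
      using on_chain_mod[OF q0 f] on_chain_add[OF nz fin[OF b] fin[OF b0(1)]] by simp
  qed
  finally have "(\<Sum>b\<in>bounding q A. on_chain f b) * (1 - on_chain f b0) = 0"
    by (simp add: right_diff_distrib flip: sum_distrib_right)
  with b0(2) False show ?thesis by simp
qed

lemma cis_root_eq_1_iff:
  assumes "q > 0"
  shows "cis (2 * pi / real q) powi k = 1 \<longleftrightarrow> int q dvd k"
proof -
  let ?z = "cis (2 * pi / real q)"
  have z: "?z ^ q = 1" using assms by (simp add: Complex.DeMoivre)
  define r where "r = nat (k mod int q)"
  have r: "r < q" "k mod int q = int r" using assms by (auto simp: r_def nat_less_iff)
  have "?z powi k = ?z ^ r" using root_powi_mod[OF assms z, of k] by (simp add: r(2))
  also have "\<dots> = cis (2 * pi * real r / real q)" by (simp add: Complex.DeMoivre mult.commute)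
  finally have "?z powi k = 1 \<longleftrightarrow> cis (2 * pi * real r / real q) = cis (2 * pi * real 0 / real q)" by simp
  also have "\<dots> \<longleftrightarrow> r = 0"
    using bij_betw_imp_inj_on[OF Complex.bij_betw_roots_unity[OF assms]] r(1) assms by (auto simp: inj_on_def)
  also have "\<dots> \<longleftrightarrow> int q dvd k" using r(2) by (simp add: dvd_eq_mod_eq_0)
  finally show ?thesis .
qed

lemma cis_root_power: "q > 0 \<Longrightarrow> cis (2 * pi / real q) ^ q = 1"
  by (simp add: Complex.DeMoivre)

lemma finite_spin_cochains:
  assumes "finite X" "q > 0"
  shows "finite (spin_cochains q j X)"
proof -
  have "spin_cochains q j X =
      {f. \<forall>\<sigma>. (\<sigma> \<in> cells j X \<longrightarrow> f \<sigma> \<in> {z. z ^ q = 1}) \<and> (\<sigma> \<notin> cells j X \<longrightarrow> f \<sigma> = 1)}"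
    by (auto simp: spin_cochains_def)
  then show ?thesis
    using finite_set_of_finite_funs[of "cells j X" "{z :: complex. z ^ q = 1}" 1] assms finite_roots_unity[of q]
    by (simp add: cells_def)
qed

text \<open>Orthogonality in the other variable: twisting the spin at a cell of the support of \<open>c\<close> by a primitive
  root of unity multiplies the sum by a number different from 1.\<close>

lemma sum_spin_cochains_on_chain:
  assumes q: "q > 0" and X: "finite X" and c: "c \<in> chains_on q (cells j X)"
  shows "(\<Sum>f\<in>spin_cochains q j X. on_chain f c) = of_nat (card (spin_cochains q j X)) * of_bool (c = (\<lambda>_. 0))"
proof (cases "c = (\<lambda>_. 0)")
  case False
  then obtain \<rho> where \<rho>: "c \<rho> \<noteq> 0" by auto
  let ?z = "cis (2 * pi / real q)"
  have z: "?z ^ q = 1" "?z \<noteq> 0" using q by (simp_all add: cis_root_power)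
  have \<rho>X: "\<rho> \<in> cells j X" using c \<rho> by (auto simp: chains_on_def)
  have "0 \<le> c \<rho>" "c \<rho> < int q" using c q by (auto simp: chains_on_def carrier_mod_functions_iff)
  then have ndvd: "\<not> int q dvd c \<rho>" using \<rho> zdvd_imp_le[of "int q" "c \<rho>"] by auto
  have bij: "bij_betw (\<lambda>f. f(\<rho> := f \<rho> * ?z)) (spin_cochains q j X) (spin_cochains q j X)"
    by (rule bij_betw_byWitness[where f' = "\<lambda>f. f(\<rho> := f \<rho> / ?z)"])
      (use z \<rho>X in \<open>auto simp: spin_cochains_def power_mult_distrib power_divide\<close>)
  have "(\<Sum>f\<in>spin_cochains q j X. on_chain f c) = (\<Sum>f\<in>spin_cochains q j X. on_chain (f(\<rho> := f \<rho> * ?z)) c)"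
    by (rule sum.reindex_bij_betw[OF bij, symmetric])
  also have "\<dots> = (\<Sum>f\<in>spin_cochains q j X. on_chain f c * ?z powi c \<rho>)"
  proof (rule sum.cong[OF refl])
    fix f
    have mem: "\<rho> \<in> {\<sigma>. c \<sigma> \<noteq> 0}" using \<rho> by simp
    show "on_chain (f(\<rho> := f \<rho> * ?z)) c = on_chain f c * ?z powi c \<rho>"
      unfolding on_chain_def prod.remove[OF finite_chain[OF c] mem]
      by (simp add: power_int_mult_distrib)
  qed
  finally have "(\<Sum>f\<in>spin_cochains q j X. on_chain f c) * (1 - ?z powi c \<rho>) = 0"
    by (simp add: right_diff_distrib flip: sum_distrib_right)
  with ndvd cis_root_eq_1_iff[OF q] False show ?thesis by simp
qed simp

lemma bounding_box_subset:
  assumes "A \<subseteq> cells (Suc j) (box_cells \<Lambda>)" "q > 0"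
  shows "bounding q A \<subseteq> chains_on q (cells j (box_cells \<Lambda>))"
proof
  fix b assume "b \<in> bounding q A"
  then obtain c where c: "c \<in> chains_on q A" "b = (\<lambda>\<tau>. int_boundary c \<tau> mod int q)" by (rule mem_boundingE)
  show "b \<in> chains_on q (cells j (box_cells \<Lambda>))"
    unfolding c(2)
  proof (rule chains_onI[OF assms(2) finite_support_int_boundary[OF finite_chain[OF c(1)]]])
    fix \<tau> assume "int_boundary c \<tau> mod int q \<noteq> 0"
    then have "\<not> (\<forall>\<sigma>. bd \<sigma> \<tau> \<noteq> 0 \<longrightarrow> c \<sigma> = 0)" using int_boundary_cong[of \<tau> c "\<lambda>_. 0"] by force
    then obtain \<sigma> where \<sigma>: "bd \<sigma> \<tau> \<noteq> 0" "c \<sigma> \<noteq> 0" by blast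
    then have "\<sigma> \<in> cells (Suc j) (box_cells \<Lambda>)" using c(1) assms(1) by (auto simp: chains_on_def)
    then show "\<tau> \<in> cells j (box_cells \<Lambda>)"
      using bd_nonzeroD(2)[OF \<sigma>(1)] box_cells_face[OF _ \<sigma>(1)] by (auto simp: cells_def)
  qed
qed

lemma finite_cells_box [simp]: "finite (cells j (box_cells \<Lambda>))"
  by (simp add: cells_def finite_box_cells)

text \<open>Sum \<open>f (\<gamma> + b)\<close> over all spin configurations \<open>f\<close> and all \<open>b \<in> bounding q A\<close>. The sum over \<open>b\<close>
  selects the flat \<open>f\<close>, while the sum over \<open>f\<close> selects \<open>b = - \<gamma>\<close>. The equality of the two results contains
  the duality of finite abelian groups without any extension of characters from a
  subgroup.\<close>

theorem sum_flat_spins: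
  assumes q: "q \<ge> 2" and A: "A \<subseteq> cells (Suc j) (box_cells \<Lambda>)"
    and \<gamma>: "\<gamma> \<in> chains_on q (cells j (box_cells \<Lambda>))"
  shows "of_nat (card (bounding q A)) * (\<Sum>f\<in>spin_cochains q j (box_cells \<Lambda>). of_bool (flat_on A f) * on_chain f \<gamma>) =
    of_nat (card (spin_cochains q j (box_cells \<Lambda>))) * of_bool (\<gamma> \<in> bounding q A)"
proof -
  let ?C = "spin_cochains q j (box_cells \<Lambda>)" and ?B = "bounding q A"
  have q0: "q > 0" using q by simp
  have A_fin: "finite A" using A finite_cells_box by (rule finite_subset)
  have sub: "?B \<subseteq> chains_on q (cells j (box_cells \<Lambda>))" using A q0 by (rule bounding_box_subset)
  have B_fin: "finite {\<sigma>. b \<sigma> \<noteq> 0}" if "b \<in> ?B" for b using sub that finite_chain by blast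
  have \<gamma>_fin: "finite {\<sigma>. \<gamma> \<sigma> \<noteq> 0}" using \<gamma> by (rule finite_chain)
  have red: "x \<sigma> mod int q = x \<sigma>" if "x \<in> chains_on q (cells j (box_cells \<Lambda>))" for x \<sigma>
    using that q0 by (simp add: chains_on_def mod_functions_mod_eq)
  have "of_nat (card ?B) * (\<Sum>f\<in>?C. of_bool (flat_on A f) * on_chain f \<gamma>) = (\<Sum>f\<in>?C. on_chain f \<gamma> * (\<Sum>b\<in>?B. on_chain f b))"
    by (simp add: sum_on_chain_bounding[OF q spin_cochains_root_spins A_fin B_fin] sum_distrib_left ac_simps)
  also have "\<dots> = (\<Sum>f\<in>?C. \<Sum>b\<in>?B. on_chain f (\<lambda>\<sigma>. (\<gamma> \<sigma> + b \<sigma>) mod int q))"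
    unfolding sum_distrib_left
  proof (intro sum.cong refl)
    fix f b assume f: "f \<in> ?C" and b: "b \<in> ?B"
    have r: "f \<in> root_spins q" using f by (rule spin_cochains_root_spins)
    have nz: "\<And>\<sigma>. f \<sigma> \<noteq> 0" using root_spins_nonzero[OF q0 r] .
    have "finite {\<sigma>. \<gamma> \<sigma> + b \<sigma> \<noteq> 0}"
      by (rule finite_subset[of _ "{\<sigma>. \<gamma> \<sigma> \<noteq> 0} \<union> {\<sigma>. b \<sigma> \<noteq> 0}"]) (use B_fin[OF b] \<gamma>_fin in auto)
    then show "on_chain f \<gamma> * on_chain f b = on_chain f (\<lambda>\<sigma>. (\<gamma> \<sigma> + b \<sigma>) mod int q)"
      by (simp add: on_chain_mod[OF q0 r] on_chain_add[OF nz \<gamma>_fin B_fin[OF b]])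
  qed
  also have "\<dots> = (\<Sum>b\<in>?B. \<Sum>f\<in>?C. on_chain f (\<lambda>\<sigma>. (\<gamma> \<sigma> + b \<sigma>) mod int q))" by (rule sum.swap)
  also have "\<dots> = (\<Sum>b\<in>?B. of_nat (card ?C) * of_bool ((\<lambda>\<sigma>. (\<gamma> \<sigma> + b \<sigma>) mod int q) = (\<lambda>_. 0)))"
  proof (rule sum.cong[OF refl], rule sum_spin_cochains_on_chain[OF q0 finite_box_cells])
    fix b assume b: "b \<in> ?B"
    have "(\<lambda>\<sigma>. (\<gamma> \<sigma> - (0 - b \<sigma>) mod int q) mod int q) \<in> chains_on q (cells j (box_cells \<Lambda>))"
      using chains_on_diff[OF q0 chains_on_zero[OF q0] subsetD[OF sub b]] by (rule chains_on_diff[OF q0 \<gamma>])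
    then show "(\<lambda>\<sigma>. (\<gamma> \<sigma> + b \<sigma>) mod int q) \<in> chains_on q (cells j (box_cells \<Lambda>))"
      by (simp add: mod_diff_right_eq)
  qed
  also have "\<dots> = (\<Sum>b\<in>?B. if b = (\<lambda>\<sigma>. (- \<gamma> \<sigma>) mod int q) then of_nat (card ?C) else 0)"
  proof (rule sum.cong[OF refl])
    fix b assume b: "b \<in> ?B"
    have "(\<gamma> \<sigma> + b \<sigma>) mod int q = 0 \<longleftrightarrow> b \<sigma> = (- \<gamma> \<sigma>) mod int q" for \<sigma>
    proof
      assume "(\<gamma> \<sigma> + b \<sigma>) mod int q = 0"
      then have "((\<gamma> \<sigma> + b \<sigma>) mod int q - \<gamma> \<sigma>) mod int q = (- \<gamma> \<sigma>) mod int q" by simp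
      then show "b \<sigma> = (- \<gamma> \<sigma>) mod int q"
        using red[OF subsetD[OF sub b]] by (simp only: mod_diff_left_eq) simp
    qed (simp add: mod_add_right_eq)
    then show "of_nat (card ?C) * of_bool ((\<lambda>\<sigma>. (\<gamma> \<sigma> + b \<sigma>) mod int q) = (\<lambda>_. 0)) =
        (if b = (\<lambda>\<sigma>. (- \<gamma> \<sigma>) mod int q) then of_nat (card ?C) else (0 :: complex))"
      by (simp add: fun_eq_iff)
  qed
  also have "\<dots> = of_nat (card ?C) * of_bool ((\<lambda>\<sigma>. (- \<gamma> \<sigma>) mod int q) \<in> ?B)"
    using finite_bounding[OF A_fin q0] by simp
  also have "(\<lambda>\<sigma>. (- \<gamma> \<sigma>) mod int q) \<in> ?B \<longleftrightarrow> \<gamma> \<in> ?B"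
    using bounding_uminus[OF q0, of \<gamma> A] bounding_uminus[OF q0, of "\<lambda>\<sigma>. (- \<gamma> \<sigma>) mod int q" A]
    by (auto simp: mod_minus_eq red[OF \<gamma>])
  finally show ?thesis .
qed

lemma card_flat_spins:
  assumes q: "q \<ge> 2" and A: "A \<subseteq> cells (Suc j) (box_cells \<Lambda>)"
  shows "card (bounding q A) * card {f \<in> spin_cochains q j (box_cells \<Lambda>). flat_on A f} =
    card (spin_cochains q j (box_cells \<Lambda>))"
proof -
  let ?C = "spin_cochains q j (box_cells \<Lambda>)"
  have fin: "finite ?C" using q finite_spin_cochains[OF finite_box_cells] by simp
  have "(\<Sum>f\<in>?C. of_bool (flat_on A f) * on_chain f (\<lambda>_. 0)) = of_nat (card {f \<in> ?C. flat_on A f})"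
    using fin by (simp add: of_bool_def sum.If_cases Int_def)
  then have "(of_nat (card (bounding q A) * card {f \<in> ?C. flat_on A f}) :: complex) = of_nat (card ?C)"
    using sum_flat_spins[OF q A, of "\<lambda>_. 0"] q by simp
  then show ?thesis using of_nat_eq_iff by blast
qed

text \<open>The homology side works with residues and the gauge theory with complex roots of unity; the
  isomorphism \<open>k \<mapsto> exp (2\<pi>i k / q)\<close> matches cocycles with flat spin configurations.\<close>

lemma card_cocycles:
  assumes q: "q \<ge> 2" and XB: "cells j X = cells j (box_cells \<Lambda>)" and A: "cells (Suc j) X = A"
  shows "card (cocycles q j X) = card {f \<in> spin_cochains q j (box_cells \<Lambda>). flat_on A f}"
proof -
  have q0: "q > 0" using q by simp
  let ?z = "cis (2 * pi / real q)"
  let ?h = "\<lambda>\<phi> \<sigma>. ?z powi \<phi> \<sigma>"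
  have z: "?z ^ q = 1" "?z \<noteq> 0" using cis_root_power[OF q0] by simp_all
  have flat: "spin_coboundary (?h \<phi>) \<sigma> = ?z powi int_coboundary \<phi> \<sigma>" for \<phi> \<sigma>
  proof -
    have "?z powi (\<Sum>\<tau>\<in>F. g \<tau>) = (\<Prod>\<tau>\<in>F. ?z powi g \<tau>)" if "finite F" for F and g :: "cell \<Rightarrow> int"
      using that by (induction F rule: finite_induct) (simp_all add: power_int_add z)
    from this[OF finite_faces] show ?thesis
      by (simp add: spin_coboundary_def on_chain_def int_coboundary_def power_int_mult[symmetric] mult.commute)
  qed
  have range: "0 \<le> \<phi> \<sigma> \<and> \<phi> \<sigma> < int q" if "\<phi> \<in> cocycles q j X" for \<phi> \<sigma>
    using that q0 by (auto simp: cocycles_def cochain_group_def carrier_integer_mod_group image_subset_iff)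
  have coc_iff: "\<phi> \<in> cocycles q j X \<longleftrightarrow> (\<forall>\<sigma>. 0 \<le> \<phi> \<sigma> \<and> \<phi> \<sigma> < int q) \<and>
      (\<forall>\<sigma>. \<phi> \<sigma> \<noteq> 0 \<longrightarrow> \<sigma> \<in> cells j (box_cells \<Lambda>)) \<and> flat_on A (?h \<phi>)" for \<phi>
    using q0 by (auto simp: cocycles_def cochain_group_def carrier_integer_mod_group image_subset_iff
        subset_iff coboundary_def XB A flat_on_def flat cis_root_eq_1_iff dvd_eq_mod_eq_0 fun_eq_iff
        int_coboundary_def)
  have root: "\<exists>k. 0 \<le> k \<and> k < int q \<and> w = ?z powi k" if w: "w ^ q = 1" for w :: complex
  proof -
    have "w \<in> (\<lambda>k. cis (2 * pi * real k / real q)) ` {..<q}"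
      using bij_betw_imp_surj_on[OF Complex.bij_betw_roots_unity[OF q0]] w by simp
    then obtain k where "k < q" "w = cis (2 * pi * real k / real q)" by auto
    then show ?thesis
      by (intro exI[of _ "int k"]) (simp add: Complex.DeMoivre mult.commute)
  qed
  have "bij_betw ?h (cocycles q j X) {f \<in> spin_cochains q j (box_cells \<Lambda>). flat_on A f}"
  proof (rule bij_betwI')
    fix \<phi> \<psi> assume \<phi>: "\<phi> \<in> cocycles q j X" and \<psi>: "\<psi> \<in> cocycles q j X"
    show "?h \<phi> = ?h \<psi> \<longleftrightarrow> \<phi> = \<psi>"
    proof
      assume eq: "?h \<phi> = ?h \<psi>"
      show "\<phi> = \<psi>"
      proof
        fix \<sigma>
        have "?z powi (\<phi> \<sigma> - \<psi> \<sigma>) = 1" using fun_cong[OF eq, of \<sigma>] z by (simp add: power_int_diff)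
        then have "\<phi> \<sigma> mod int q = \<psi> \<sigma> mod int q"
          using cis_root_eq_1_iff[OF q0] by (simp add: mod_eq_dvd_iff)
        then show "\<phi> \<sigma> = \<psi> \<sigma>" using range[OF \<phi>] range[OF \<psi>] by simp
      qed
    qed simp
  next
    fix \<phi> assume "\<phi> \<in> cocycles q j X"
    then show "?h \<phi> \<in> {f \<in> spin_cochains q j (box_cells \<Lambda>). flat_on A f}"
      using z unfolding coc_iff
      by (auto simp: spin_cochains_def power_int_power' mult.commute[of _ "int q"] power_int_mult)
        (metis power_int_0_right)
  next
    fix f assume f: "f \<in> {f \<in> spin_cochains q j (box_cells \<Lambda>). flat_on A f}"
    have "\<forall>\<sigma>. \<exists>k. 0 \<le> k \<and> k < int q \<and> f \<sigma> = ?z powi k \<and> (f \<sigma> = 1 \<longrightarrow> k = 0)"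
    proof
      fix \<sigma>
      have "f \<sigma> ^ q = 1" using f spin_cochains_root_spins[of f] by (auto simp: root_spins_def)
      then show "\<exists>k. 0 \<le> k \<and> k < int q \<and> f \<sigma> = ?z powi k \<and> (f \<sigma> = 1 \<longrightarrow> k = 0)"
        using root[of "f \<sigma>"] q0 by (cases "f \<sigma> = 1") (auto intro: exI[of _ 0])
    qed
    then obtain \<phi> where \<phi>: "\<And>\<sigma>. 0 \<le> \<phi> \<sigma> \<and> \<phi> \<sigma> < int q \<and> f \<sigma> = ?z powi \<phi> \<sigma> \<and> (f \<sigma> = 1 \<longrightarrow> \<phi> \<sigma> = 0)"
      by metis
    have hf: "?h \<phi> = f" using \<phi> by auto
    have "\<phi> \<in> cocycles q j X"
      using \<phi> f unfolding coc_iff hf by (auto simp: spin_cochains_def)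
    with hf show "\<exists>\<phi>\<in>cocycles q j X. f = ?h \<phi>" by blast
  qed
  then show ?thesis by (rule bij_betw_same_card)
qed

lemma finite_cochains:
  assumes "finite (cells j X)" "q > 0"
  shows "finite (carrier (cochain_group q j X))"
proof (rule finite_subset)
  show "carrier (cochain_group q j X) \<subseteq>
      {c. \<forall>\<sigma>. (\<sigma> \<in> cells j X \<longrightarrow> c \<sigma> \<in> {0..<int q}) \<and> (\<sigma> \<notin> cells j X \<longrightarrow> c \<sigma> = 0)}"
    using assms by (auto simp: cochain_group_def carrier_integer_mod_group image_subset_iff)
  show "finite {c. \<forall>\<sigma>. (\<sigma> \<in> cells j X \<longrightarrow> c \<sigma> \<in> {0..<int q}) \<and> (\<sigma> \<notin> cells j X \<longrightarrow> c \<sigma> = 0)}"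
    by (rule finite_set_of_finite_funs) (use assms in auto)
qed

text \<open>Since the group of coboundaries does not see the random plaquettes, this reduces the order of the
  cohomology group to that of the group of cocycles.\<close>

lemma card_cohomology:
  assumes q: "q > 0" and fin: "finite (cells j X)"
    and faces: "\<And>\<sigma> \<tau>. \<sigma> \<in> cells (Suc j) X \<Longrightarrow> bd \<sigma> \<tau> \<noteq> 0 \<Longrightarrow> \<tau> \<in> X"
  shows "card (carrier (cohomology q j X)) * card (coboundaries q j X) = card (cocycles q j X)"
    and "card (coboundaries q j X) > 0" and "card (carrier (cohomology q j X)) > 0"
proof -
  let ?G = "mod_functions q :: (cell \<Rightarrow> int) monoid"
  interpret comm_group ?G using q by (rule comm_group_mod_functions)
  have carr: "\<phi> \<in> carrier (cochain_group q k X) \<longleftrightarrow>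
      \<phi> \<in> carrier ?G \<and> (\<forall>\<sigma>. \<phi> \<sigma> \<noteq> 0 \<longrightarrow> \<sigma> \<in> cells k X)" for \<phi> k
    by (auto simp: cochain_group_def mod_functions_def)
  have cob: "coboundary q k X \<phi> = (\<lambda>\<sigma>. if \<sigma> \<in> cells (Suc k) X then int_coboundary \<phi> \<sigma> mod int q else 0)" for k \<phi>
    unfolding coboundary_def int_coboundary_def by (rule refl)
  have cob_diff: "coboundary q k X (\<lambda>\<tau>. (\<phi> \<tau> - \<psi> \<tau>) mod int q) =
      (\<lambda>\<sigma>. (coboundary q k X \<phi> \<sigma> - coboundary q k X \<psi> \<sigma>) mod int q)" for k \<phi> \<psi>
    by (auto simp: cob int_coboundary_mod int_coboundary_diff mod_diff_eq)
  have diff: "(\<lambda>\<tau>. (\<phi> \<tau> - \<psi> \<tau>) mod int q) \<in> carrier (cochain_group q k X)"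
    if "\<phi> \<in> carrier (cochain_group q k X)" "\<psi> \<in> carrier (cochain_group q k X)" for k \<phi> \<psi>
    unfolding carr
  proof (intro conjI allI impI)
    fix \<sigma> assume "(\<phi> \<sigma> - \<psi> \<sigma>) mod int q \<noteq> 0"
    then have "\<phi> \<sigma> \<noteq> 0 \<or> \<psi> \<sigma> \<noteq> 0" by auto
    then show "\<sigma> \<in> cells k X" using that carr by blast
  qed (rule mod_mem_mod_functions[OF q])
  have cob0: "coboundary q k X (\<lambda>_. 0) = (\<lambda>_. 0)" for k
    by (simp add: cob int_coboundary_def fun_eq_iff)
  have zero: "(\<lambda>_. 0) \<in> carrier (cochain_group q k X)" for k using q by (simp add: carr carrier_mod_functions_iff)
  have Z: "subgroup (cocycles q j X) ?G"
    by (rule subgroup_mod_functionsI[OF q])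
      (auto simp: cocycles_def diff zero cob_diff cob0, auto simp: carr)
  have B: "subgroup (coboundaries q j X) ?G \<and> coboundaries q j X \<subseteq> cocycles q j X"
  proof (cases j)
    case 0
    then show ?thesis using subgroup.one_closed[OF Z] triv_subgroup by simp
  next
    case (Suc k)
    have closed: "coboundary q k X \<phi> \<in> cocycles q j X" if "\<phi> \<in> carrier (cochain_group q k X)" for \<phi>
    proof -
      have "int_coboundary (coboundary q k X \<phi>) \<sigma> mod int q = 0" if \<sigma>: "\<sigma> \<in> cells (Suc j) X" for \<sigma>
      proof -
        have "int_coboundary (coboundary q k X \<phi>) \<sigma> = int_coboundary (\<lambda>\<tau>. int_coboundary \<phi> \<tau> mod int q) \<sigma>"
          unfolding int_coboundary_def[of _ \<sigma>]
          using faces[OF \<sigma>] \<sigma> bd_nonzeroD(2)[of \<sigma>]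
          by (intro sum.cong refl) (auto simp: cob Suc cells_def)
        then show ?thesis by (simp add: int_coboundary_mod int_coboundary_coboundary)
      qed
      then show ?thesis
        unfolding cocycles_def mem_Collect_eq carr cob[of j]
        using q by (auto simp: cob Suc carrier_mod_functions_iff fun_eq_iff)
    qed
    have "subgroup (coboundaries q j X) ?G"
    proof (rule subgroup_mod_functionsI[OF q])
      show "coboundaries q j X \<subseteq> carrier ?G" using closed carr by (auto simp: Suc cocycles_def)
      show "(\<lambda>_. 0) \<in> coboundaries q j X"
        unfolding Suc coboundaries.simps using zero cob0 by (metis image_eqI)
      show "(\<lambda>\<sigma>. (x \<sigma> - y \<sigma>) mod int q) \<in> coboundaries q j X"
        if "x \<in> coboundaries q j X" "y \<in> coboundaries q j X" for x y
        using that diff unfolding Suc coboundaries.simps by (auto simp flip: cob_diff)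
    qed
    then show ?thesis using closed by (auto simp: Suc)
  qed
  interpret Z: group "?G\<lparr>carrier := cocycles q j X\<rparr>" using Z by (rule subgroup_imp_group)
  have "subgroup (coboundaries q j X) (?G\<lparr>carrier := cocycles q j X\<rparr>)"
    using subgroup_incl Z B by blast
  moreover have "?G\<lparr>carrier := cocycles q j X\<rparr> = (cochain_group q j X)\<lparr>carrier := cocycles q j X\<rparr>"
    by (simp add: mod_functions_def cochain_group_def)
  ultimately show eq: "card (carrier (cohomology q j X)) * card (coboundaries q j X) = card (cocycles q j X)"
    using Z.lagrange[of "coboundaries q j X"] by (simp add: cohomology_def FactGroup_def order_def)
  have "finite (cocycles q j X)"
    using finite_cochains[OF fin q] by (auto simp: cocycles_def)
  then have "card (cocycles q j X) > 0" using subgroup.one_closed[OF Z] card_gt_0_iff by blast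
  then show "card (coboundaries q j X) > 0" "card (carrier (cohomology q j X)) > 0"
    using eq by (metis mult_is_0 neq0_conv)+
qed

section \<open>The Edwards-Sokal representation on a box\<close>

definition boundary_plaquettes :: "boundary_condition \<Rightarrow> nat \<Rightarrow> box \<Rightarrow> cell set" where
  "boundary_plaquettes bc i \<Lambda> = cells i (with_boundary bc \<Lambda> {})"

lemma cells_with_boundary:
  "cells i (with_boundary bc \<Lambda> P) = cells i P \<union> boundary_plaquettes bc i \<Lambda>"
  by (cases bc) (auto simp: boundary_plaquettes_def cells_def)

lemma boundary_plaquettes_subset: "boundary_plaquettes bc i \<Lambda> \<subseteq> cells i (box_cells \<Lambda>)"
  using box_boundary_subset by (cases bc) (auto simp: boundary_plaquettes_def cells_def)

text \<open>Here \<open>S\<close> is the set of all plaquettes of a box, \<open>T\<close> the set of those that the boundary condition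
  adds, and \<open>A\<close> the set of open ones. Up to a constant factor this is the weight of the random cluster
  model, with the order of the cohomology group expressed through boundaries.\<close>

definition rc_weight :: "nat \<Rightarrow> real \<Rightarrow> cell set \<Rightarrow> cell set \<Rightarrow> cell set \<Rightarrow> real" where
  "rc_weight q p S T A = p ^ card A * (1 - p) ^ (card S - card A) / card (bounding q (A \<union> T))"

definition rc_mean :: "nat \<Rightarrow> real \<Rightarrow> cell set \<Rightarrow> cell set \<Rightarrow> (cell set \<Rightarrow> real) \<Rightarrow> real" where
  "rc_mean q p S T h = (\<Sum>A\<in>Pow S. rc_weight q p S T A * h A) / (\<Sum>A\<in>Pow S. rc_weight q p S T A)"

lemma rc_weight_nonneg: "0 \<le> p \<Longrightarrow> p \<le> 1 \<Longrightarrow> 0 \<le> rc_weight q p S T A"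
  by (simp add: rc_weight_def)

lemma sum_rc_weight_pos:
  assumes "0 \<le> p" "p < 1" "q > 0" "finite S" "finite T"
  shows "0 < (\<Sum>A\<in>Pow S. rc_weight q p S T A)"
proof (rule sum_pos2)
  show "0 < rc_weight q p S T {}"
    using assms card_bounding_pos[of T q] by (simp add: rc_weight_def)
qed (use assms rc_weight_nonneg in auto)

lemma pmf_gibbs:
  assumes fin: "finite A" and nonneg: "\<And>x. x \<in> A \<Longrightarrow> 0 \<le> w x" and pos: "0 < sum w A"
  shows "pmf (gibbs A w) x = (if x \<in> A then w x / sum w A else 0)"
  unfolding gibbs_def
proof (rule pmf_embed_pmf)
  show "0 \<le> (if x \<in> A then w x / sum w A else 0)" for x using nonneg pos by simp
  have "(\<integral>\<^sup>+ x. ennreal (if x \<in> A then w x / sum w A else 0) \<partial>count_space UNIV) =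
      (\<integral>\<^sup>+ x. ennreal (w x / sum w A) \<partial>count_space A)"
    by (subst nn_integral_count_space_indicator)
      (auto intro!: nn_integral_cong split: split_indicator)
  also have "\<dots> = (\<Sum>x\<in>A. ennreal (w x / sum w A))" by (rule nn_integral_count_space_finite[OF fin])
  also have "\<dots> = ennreal (\<Sum>x\<in>A. w x / sum w A)" using nonneg pos by (intro sum_ennreal) auto
  also have "(\<Sum>x\<in>A. w x / sum w A) = 1" using pos by (simp flip: sum_divide_distrib)
  finally show "(\<integral>\<^sup>+ x. ennreal (if x \<in> A then w x / sum w A else 0) \<partial>count_space UNIV) = 1" by simp
qed

lemma expectation_gibbs:
  fixes g :: "'a \<Rightarrow> 'b::{banach, second_countable_topology}"
  assumes fin: "finite A" and nonneg: "\<And>x. x \<in> A \<Longrightarrow> 0 \<le> w x" and pos: "0 < sum w A"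
  shows "measure_pmf.expectation (gibbs A w) g = (\<Sum>x\<in>A. (w x / sum w A) *\<^sub>R g x)"
proof -
  have "measure_pmf.expectation (gibbs A w) g = (\<Sum>x\<in>A. pmf (gibbs A w) x *\<^sub>R g x)"
    by (rule integral_measure_pmf[OF fin]) (auto simp: set_pmf_iff pmf_gibbs[OF assms] split: if_splits)
  then show ?thesis by (simp add: pmf_gibbs[OF assms])
qed

lemma set_pmf_gibbs:
  assumes "finite A" and "\<And>x. x \<in> A \<Longrightarrow> 0 \<le> w x" and "0 < sum w A"
  shows "set_pmf (gibbs A w) \<subseteq> A"
  by (auto simp: set_pmf_iff pmf_gibbs[OF assms] split: if_splits)

lemma of_real_of_bool: "complex_of_real (of_bool P) = of_bool P"
  by simp

text \<open>After multiplication by \<open>exp (- \<beta>)\<close> per plaquette, the Boltzmann factor of a plaquette equals 1 if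
  the plaquette is flat and \<open>exp (- \<beta>) = 1 - p\<close> otherwise. Writing it as \<open>p [flat] + (1 - p)\<close> and
  expanding the product opens each flat plaquette independently with probability \<open>p\<close>.\<close>

lemma plgt_weight_expansion:
  fixes j :: nat and \<beta> :: real and \<Lambda> :: box and bc :: boundary_condition
  assumes p: "p = 1 - exp (- \<beta>)"
  defines "S \<equiv> cells (Suc j) (box_cells \<Lambda>)" and "T \<equiv> boundary_plaquettes bc (Suc j) \<Lambda>"
  shows "exp (- \<beta> * card S) * plgt_weight bc \<Lambda> \<beta> j f =
    (\<Sum>A\<in>Pow S. p ^ card A * (1 - p) ^ (card S - card A) * of_bool (flat_on (A \<union> T) f))"
proof -
  have S: "finite S" by (simp add: S_def)
  let ?g = "\<lambda>\<sigma>. of_bool (spin_coboundary f \<sigma> = 1) :: real"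
  have wt: "plgt_weight bc \<Lambda> \<beta> j f = of_bool (flat_on T f) * exp (- \<beta> * plgt_energy \<Lambda> j f)"
    by (cases bc) (auto simp: T_def boundary_plaquettes_def flat_on_def cells_def)
  have "exp (- \<beta> * card S) * exp (- \<beta> * plgt_energy \<Lambda> j f) = exp (\<Sum>\<sigma>\<in>S. - \<beta> * (1 - ?g \<sigma>))"
    by (simp add: plgt_energy_def S_def[symmetric] right_diff_distrib sum_subtractf sum_distrib_left
        sum_negf flip: exp_add)
  also have "\<dots> = (\<Prod>\<sigma>\<in>S. exp (- \<beta> * (1 - ?g \<sigma>)))" by (rule exp_sum[OF S])
  also have "\<dots> = (\<Prod>\<sigma>\<in>S. p * ?g \<sigma> + (1 - p))"
    by (rule prod.cong) (auto simp: p)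
  also have "\<dots> = (\<Sum>A\<in>Pow S. (\<Prod>\<sigma>\<in>A. p * ?g \<sigma>) * (\<Prod>\<sigma>\<in>S - A. 1 - p))" by (rule prod_add[OF S])
  also have "\<dots> = (\<Sum>A\<in>Pow S. p ^ card A * (1 - p) ^ (card S - card A) * of_bool (flat_on A f))"
  proof (rule sum.cong[OF refl])
    fix A assume "A \<in> Pow S"
    then have A: "A \<subseteq> S" "finite A" using S finite_subset by auto
    have "(\<Prod>\<sigma>\<in>A. p * ?g \<sigma>) = p ^ card A * of_bool (flat_on A f)"
      using A(2) by (simp add: prod.distrib flat_on_def)
    then show "(\<Prod>\<sigma>\<in>A. p * ?g \<sigma>) * (\<Prod>\<sigma>\<in>S - A. 1 - p) =
        p ^ card A * (1 - p) ^ (card S - card A) * of_bool (flat_on A f)"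
      using A by (simp add: card_Diff_subset)
  qed
  finally have "exp (- \<beta> * card S) * plgt_weight bc \<Lambda> \<beta> j f = of_bool (flat_on T f) *
      (\<Sum>A\<in>Pow S. p ^ card A * (1 - p) ^ (card S - card A) * of_bool (flat_on A f))"
    by (simp add: wt)
  also have "\<dots> = (\<Sum>A\<in>Pow S. p ^ card A * (1 - p) ^ (card S - card A) * of_bool (flat_on (A \<union> T) f))"
    unfolding sum_distrib_left by (rule sum.cong) (auto simp: flat_on_def)
  finally show ?thesis .
qed

lemma plgt_weight_nonneg: "0 \<le> plgt_weight bc \<Lambda> \<beta> j f"
  by (cases bc) auto

lemma sum_plgt_weight_on_chain:
  fixes j :: nat and \<beta> :: real and \<Lambda> :: box and bc :: boundary_condition
  assumes q: "q \<ge> 2" and p: "p = 1 - exp (- \<beta>)" and \<gamma>: "\<gamma> \<in> chains_on q (cells j (box_cells \<Lambda>))"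
  defines "S \<equiv> cells (Suc j) (box_cells \<Lambda>)" and "T \<equiv> boundary_plaquettes bc (Suc j) \<Lambda>"
    and "C \<equiv> spin_cochains q j (box_cells \<Lambda>)"
  shows "exp (- \<beta> * card S) * (\<Sum>f\<in>C. plgt_weight bc \<Lambda> \<beta> j f * on_chain f \<gamma>) =
    of_nat (card C) * complex_of_real (\<Sum>A\<in>Pow S. rc_weight q p S T A * of_bool (\<gamma> \<in> bounding q (A \<union> T)))"
proof -
  let ?u = "\<lambda>A. p ^ card A * (1 - p) ^ (card S - card A)"
  have q0: "q > 0" using q by simp
  have "exp (- \<beta> * card S) * (\<Sum>f\<in>C. plgt_weight bc \<Lambda> \<beta> j f * on_chain f \<gamma>) =
      (\<Sum>f\<in>C. complex_of_real (exp (- \<beta> * card S) * plgt_weight bc \<Lambda> \<beta> j f) * on_chain f \<gamma>)"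
    by (simp add: sum_distrib_left ac_simps)
  also have "\<dots> = (\<Sum>f\<in>C. \<Sum>A\<in>Pow S. ?u A * (of_bool (flat_on (A \<union> T) f) * on_chain f \<gamma>))"
    unfolding plgt_weight_expansion[OF p, of j \<Lambda> bc, folded S_def T_def]
    by (simp add: sum_distrib_right sum_distrib_left ac_simps of_real_of_bool)
  also have "\<dots> = (\<Sum>A\<in>Pow S. ?u A * (\<Sum>f\<in>C. of_bool (flat_on (A \<union> T) f) * on_chain f \<gamma>))"
    by (subst sum.swap) (simp add: sum_distrib_left)
  also have "\<dots> = (\<Sum>A\<in>Pow S. of_nat (card C) * complex_of_real (rc_weight q p S T A * of_bool (\<gamma> \<in> bounding q (A \<union> T))))"
  proof (rule sum.cong[OF refl])
    fix A assume "A \<in> Pow S"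
    then have AT: "A \<union> T \<subseteq> cells (Suc j) (box_cells \<Lambda>)"
      using boundary_plaquettes_subset by (auto simp: S_def T_def)
    then have "card (bounding q (A \<union> T)) > 0"
      using q0 finite_subset[OF AT finite_cells_box] by (simp add: card_bounding_pos)
    then have "(\<Sum>f\<in>C. of_bool (flat_on (A \<union> T) f) * on_chain f \<gamma>) =
        of_nat (card C) * of_bool (\<gamma> \<in> bounding q (A \<union> T)) / of_nat (card (bounding q (A \<union> T)))"
      using sum_flat_spins[OF q AT \<gamma>] by (simp add: C_def field_simps)
    then show "?u A * (\<Sum>f\<in>C. of_bool (flat_on (A \<union> T) f) * on_chain f \<gamma>) =
        of_nat (card C) * complex_of_real (rc_weight q p S T A * of_bool (\<gamma> \<in> bounding q (A \<union> T)))"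
      by (simp add: rc_weight_def)
  qed
  also have "\<dots> = of_nat (card C) * complex_of_real (\<Sum>A\<in>Pow S. rc_weight q p S T A * of_bool (\<gamma> \<in> bounding q (A \<union> T)))"
    by (simp add: sum_distrib_left)
  finally show ?thesis .
qed

lemma sum_plgt_weight_pos:
  assumes q: "q > 0"
  shows "0 < (\<Sum>f\<in>spin_cochains q j (box_cells \<Lambda>). plgt_weight bc \<Lambda> \<beta> j f)"
proof (rule sum_pos2)
  show "finite (spin_cochains q j (box_cells \<Lambda>))" using q by (simp add: finite_spin_cochains finite_box_cells)
  show "(\<lambda>_. 1) \<in> spin_cochains q j (box_cells \<Lambda>)" by (simp add: spin_cochains_def)
  show "0 < plgt_weight bc \<Lambda> \<beta> j (\<lambda>_. 1)"
    by (cases bc) (auto simp: spin_coboundary_def on_chain_def)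
qed (rule plgt_weight_nonneg)

theorem expectation_wilson:
  fixes j :: nat and \<beta> :: real and \<Lambda> :: box and bc :: boundary_condition
  assumes q: "q \<ge> 2" and p: "p = 1 - exp (- \<beta>)" and \<gamma>: "\<gamma> \<in> chains_on q (cells j (box_cells \<Lambda>))"
  defines "S \<equiv> cells (Suc j) (box_cells \<Lambda>)" and "T \<equiv> boundary_plaquettes bc (Suc j) \<Lambda>"
  shows "measure_pmf.expectation (plgt_box bc \<Lambda> \<beta> q j) (wilson \<gamma>) =
    complex_of_real (rc_mean q p S T (\<lambda>A. of_bool (\<gamma> \<in> bounding q (A \<union> T))))"
proof -
  have q0: "q > 0" using q by simp
  define C where "C = spin_cochains q j (box_cells \<Lambda>)"
  define w where "w = plgt_weight bc \<Lambda> \<beta> j"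
  define Z where "Z = sum w C"
  define k where "k = exp (- \<beta> * card S)"
  define R where "R = (\<Sum>A\<in>Pow S. rc_weight q p S T A)"
  define N where "N = (\<Sum>A\<in>Pow S. rc_weight q p S T A * of_bool (\<gamma> \<in> bounding q (A \<union> T)))"
  have fin: "finite C" using q0 by (simp add: C_def finite_spin_cochains finite_box_cells)
  have Z: "Z > 0" using sum_plgt_weight_pos[OF q0] by (simp add: Z_def w_def C_def)
  have k: "k > 0" by (simp add: k_def)
  have num: "k * (\<Sum>f\<in>C. w f * on_chain f \<gamma>) = of_nat (card C) * complex_of_real N"
    using sum_plgt_weight_on_chain[OF q p \<gamma>, of bc] by (simp add: k_def w_def C_def S_def T_def N_def)
  have "complex_of_real (k * Z) = complex_of_real (card C * R)"
    using sum_plgt_weight_on_chain[OF q p chains_on_zero[OF q0], of j \<Lambda> bc] bounding_zero[OF q0]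
    by (simp add: k_def w_def C_def S_def T_def R_def Z_def)
  then have den: "k * Z = card C * R" by (simp only: of_real_eq_iff)
  have "measure_pmf.expectation (plgt_box bc \<Lambda> \<beta> q j) (wilson \<gamma>) = (\<Sum>f\<in>C. (w f / Z) *\<^sub>R on_chain f \<gamma>)"
    unfolding plgt_box_def wilson_def using expectation_gibbs[OF fin, of w] Z plgt_weight_nonneg
    by (simp add: C_def w_def Z_def)
  also have "\<dots> = (k * (\<Sum>f\<in>C. w f * on_chain f \<gamma>)) / complex_of_real (k * Z)"
    using k Z by (simp add: scaleR_conv_of_real sum_distrib_left sum_divide_distrib)
  also have "\<dots> = of_nat (card C) * complex_of_real N / complex_of_real (card C * R)" by (simp only: num den)
  also have "\<dots> = complex_of_real (N / R)"
    using den k Z by (auto simp: field_simps)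
  finally show ?thesis by (simp add: rc_mean_def N_def R_def)
qed

lemma set_pmf_plgt_box:
  assumes "q > 0"
  shows "set_pmf (plgt_box bc \<Lambda> \<beta> q j) \<subseteq> spin_cochains q j (box_cells \<Lambda>)"
  unfolding plgt_box_def using assms
  by (intro set_pmf_gibbs plgt_weight_nonneg sum_plgt_weight_pos) (simp_all add: finite_spin_cochains finite_box_cells)

section \<open>The random cluster model as a law on sets of plaquettes\<close>

lemma percolation_subcomplex_plaquettes:
  "bij_betw (\<lambda>\<omega>. cells i (Collect \<omega>)) {\<omega>. Collect \<omega> \<in> percolation_subcomplexes i X} (Pow (cells i X))"
proof (rule bij_betw_byWitness[where f' = "\<lambda>A \<sigma>. \<sigma> \<in> A \<or> \<sigma> \<in> X \<and> cell_dim \<sigma> < i"])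
  show "\<forall>\<omega>\<in>{\<omega>. Collect \<omega> \<in> percolation_subcomplexes i X}.
      (\<lambda>\<sigma>. \<sigma> \<in> cells i (Collect \<omega>) \<or> \<sigma> \<in> X \<and> cell_dim \<sigma> < i) = \<omega>"
  proof (intro ballI ext)
    fix \<omega> \<sigma> assume "\<omega> \<in> {\<omega>. Collect \<omega> \<in> percolation_subcomplexes i X}"
    then have "\<omega> \<sigma> \<Longrightarrow> \<sigma> \<in> X \<and> cell_dim \<sigma> \<le> i" "\<sigma> \<in> X \<Longrightarrow> cell_dim \<sigma> < i \<Longrightarrow> \<omega> \<sigma>"
      by (auto simp: percolation_subcomplexes_def)
    then show "(\<sigma> \<in> cells i (Collect \<omega>) \<or> \<sigma> \<in> X \<and> cell_dim \<sigma> < i) = \<omega> \<sigma>"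
      by (auto simp: cells_def)
  qed
qed (auto simp: cells_def percolation_subcomplexes_def)

text \<open>The order of the cohomology group is that of the group of cocycles divided by that of the group of
  coboundaries. The latter is the same for all percolation subcomplexes because they share their
  cells of dimension less than \<open>Suc j\<close>, and the former is inversely proportional to the number of
  boundaries by \<open>card_flat_spins\<close>.\<close>

lemma prcm_weight_eq:
  fixes j :: nat and \<Lambda> :: box and bc :: boundary_condition
  assumes q: "q \<ge> 2" and P: "P \<in> percolation_subcomplexes (Suc j) (box_cells \<Lambda>)"
  defines "S \<equiv> cells (Suc j) (box_cells \<Lambda>)" and "T \<equiv> boundary_plaquettes bc (Suc j) \<Lambda>"
  shows "prcm_weight bc \<Lambda> p q (Suc j) P =
    card (spin_cochains q j (box_cells \<Lambda>)) / card (coboundaries q j (box_cells \<Lambda>)) *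
    rc_weight q p S T (cells (Suc j) P)"
    and "card (coboundaries q j (box_cells \<Lambda>)) > 0"
proof -
  let ?X = "with_boundary bc \<Lambda> P"
  have q0: "q > 0" using q by simp
  have low: "cells k ?X = cells k (box_cells \<Lambda>)" if "k \<le> j" for k
    using P that box_boundary_subset by (cases bc) (auto simp: percolation_subcomplexes_def cells_def)
  have AT: "cells (Suc j) P \<union> T \<subseteq> S"
    using boundary_plaquettes_subset P by (auto simp: T_def S_def percolation_subcomplexes_def cells_def)
  have faces: "\<tau> \<in> ?X" if "\<sigma> \<in> cells (Suc j) ?X" "bd \<sigma> \<tau> \<noteq> 0" for \<sigma> \<tau>
  proof -
    have "\<sigma> \<in> S" using that(1) AT cells_with_boundary[of "Suc j" bc \<Lambda> P] by (auto simp: T_def)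
    then have "\<tau> \<in> cells j (box_cells \<Lambda>)"
      using that(2) bd_nonzeroD(2)[OF that(2)] box_cells_face by (auto simp: S_def cells_def)
    then show ?thesis using low[of j] by (auto simp: cells_def)
  qed
  have cob: "coboundaries q j ?X = coboundaries q j (box_cells \<Lambda>)"
  proof (cases j)
    case (Suc k)
    have "coboundary q k ?X = coboundary q k (box_cells \<Lambda>)"
      using low[of j] by (simp add: fun_eq_iff coboundary_def Suc)
    moreover have "carrier (cochain_group q k ?X) = carrier (cochain_group q k (box_cells \<Lambda>))"
      using low[of k] by (simp add: cochain_group_def Suc)
    ultimately show ?thesis by (simp add: Suc)
  qed simp
  have fin: "finite (cells j ?X)" using low[of j] by simp
  have coh: "card (carrier (cohomology q j ?X)) * card (coboundaries q j ?X) = card (cocycles q j ?X)"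
    by (rule card_cohomology(1)[OF q0 fin]) (rule faces)
  have "card (coboundaries q j ?X) > 0" by (rule card_cohomology(2)[OF q0 fin]) (rule faces)
  then show pos: "card (coboundaries q j (box_cells \<Lambda>)) > 0" by (simp only: cob)
  have flat: "card (cocycles q j ?X) * card (bounding q (cells (Suc j) P \<union> T)) = card (spin_cochains q j (box_cells \<Lambda>))"
    using card_flat_spins[OF q, of "cells (Suc j) P \<union> T" j \<Lambda>] AT
      card_cocycles[OF q low[OF le_refl], of "cells (Suc j) P \<union> T"] cells_with_boundary[of "Suc j" bc \<Lambda> P]
    by (simp add: T_def S_def mult.commute)
  have "card (bounding q (cells (Suc j) P \<union> T)) > 0"
    using q0 finite_subset[OF AT[unfolded S_def] finite_cells_box] by (simp add: card_bounding_pos)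
  moreover have "real (card (carrier (cohomology q j ?X))) * card (coboundaries q j (box_cells \<Lambda>)) *
      card (bounding q (cells (Suc j) P \<union> T)) = card (spin_cochains q j (box_cells \<Lambda>))"
    using coh flat by (simp only: cob flip: of_nat_mult)
  ultimately have "real (card (carrier (cohomology q j ?X))) =
      card (spin_cochains q j (box_cells \<Lambda>)) / card (coboundaries q j (box_cells \<Lambda>)) /
      card (bounding q (cells (Suc j) P \<union> T))"
    using pos by (simp add: field_simps)
  then show "prcm_weight bc \<Lambda> p q (Suc j) P =
    card (spin_cochains q j (box_cells \<Lambda>)) / card (coboundaries q j (box_cells \<Lambda>)) *
    rc_weight q p S T (cells (Suc j) P)"
    by (simp add: prcm_weight_def rc_weight_def S_def)
qed

theorem expectation_prcm:
  fixes j :: nat and \<Lambda> :: box and bc :: boundary_condition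
  assumes q: "q \<ge> 2" and p: "0 \<le> p" "p < 1"
  defines "S \<equiv> cells (Suc j) (box_cells \<Lambda>)" and "T \<equiv> boundary_plaquettes bc (Suc j) \<Lambda>"
  shows "measure_pmf.expectation (prcm_box bc \<Lambda> p q (Suc j)) (\<lambda>\<omega>. h (cells (Suc j) (Collect \<omega>))) = rc_mean q p S T h"
    and "set_pmf (prcm_box bc \<Lambda> p q (Suc j)) \<subseteq> {\<omega>. Collect \<omega> \<in> percolation_subcomplexes (Suc j) (box_cells \<Lambda>)}"
proof -
  let ?\<Omega> = "{\<omega>. Collect \<omega> \<in> percolation_subcomplexes (Suc j) (box_cells \<Lambda>)}"
  let ?w = "\<lambda>\<omega>. prcm_weight bc \<Lambda> p q (Suc j) (Collect \<omega>)"
  define k where "k = real (card (spin_cochains q j (box_cells \<Lambda>))) / card (coboundaries q j (box_cells \<Lambda>))"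
  have q0: "q > 0" using q by simp
  have bij: "bij_betw (\<lambda>\<omega>. cells (Suc j) (Collect \<omega>)) ?\<Omega> (Pow S)"
    unfolding S_def by (rule percolation_subcomplex_plaquettes)
  have fin: "finite ?\<Omega>" using bij_betw_finite[OF bij] by (simp add: S_def)
  have w: "?w \<omega> = k * rc_weight q p S T (cells (Suc j) (Collect \<omega>))" if "\<omega> \<in> ?\<Omega>" for \<omega>
    using prcm_weight_eq(1)[OF q, of "Collect \<omega>" j \<Lambda>] that by (simp add: k_def S_def T_def)
  have sum: "(\<Sum>\<omega>\<in>?\<Omega>. ?w \<omega> * g (cells (Suc j) (Collect \<omega>))) = k * (\<Sum>A\<in>Pow S. rc_weight q p S T A * g A)" for g
  proof -
    have "(\<Sum>\<omega>\<in>?\<Omega>. ?w \<omega> * g (cells (Suc j) (Collect \<omega>))) =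
        (\<Sum>\<omega>\<in>?\<Omega>. (\<lambda>A. k * (rc_weight q p S T A * g A)) (cells (Suc j) (Collect \<omega>)))"
      by (rule sum.cong[OF refl]) (simp add: w)
    also have "\<dots> = (\<Sum>A\<in>Pow S. k * (rc_weight q p S T A * g A))" by (rule sum.reindex_bij_betw[OF bij])
    finally show ?thesis by (simp add: sum_distrib_left)
  qed
  have "box_cells \<Lambda> \<inter> {\<sigma>. cell_dim \<sigma> \<le> j} \<in> percolation_subcomplexes (Suc j) (box_cells \<Lambda>)"
    by (auto simp: percolation_subcomplexes_def)
  from prcm_weight_eq(2)[OF q this] have "card (coboundaries q j (box_cells \<Lambda>)) > 0" .
  moreover have "card (spin_cochains q j (box_cells \<Lambda>)) > 0"
  proof -
    have "(\<lambda>_. 1) \<in> spin_cochains q j (box_cells \<Lambda>)" by (simp add: spin_cochains_def)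
    then show ?thesis using finite_spin_cochains[OF finite_box_cells q0] card_gt_0_iff by blast
  qed
  ultimately have k: "k > 0" by (simp add: k_def)
  have R: "0 < (\<Sum>A\<in>Pow S. rc_weight q p S T A)"
    using p q0 boundary_plaquettes_subset[of bc "Suc j" \<Lambda>]
    by (intro sum_rc_weight_pos) (simp_all add: S_def T_def finite_subset[OF _ finite_cells_box])
  have Z: "sum ?w ?\<Omega> = k * (\<Sum>A\<in>Pow S. rc_weight q p S T A)" using sum[of "\<lambda>_. 1"] by (simp only: mult_1_right)
  have nonneg: "0 \<le> ?w \<omega>" for \<omega>
    unfolding prcm_weight_def using p by (intro mult_nonneg_nonneg) simp_all
  have pos: "0 < sum ?w ?\<Omega>" unfolding Z using k R by (rule mult_pos_pos)
  show "measure_pmf.expectation (prcm_box bc \<Lambda> p q (Suc j)) (\<lambda>\<omega>. h (cells (Suc j) (Collect \<omega>))) = rc_mean q p S T h"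
  proof -
    have "measure_pmf.expectation (prcm_box bc \<Lambda> p q (Suc j)) (\<lambda>\<omega>. h (cells (Suc j) (Collect \<omega>))) =
        (\<Sum>\<omega>\<in>?\<Omega>. ?w \<omega> * h (cells (Suc j) (Collect \<omega>))) / sum ?w ?\<Omega>"
      unfolding prcm_box_def expectation_gibbs[OF fin nonneg pos] sum_divide_distrib
      by (simp only: real_scaleR_def times_divide_eq_left)
    also have "\<dots> = k * (\<Sum>A\<in>Pow S. rc_weight q p S T A * h A) / (k * (\<Sum>A\<in>Pow S. rc_weight q p S T A))"
      by (simp only: sum[of h] Z)
    finally show ?thesis using k by (simp add: rc_mean_def)
  qed
  show "set_pmf (prcm_box bc \<Lambda> p q (Suc j)) \<subseteq> ?\<Omega>"
    unfolding prcm_box_def by (rule set_pmf_gibbs[OF fin nonneg pos])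
qed

section \<open>Monotonicity in the volume\<close>

text \<open>With \<open>u = c1 * d0\<close>, the product of the middle terms \<open>v = a0 * b1\<close> and \<open>w = a1 * b0\<close> is at most
  \<open>u * (c0 * d1)\<close> by the outer inequalities, and \<open>(u - v) (u - w) \<ge> 0\<close> gives \<open>v + w \<le> u + v w / u\<close>.\<close>

lemma four_functions_one_point:
  fixes a0 a1 b0 b1 c0 c1 d0 d1 :: real
  assumes nonneg: "0 \<le> a0" "0 \<le> a1" "0 \<le> b0" "0 \<le> b1" "0 \<le> c0" "0 \<le> c1" "0 \<le> d0" "0 \<le> d1"
    and le: "a0 * b0 \<le> c0 * d0" "a0 * b1 \<le> c1 * d0" "a1 * b0 \<le> c1 * d0" "a1 * b1 \<le> c1 * d1"
  shows "(a0 + a1) * (b0 + b1) \<le> (c0 + c1) * (d0 + d1)"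
proof (cases "c1 * d0 = 0")
  case True
  then have "a0 * b1 \<le> 0" "a1 * b0 \<le> 0" using le(2,3) by (simp_all only: True)
  moreover have "0 \<le> c0 * d1" using nonneg by simp
  ultimately show ?thesis using le(1,4) True unfolding distrib_left distrib_right by linarith
next
  case False
  define u where "u = c1 * d0"
  have u: "u > 0" using False nonneg by (simp add: u_def less_le)
  have "(a0 * b1) * (a1 * b0) = (a0 * b0) * (a1 * b1)" by (simp add: ac_simps)
  also have "\<dots> \<le> (c0 * d0) * (c1 * d1)"
    by (rule mult_mono[OF le(1,4)]) (use nonneg in auto)
  also have "\<dots> = u * (c0 * d1)" by (simp add: u_def ac_simps)
  finally have prod: "(a0 * b1) * (a1 * b0) \<le> u * (c0 * d1)" .
  have "0 \<le> (u - a0 * b1) * (u - a1 * b0)" using le by (simp add: u_def)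
  then have "u * (a0 * b1 + a1 * b0) \<le> u * u + (a0 * b1) * (a1 * b0)" by (simp add: algebra_simps)
  also have "\<dots> \<le> u * (u + c0 * d1)" using prod by (simp add: algebra_simps)
  finally have "a0 * b1 + a1 * b0 \<le> u + c0 * d1" using u by simp
  then show ?thesis using le(1,4) by (simp add: u_def algebra_simps)
qed

lemma sum_Pow_insert:
  assumes "finite S" "x \<notin> S"
  shows "(\<Sum>A\<in>Pow (insert x S). f A) = (\<Sum>A\<in>Pow S. f A + f (insert x A))"
proof -
  have "(\<Sum>A\<in>Pow (insert x S). f A) = (\<Sum>A\<in>Pow S. f A) + (\<Sum>A\<in>insert x ` Pow S. f A)"
    unfolding Pow_insert by (rule sum.union_disjoint) (use assms in auto)
  also have "(\<Sum>A\<in>insert x ` Pow S. f A) = (\<Sum>A\<in>Pow S. f (insert x A))"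
  proof (subst sum.reindex)
    show "inj_on (insert x) (Pow S)" using assms(2) by (intro inj_onI) (metis PowD insert_ident subsetD)
  qed simp
  finally show ?thesis by (simp add: sum.distrib)
qed

text \<open>The theorem of Ahlswede and Daykin. Summing out one point preserves the hypothesis by the one-point
  case.\<close>

theorem four_functions:
  fixes \<alpha> \<beta> \<gamma> \<delta> :: "'a set \<Rightarrow> real"
  assumes "finite S"
    and "\<And>A. A \<subseteq> S \<Longrightarrow> 0 \<le> \<alpha> A \<and> 0 \<le> \<beta> A \<and> 0 \<le> \<gamma> A \<and> 0 \<le> \<delta> A"
    and "\<And>A B. A \<subseteq> S \<Longrightarrow> B \<subseteq> S \<Longrightarrow> \<alpha> A * \<beta> B \<le> \<gamma> (A \<union> B) * \<delta> (A \<inter> B)"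
  shows "(\<Sum>A\<in>Pow S. \<alpha> A) * (\<Sum>A\<in>Pow S. \<beta> A) \<le> (\<Sum>A\<in>Pow S. \<gamma> A) * (\<Sum>A\<in>Pow S. \<delta> A)"
  using assms
proof (induction S arbitrary: \<alpha> \<beta> \<gamma> \<delta> rule: finite_induct)
  case empty
  then show ?case by simp
next
  case (insert x S)
  have sub: "A \<subseteq> insert x S" "insert x A \<subseteq> insert x S" if "A \<subseteq> S" for A using that by auto
  show ?case
    unfolding sum_Pow_insert[OF insert.hyps]
  proof (rule insert.IH)
    show "0 \<le> \<alpha> A + \<alpha> (insert x A) \<and> 0 \<le> \<beta> A + \<beta> (insert x A) \<and>
        0 \<le> \<gamma> A + \<gamma> (insert x A) \<and> 0 \<le> \<delta> A + \<delta> (insert x A)" if "A \<subseteq> S" for A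
      using insert.prems(1)[OF sub(1)[OF that]] insert.prems(1)[OF sub(2)[OF that]] by simp
    fix A B assume A: "A \<subseteq> S" and B: "B \<subseteq> S"
    then have AB: "A \<union> B \<subseteq> S" "A \<inter> B \<subseteq> S" and x: "x \<notin> A" "x \<notin> B" using insert.hyps(2) by auto
    show "(\<alpha> A + \<alpha> (insert x A)) * (\<beta> B + \<beta> (insert x B)) \<le>
        (\<gamma> (A \<union> B) + \<gamma> (insert x (A \<union> B))) * (\<delta> (A \<inter> B) + \<delta> (insert x (A \<inter> B)))"
    proof (rule four_functions_one_point)
      show "\<alpha> A * \<beta> B \<le> \<gamma> (A \<union> B) * \<delta> (A \<inter> B)"
        using insert.prems(2)[OF sub(1)[OF A] sub(1)[OF B]] .
      show "\<alpha> A * \<beta> (insert x B) \<le> \<gamma> (insert x (A \<union> B)) * \<delta> (A \<inter> B)"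
        using insert.prems(2)[OF sub(1)[OF A] sub(2)[OF B]] x by simp
      show "\<alpha> (insert x A) * \<beta> B \<le> \<gamma> (insert x (A \<union> B)) * \<delta> (A \<inter> B)"
        using insert.prems(2)[OF sub(2)[OF A] sub(1)[OF B]] x by simp
      show "\<alpha> (insert x A) * \<beta> (insert x B) \<le> \<gamma> (insert x (A \<union> B)) * \<delta> (insert x (A \<inter> B))"
        using insert.prems(2)[OF sub(2)[OF A] sub(2)[OF B]] by simp
    qed (use insert.prems(1) sub A B AB in auto)
  qed
qed

lemma bernoulli_weights:
  fixes p :: real and a b c d m n :: nat
  assumes "a + b = c + d" "a \<le> m" "b \<le> n" "c \<le> n" "d \<le> m"
  shows "(p ^ a * (1 - p) ^ (m - a)) * (p ^ b * (1 - p) ^ (n - b)) =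
    (p ^ c * (1 - p) ^ (n - c)) * (p ^ d * (1 - p) ^ (m - d))"
proof -
  have "(m - a) + (n - b) = (n - c) + (m - d)" using assms by linarith
  then have "p ^ (a + b) * (1 - p) ^ ((m - a) + (n - b)) = p ^ (c + d) * (1 - p) ^ ((n - c) + (m - d))"
    using assms(1) by simp
  then show ?thesis by (simp only: power_add ac_simps)
qed

lemma weighted_quotient_le:
  fixes x y z w g h :: real and a b c d :: nat
  assumes "x * y = z * w" "0 \<le> z * w" "c * d \<le> a * b" "0 < c" "0 < d" "0 \<le> g" "g \<le> h"
  shows "(x / a) * (y / b) * g \<le> (z / c) * (w / d) * h"
proof -
  have "(0::real) < real c * real d" using assms by simp
  moreover have "real c * real d \<le> real a * real b" using assms(3) by (metis of_nat_le_iff of_nat_mult)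
  ultimately have "z * w / (real a * real b) \<le> z * w / (real c * real d)"
    using assms(2) by (intro divide_left_mono) auto
  then have "z * w / (real a * real b) * g \<le> z * w / (real c * real d) * h"
    using assms by (intro mult_mono) auto
  then show ?thesis using assms(1) by simp
qed

lemma quotient_le_quotient:
  fixes a b c d :: real
  assumes "0 < b" "0 < d" "a * d \<le> c * b"
  shows "a / b \<le> c / d"
  using assms by (simp add: field_simps)

text \<open>A free measure is stochastically dominated by the free measure on a larger volume. The four
  functions theorem compares the two laws directly once subsets of \<open>S\<close> are regarded as subsets of
  \<open>S'\<close>; its hypothesis is the submodularity of \<open>bounding\<close>.\<close>

lemma rc_mean_le_larger_volume_free:
  assumes q: "q > 0" and p: "0 \<le> p" "p < 1" and S: "finite S'" "S \<subseteq> S'"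
    and h: "\<And>A. 0 \<le> h A" "\<And>A B. A \<subseteq> B \<Longrightarrow> B \<subseteq> S \<Longrightarrow> h A \<le> h B"
  shows "rc_mean q p S {} h \<le> rc_mean q p S' {} (\<lambda>A. h (A \<inter> S))"
proof -
  have fin: "finite S" using S finite_subset by blast
  let ?w = "rc_weight q p S {}" and ?w' = "rc_weight q p S' {}"
  have ext: "(\<Sum>A\<in>Pow S'. if A \<subseteq> S then g A else 0) = (\<Sum>A\<in>Pow S. g A)" for g :: "cell set \<Rightarrow> real"
    by (rule sum.mono_neutral_cong_right) (use S in auto)
  have "(\<Sum>A\<in>Pow S'. if A \<subseteq> S then ?w A * h A else 0) * (\<Sum>A\<in>Pow S'. ?w' A) \<le>
      (\<Sum>A\<in>Pow S'. ?w' A * h (A \<inter> S)) * (\<Sum>A\<in>Pow S'. if A \<subseteq> S then ?w A else 0)"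
  proof (rule four_functions[OF S(1)])
    show "0 \<le> (if A \<subseteq> S then ?w A * h A else 0) \<and> 0 \<le> ?w' A \<and> 0 \<le> ?w' A * h (A \<inter> S) \<and>
        0 \<le> (if A \<subseteq> S then ?w A else 0)" for A
      using p h(1) by (auto simp: rc_weight_nonneg)
    fix A B assume AB: "A \<subseteq> S'" "B \<subseteq> S'"
    show "(if A \<subseteq> S then ?w A * h A else 0) * ?w' B \<le>
        ?w' (A \<union> B) * h ((A \<union> B) \<inter> S) * (if A \<inter> B \<subseteq> S then ?w (A \<inter> B) else 0)"
    proof (cases "A \<subseteq> S")
      case True
      have fAB: "finite A" "finite B" using AB S(1) finite_subset by auto
      let ?u = "\<lambda>n A. p ^ card A * (1 - p) ^ (n - card A)"
      have "(?u (card S) A / card (bounding q A)) * (?u (card S') B / card (bounding q B)) * h A \<le>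
          (?u (card S') (A \<union> B) / card (bounding q (A \<union> B))) * (?u (card S) (A \<inter> B) / card (bounding q (A \<inter> B))) * h ((A \<union> B) \<inter> S)"
      proof (rule weighted_quotient_le)
        show "?u (card S) A * ?u (card S') B = ?u (card S') (A \<union> B) * ?u (card S) (A \<inter> B)"
          by (rule bernoulli_weights[OF card_Un_Int[OF fAB]]) (use AB True S fin in \<open>auto intro!: card_mono\<close>)
        show "card (bounding q (A \<union> B)) * card (bounding q (A \<inter> B)) \<le> card (bounding q A) * card (bounding q B)"
          by (rule card_bounding_submodular[OF q fAB])
        show "h A \<le> h ((A \<union> B) \<inter> S)" using True by (intro h(2)) auto
        show "0 \<le> ?u (card S') (A \<union> B) * ?u (card S) (A \<inter> B)" using p by simp
        show "0 < card (bounding q (A \<union> B))" "0 < card (bounding q (A \<inter> B))"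
          using q fAB by (simp_all add: card_bounding_pos)
      qed (rule h(1))
      moreover have "A \<inter> B \<subseteq> S" using True by auto
      ultimately show ?thesis using True by (simp add: rc_weight_def ac_simps)
    next
      case False
      then show ?thesis using p h(1) by (simp add: rc_weight_nonneg)
    qed
  qed
  then have "(\<Sum>A\<in>Pow S. ?w A * h A) * (\<Sum>A\<in>Pow S'. ?w' A) \<le> (\<Sum>A\<in>Pow S'. ?w' A * h (A \<inter> S)) * (\<Sum>A\<in>Pow S. ?w A)"
    by (simp only: ext)
  then show ?thesis
    unfolding rc_mean_def using sum_rc_weight_pos[OF p q] fin S(1) by (intro quotient_le_quotient) auto
qed

text \<open>A wired measure stochastically dominates the wired measure on a larger volume. A subset \<open>A\<close> of \<open>S\<close> is
  encoded as \<open>A \<union> (S' - S)\<close>, because by the gluing hypothesis the wired weight on \<open>S\<close> is proportional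
  to a weight in which the complement of \<open>S\<close> is completely filled. Under this encoding
  the union in the four functions theorem is a configuration of the smaller volume.\<close>

lemma rc_mean_ge_larger_volume_wired:
  assumes q: "q > 0" and p: "0 \<le> p" "p < 1" and S: "finite S'" "S \<subseteq> S'" and T: "T \<subseteq> S" "T' \<subseteq> S' - S \<union> T"
    and glue: "\<And>A. A \<subseteq> S \<Longrightarrow> card (bounding q (A \<union> (S' - S \<union> T))) * card (bounding q T) =
      card (bounding q (A \<union> T)) * card (bounding q (S' - S \<union> T))"
    and h: "\<And>A. 0 \<le> h A" "\<And>A B. A \<subseteq> B \<Longrightarrow> B \<subseteq> S \<Longrightarrow> h A \<le> h B"
  shows "rc_mean q p S' T' (\<lambda>A. h (A \<inter> S)) \<le> rc_mean q p S T h"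
proof -
  let ?w = "rc_weight q p S T" and ?w' = "rc_weight q p S' T'" and ?D = "S' - S"
  let ?b = "\<lambda>A. card (bounding q A)"
  have fin: "finite S" using S by (rule finite_subset[rotated])
  then have fin: "finite S" "finite T" "finite T'"
    using T finite_subset[OF T(1)] finite_subset[OF T(2)] S(1) by simp_all
  have ext: "(\<Sum>A\<in>Pow S'. if ?D \<subseteq> A then g (A \<inter> S) else 0) = (\<Sum>A\<in>Pow S. g A)" for g :: "cell set \<Rightarrow> real"
  proof -
    have "(\<Sum>A\<in>Pow S'. if ?D \<subseteq> A then g (A \<inter> S) else 0) = (\<Sum>A\<in>{A \<in> Pow S'. ?D \<subseteq> A}. g (A \<inter> S))"
      using S(1) by (intro sum.mono_neutral_cong_right) auto
    also have "\<dots> = (\<Sum>A\<in>Pow S. g A)"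
      by (rule sum.reindex_bij_witness[of _ "\<lambda>A. A \<union> ?D" "\<lambda>A. A \<inter> S"]) (use S(2) in auto)
    finally show ?thesis .
  qed
  have "(\<Sum>A\<in>Pow S'. ?w' A * h (A \<inter> S)) * (\<Sum>A\<in>Pow S'. if ?D \<subseteq> A then ?w (A \<inter> S) else 0) \<le>
      (\<Sum>A\<in>Pow S'. if ?D \<subseteq> A then ?w (A \<inter> S) * h (A \<inter> S) else 0) * (\<Sum>A\<in>Pow S'. ?w' A)"
  proof (rule four_functions[OF S(1)])
    show "0 \<le> ?w' A * h (A \<inter> S) \<and> 0 \<le> (if ?D \<subseteq> A then ?w (A \<inter> S) else 0) \<and>
        0 \<le> (if ?D \<subseteq> A then ?w (A \<inter> S) * h (A \<inter> S) else 0) \<and> 0 \<le> ?w' A" for A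
      using p h(1) by (auto simp: rc_weight_nonneg)
    fix A B assume AB: "A \<subseteq> S'" "B \<subseteq> S'"
    show "?w' A * h (A \<inter> S) * (if ?D \<subseteq> B then ?w (B \<inter> S) else 0) \<le>
        (if ?D \<subseteq> A \<union> B then ?w ((A \<union> B) \<inter> S) * h ((A \<union> B) \<inter> S) else 0) * ?w' (A \<inter> B)"
    proof (cases "?D \<subseteq> B")
      case True
      have fAB: "finite A" "finite B" using AB S(1) finite_subset by auto
      let ?u = "\<lambda>n A. p ^ card A * (1 - p) ^ (n - card A)"
      have card: "card C = card (C \<inter> S) + card ?D" if "?D \<subseteq> C" "C \<subseteq> S'" for C
      proof -
        have "card ((C \<inter> S) \<union> ?D) = card (C \<inter> S) + card ?D"
          using S(1) fin by (intro card_Un_disjoint) auto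
        moreover have "(C \<inter> S) \<union> ?D = C" using that by auto
        ultimately show ?thesis by simp
      qed
      have DAB: "?D \<subseteq> A \<union> B" using True by blast
      have cards: "card A + card (B \<inter> S) = card ((A \<union> B) \<inter> S) + card (A \<inter> B)"
        using card[OF True AB(2)] card[OF DAB Un_least[OF AB]] card_Un_Int[OF fAB] by simp
      have "(?u (card S') A / ?b (A \<union> T')) * (?u (card S) (B \<inter> S) / ?b ((B \<inter> S) \<union> T)) * h (A \<inter> S) \<le>
          (?u (card S) ((A \<union> B) \<inter> S) / ?b (((A \<union> B) \<inter> S) \<union> T)) * (?u (card S') (A \<inter> B) / ?b ((A \<inter> B) \<union> T')) * h ((A \<union> B) \<inter> S)"
      proof (rule weighted_quotient_le)
        show "?u (card S') A * ?u (card S) (B \<inter> S) = ?u (card S) ((A \<union> B) \<inter> S) * ?u (card S') (A \<inter> B)"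
          by (rule bernoulli_weights[OF cards]) (use AB S fin in \<open>auto intro!: card_mono\<close>)
        show "h (A \<inter> S) \<le> h ((A \<union> B) \<inter> S)" by (intro h(2)) auto
        have glue': "?b (C \<union> T) * ?b T = ?b ((C \<inter> S) \<union> T) * ?b (?D \<union> T)" if "?D \<subseteq> C" "C \<subseteq> S'" for C
        proof -
          have "(C \<inter> S) \<union> (?D \<union> T) = C \<union> T" using that by auto
          then show ?thesis using glue[of "C \<inter> S"] by simp
        qed
        have "?b (A \<union> B \<union> T) * ?b ((A \<inter> B) \<union> T') \<le> ?b ((A \<union> T') \<union> (B \<union> T)) * ?b ((A \<union> T') \<inter> (B \<union> T))"
          using True T fAB fin q by (intro mult_le_mono card_bounding_mono) auto
        also have "\<dots> \<le> ?b (A \<union> T') * ?b (B \<union> T)"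
          using fAB fin by (intro card_bounding_submodular[OF q]) auto
        finally have "?b T * (?b (A \<union> B \<union> T) * ?b ((A \<inter> B) \<union> T')) \<le> ?b T * (?b (A \<union> T') * ?b (B \<union> T))"
          by (rule mult_le_mono2)
        then have "(?b (A \<union> B \<union> T) * ?b T) * ?b ((A \<inter> B) \<union> T') \<le> ?b (A \<union> T') * (?b (B \<union> T) * ?b T)"
          by (simp only: mult.assoc mult.left_commute[of "?b T"] mult.commute[of _ "?b T"])
        then have "?b (?D \<union> T) * (?b (((A \<union> B) \<inter> S) \<union> T) * ?b ((A \<inter> B) \<union> T')) \<le>
            ?b (?D \<union> T) * (?b (A \<union> T') * ?b ((B \<inter> S) \<union> T))"
          unfolding glue'[OF True AB(2)] glue'[OF DAB Un_least[OF AB]] by (simp only: mult_ac)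
        moreover have "?b (?D \<union> T) > 0" using q S(1) fin by (intro card_bounding_pos) auto
        ultimately show "?b (((A \<union> B) \<inter> S) \<union> T) * ?b ((A \<inter> B) \<union> T') \<le> ?b (A \<union> T') * ?b ((B \<inter> S) \<union> T)"
          by simp
        show "0 \<le> ?u (card S) ((A \<union> B) \<inter> S) * ?u (card S') (A \<inter> B)" using p by simp
        show "0 < ?b (((A \<union> B) \<inter> S) \<union> T)" "0 < ?b ((A \<inter> B) \<union> T')"
          using q fin fAB by (simp_all add: card_bounding_pos)
      qed (rule h(1))
      then show ?thesis using True DAB by (simp add: rc_weight_def ac_simps)
    next
      case False
      then show ?thesis using p h(1) by (simp add: rc_weight_nonneg)
    qed
  qed
  then have "(\<Sum>A\<in>Pow S'. ?w' A * h (A \<inter> S)) * (\<Sum>A\<in>Pow S. ?w A) \<le> (\<Sum>A\<in>Pow S. ?w A * h A) * (\<Sum>A\<in>Pow S'. ?w' A)"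
    by (simp only: ext[of ?w] ext[of "\<lambda>A. ?w A * h A"])
  then show ?thesis
    unfolding rc_mean_def using sum_rc_weight_pos[OF p q] fin S(1) by (intro quotient_le_quotient) auto
qed

section \<open>Exhausting the lattice by boxes\<close>

abbreviation box_plaquettes :: "nat \<Rightarrow> nat \<Rightarrow> nat \<Rightarrow> cell set" where
  "box_plaquettes i d N \<equiv> cells i (box_cells (centered_box d N))"

abbreviation wiring :: "boundary_condition \<Rightarrow> nat \<Rightarrow> nat \<Rightarrow> nat \<Rightarrow> cell set" where
  "wiring bc i d N \<equiv> boundary_plaquettes bc i (centered_box d N)"

lemma length_centered_box [simp]: "length (centered_box d N) = d"
  by (simp add: centered_box_def)

lemma mem_centered_box:
  "\<sigma> \<in> box_cells (centered_box d N) \<longleftrightarrow> length \<sigma> = d \<and>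
     (\<forall>k<d. - int N \<le> fst (\<sigma> ! k) \<and> fst (\<sigma> ! k) + of_bool (snd (\<sigma> ! k)) \<le> int N)"
  by (auto simp: box_cells_def centered_box_def)

lemma centered_box_mono: "N \<le> M \<Longrightarrow> box_cells (centered_box d N) \<subseteq> box_cells (centered_box d M)"
  unfolding mem_centered_box subset_iff by (fastforce intro: order_trans)

lemma box_plaquettes_mono: "N \<le> M \<Longrightarrow> box_plaquettes i d N \<subseteq> box_plaquettes i d M"
  using centered_box_mono[of N M d] by (auto simp: cells_def)

lemma box_boundary_restrict:
  assumes "N \<le> M" "\<sigma> \<in> box_boundary (centered_box d M)" "\<sigma> \<in> box_cells (centered_box d N)"
  shows "\<sigma> \<in> box_boundary (centered_box d N)"
proof -
  obtain k where k: "k < d" "\<not> snd (\<sigma> ! k)" "fst (\<sigma> ! k) = - int M \<or> fst (\<sigma> ! k) = int M"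
    using assms(2) by (auto simp: mem_box_boundary_iff centered_box_def)
  have "- int N \<le> fst (\<sigma> ! k)" "fst (\<sigma> ! k) + of_bool (snd (\<sigma> ! k)) \<le> int N"
    using assms(3) k(1) by (auto simp: mem_centered_box)
  then have "fst (\<sigma> ! k) = - int N \<or> fst (\<sigma> ! k) = int N" using k assms(1) by auto
  then show ?thesis using k assms(3) by (auto simp: mem_box_boundary_iff centered_box_def)
qed

lemma wiring_restrict: "N \<le> M \<Longrightarrow> wiring bc i d M \<inter> box_plaquettes i d N \<subseteq> wiring bc i d N"
  using box_boundary_restrict[of N M _ d] by (cases bc) (auto simp: boundary_plaquettes_def cells_def)

text \<open>Supports of chains are finite, so each chain lives in a centered box.\<close>

lemma finite_subset_centered_box:
  assumes "finite F" "F \<subseteq> lattice_cells d"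
  shows "\<exists>N. F \<subseteq> box_cells (centered_box d N)"
  using assms
proof (induction F rule: finite_induct)
  case empty
  then show ?case by simp
next
  case (insert \<sigma> F)
  then obtain N where N: "F \<subseteq> box_cells (centered_box d N)" by auto
  define M where "M = Suc (\<Sum>k<d. nat \<bar>fst (\<sigma> ! k)\<bar>)"
  have "\<bar>fst (\<sigma> ! k)\<bar> + 1 \<le> int M" if "k < d" for k
  proof -
    have "nat \<bar>fst (\<sigma> ! k)\<bar> \<le> (\<Sum>k<d. nat \<bar>fst (\<sigma> ! k)\<bar>)"
      using that by (intro member_le_sum) auto
    then show ?thesis unfolding M_def by linarith
  qed
  then have "\<sigma> \<in> box_cells (centered_box d M)"
    using insert.prems by (fastforce simp: mem_centered_box lattice_cells_def)
  then have "insert \<sigma> F \<subseteq> box_cells (centered_box d (max N M))"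
    using N centered_box_mono[of N "max N M" d] centered_box_mono[of M "max N M" d] by auto
  then show ?case by blast
qed

lemma bounding_in_some_box:
  assumes q: "q > 0" and \<gamma>: "\<gamma> \<in> chains_on q (cells j (lattice_cells d))"
    and Q: "\<gamma> \<in> bounding q Q" "Q \<subseteq> {\<sigma>. cell_dim \<sigma> = i}"
  shows "\<exists>N. \<gamma> \<in> bounding q (Q \<inter> box_plaquettes i d N)"
proof -
  obtain c where c: "c \<in> chains_on q Q" and b: "\<gamma> = (\<lambda>\<tau>. int_boundary c \<tau> mod int q)"
    using Q(1) by (rule mem_boundingE)
  \<comment> \<open>the configuration space also contains cells of the wrong length, which are discarded\<close>
  define c' where "c' = (\<lambda>\<sigma>. if length \<sigma> = d then c \<sigma> else 0)"
  have fin: "finite {\<sigma>. c' \<sigma> \<noteq> 0}"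
    by (rule finite_subset[OF _ finite_chain[OF c]]) (auto simp: c'_def)
  have "{\<sigma>. c' \<sigma> \<noteq> 0} \<subseteq> lattice_cells d" by (auto simp: c'_def lattice_cells_def)
  with fin obtain N where N: "{\<sigma>. c' \<sigma> \<noteq> 0} \<subseteq> box_cells (centered_box d N)"
    using finite_subset_centered_box by blast
  have "\<gamma> = (\<lambda>\<tau>. int_boundary c' \<tau> mod int q)"
  proof
    fix \<tau>
    show "\<gamma> \<tau> = int_boundary c' \<tau> mod int q"
    proof (cases "length \<tau> = d")
      case True
      have "int_boundary c \<tau> = int_boundary c' \<tau>"
        by (rule int_boundary_cong) (use True bd_nonzeroD(1) in \<open>auto simp: c'_def\<close>)
      then show ?thesis by (simp add: b)
    next
      case False
      have "int_boundary c' \<tau> = int_boundary (\<lambda>_. 0) \<tau>"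
        by (rule int_boundary_cong) (use False bd_nonzeroD(1) in \<open>auto simp: c'_def\<close>)
      moreover have "\<gamma> \<tau> = 0" using \<gamma> False by (auto simp: chains_on_def cells_def lattice_cells_def)
      ultimately show ?thesis by simp
    qed
  qed
  also have "\<dots> \<in> bounding q (Q \<inter> box_plaquettes i d N)"
  proof (rule mem_boundingI[OF q fin])
    fix \<sigma> assume "c' \<sigma> mod int q \<noteq> 0"
    then have "c' \<sigma> \<noteq> 0" "c \<sigma> \<noteq> 0" by (auto simp: c'_def split: if_splits)
    then show "\<sigma> \<in> Q \<inter> box_plaquettes i d N"
      using N c Q(2) by (auto simp: chains_on_def cells_def)
  qed
  finally show ?thesis by blast
qed

text \<open>Localization to the smaller box: what the wiring of the larger box contributes there lies on the
  surface of the smaller one.\<close>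

lemma wired_bounding_decreasing:
  assumes q: "q > 0" and j: "Suc j < d" and NM: "N \<le> M"
    and box: "\<gamma> \<in> bounding q (box_plaquettes (Suc j) d N)"
    and Q: "Q \<subseteq> {\<sigma>. cell_dim \<sigma> = Suc j}" and \<gamma>: "\<gamma> \<in> bounding q (Q \<union> wiring Wired (Suc j) d M)"
  shows "\<gamma> \<in> bounding q (Q \<inter> box_plaquettes (Suc j) d N \<union> wiring Wired (Suc j) d N)"
proof -
  let ?S = "box_plaquettes (Suc j) d N" and ?T = "wiring Wired (Suc j) d N"
  have T: "cells (Suc j) (box_boundary (centered_box d N)) = ?T" by (simp add: boundary_plaquettes_def)
  have "Q \<union> wiring Wired (Suc j) d M \<subseteq> {\<sigma>. cell_dim \<sigma> = Suc j}"
    using Q boundary_plaquettes_subset[of Wired "Suc j" "centered_box d M"] by (auto simp: cells_def)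
  from bounding_localize[OF q _ box \<gamma> this] j
  have "\<gamma> \<in> bounding q ((Q \<union> wiring Wired (Suc j) d M) \<inter> ?S \<union> ?T)" by (simp add: T)
  moreover have "(Q \<union> wiring Wired (Suc j) d M) \<inter> ?S \<union> ?T \<subseteq> Q \<inter> ?S \<union> ?T"
    using wiring_restrict[OF NM, of Wired "Suc j" d] by auto
  ultimately show ?thesis using bounding_mono by blast
qed

lemma wiring_Free [simp]: "boundary_plaquettes Free i \<Lambda> = {}"
  by (simp add: boundary_plaquettes_def cells_def)

text \<open>The wired boundaries move to infinity with \<open>N\<close>, so monotonicity is what makes the event in infinite
  volume determined by the configurations in finite boxes, and its defining condition eventually
  constant in \<open>N\<close>. For free boundary conditions a filling is finite, so the conditions increase. For wired
  ones they decrease once \<open>\<gamma>\<close> bounds in some box; if \<open>\<gamma>\<close> bounds in no box, then it bounds in no set of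
  plaquettes whatsoever and all conditions fail.\<close>

lemma eventually_local:
  fixes bc :: boundary_condition
  assumes q: "q > 0" and j: "Suc j < d" and \<gamma>: "\<gamma> \<in> chains_on q (cells j (lattice_cells d))"
    and Q: "Q \<subseteq> {\<sigma>. cell_dim \<sigma> = Suc j}"
  defines "P \<equiv> \<lambda>N. \<gamma> \<in> bounding q (Q \<union> wiring bc (Suc j) d N)"
  shows "\<forall>\<^sub>F N in sequentially. P N \<longleftrightarrow> \<gamma> \<in> bounding q (Q \<inter> box_plaquettes (Suc j) d N \<union> wiring bc (Suc j) d N)"
    and "(\<forall>\<^sub>F N in sequentially. P N) \<or> (\<forall>\<^sub>F N in sequentially. \<not> P N)"
proof -
  let ?D = "\<lambda>N. \<gamma> \<in> bounding q (Q \<inter> box_plaquettes (Suc j) d N \<union> wiring bc (Suc j) d N)"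
  have DP: "?D N \<Longrightarrow> P N" for N
    unfolding P_def by (rule subsetD[OF bounding_mono]) auto
  have "(\<forall>\<^sub>F N in sequentially. P N \<longleftrightarrow> ?D N) \<and> ((\<forall>\<^sub>F N in sequentially. P N) \<or> (\<forall>\<^sub>F N in sequentially. \<not> P N))"
  proof (cases bc)
    case Free
    have P: "P N \<longleftrightarrow> \<gamma> \<in> bounding q Q" for N by (simp add: P_def Free)
    have "\<forall>\<^sub>F N in sequentially. P N \<longleftrightarrow> ?D N"
    proof (cases "\<gamma> \<in> bounding q Q")
      case True
      then obtain N where N: "\<gamma> \<in> bounding q (Q \<inter> box_plaquettes (Suc j) d N)"
        using bounding_in_some_box[OF q \<gamma> _ Q] by blast
      have "?D M" if "N \<le> M" for M
        using N box_plaquettes_mono[OF that, of "Suc j" d] subsetD[OF bounding_mono[of "Q \<inter> box_plaquettes (Suc j) d N" "Q \<inter> box_plaquettes (Suc j) d M" q]]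
        by (auto simp: Free)
      then show ?thesis using True P unfolding eventually_sequentially by blast
    next
      case False
      then have "\<not> P N" "\<not> ?D N" for N using DP[of N] P[of N] by auto
      then show ?thesis by simp
    qed
    then show ?thesis using P by simp
  next
    case Wired
    show ?thesis
    proof (cases "\<exists>N. \<gamma> \<in> bounding q (box_plaquettes (Suc j) d N)")
      case True
      then obtain N0 where "\<gamma> \<in> bounding q (box_plaquettes (Suc j) d N0)" by blast
      then have box: "\<gamma> \<in> bounding q (box_plaquettes (Suc j) d N)" if "N0 \<le> N" for N
        using bounding_mono[OF box_plaquettes_mono[OF that]] by blast
      have PD: "?D N" if "N0 \<le> N" "N \<le> M" "P M" for N M
        using wired_bounding_decreasing[OF q j that(2) box[OF that(1)] Q] that(3) by (simp add: P_def Wired)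
      have "\<forall>\<^sub>F N in sequentially. P N \<longleftrightarrow> ?D N"
        unfolding eventually_sequentially using PD DP by blast
      moreover have "(\<forall>\<^sub>F N in sequentially. P N) \<or> (\<forall>\<^sub>F N in sequentially. \<not> P N)"
      proof (cases "\<forall>N\<ge>N0. P N")
        case False
        then obtain N where "N0 \<le> N" "\<not> P N" by blast
        then have "\<not> P M" if "N \<le> M" for M using PD[of N M] DP that by blast
        then show ?thesis unfolding eventually_sequentially by blast
      qed (auto simp: eventually_sequentially)
      ultimately show ?thesis by blast
    next
      case False
      have "\<not> P N" for N
      proof
        assume "P N"
        moreover have "Q \<union> wiring bc (Suc j) d N \<subseteq> {\<sigma>. cell_dim \<sigma> = Suc j}"
          using Q boundary_plaquettes_subset[of bc "Suc j" "centered_box d N"] by (auto simp: cells_def)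
        ultimately obtain M where "\<gamma> \<in> bounding q ((Q \<union> wiring bc (Suc j) d N) \<inter> box_plaquettes (Suc j) d M)"
          using bounding_in_some_box[OF q \<gamma>] unfolding P_def by blast
        then show False using False bounding_mono[of _ "box_plaquettes (Suc j) d M" q] by blast
      qed
      then have "\<not> P N" "\<not> ?D N" for N using DP[of N] by auto
      then show ?thesis by simp
    qed
  qed
  then show "\<forall>\<^sub>F N in sequentially. P N \<longleftrightarrow> ?D N"
    "(\<forall>\<^sub>F N in sequentially. P N) \<or> (\<forall>\<^sub>F N in sequentially. \<not> P N)" by blast+
qed

lemma rc_mean_mono:
  assumes "q > 0" "0 \<le> p" "p < 1" "finite S" "finite T" "\<And>A. A \<subseteq> S \<Longrightarrow> g A \<le> h A"
  shows "rc_mean q p S T g \<le> rc_mean q p S T h"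
  unfolding rc_mean_def
  by (intro divide_right_mono sum_mono mult_left_mono)
    (use assms rc_weight_nonneg in \<open>auto intro!: sum_nonneg\<close>)

lemma finite_boundary_plaquettes [simp]: "finite (boundary_plaquettes bc i \<Lambda>)"
  using boundary_plaquettes_subset finite_cells_box by (rule finite_subset)

text \<open>The middle term is the probability, in the box of radius \<open>M\<close>, of an event that depends on the box of radius
  \<open>N\<close> only; the first inequality changes the volume and the second one the event.\<close>

lemma free_sandwich:
  assumes q: "q > 0" and p: "0 \<le> p" "p < 1" and NM: "N \<le> M"
  shows "rc_mean q p (box_plaquettes i d N) {} (\<lambda>A. of_bool (\<gamma> \<in> bounding q A)) \<le>
      rc_mean q p (box_plaquettes i d M) {} (\<lambda>A. of_bool (\<gamma> \<in> bounding q (A \<inter> box_plaquettes i d N)))"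
    and "rc_mean q p (box_plaquettes i d M) {} (\<lambda>A. of_bool (\<gamma> \<in> bounding q (A \<inter> box_plaquettes i d N))) \<le>
      rc_mean q p (box_plaquettes i d M) {} (\<lambda>A. of_bool (\<gamma> \<in> bounding q A))"
proof -
  show "rc_mean q p (box_plaquettes i d N) {} (\<lambda>A. of_bool (\<gamma> \<in> bounding q A)) \<le>
      rc_mean q p (box_plaquettes i d M) {} (\<lambda>A. of_bool (\<gamma> \<in> bounding q (A \<inter> box_plaquettes i d N)))"
    by (rule rc_mean_le_larger_volume_free[OF q p])
      (use NM box_plaquettes_mono bounding_mono in \<open>auto simp: subset_iff\<close>)
  show "rc_mean q p (box_plaquettes i d M) {} (\<lambda>A. of_bool (\<gamma> \<in> bounding q (A \<inter> box_plaquettes i d N))) \<le>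
      rc_mean q p (box_plaquettes i d M) {} (\<lambda>A. of_bool (\<gamma> \<in> bounding q A))"
  proof (rule rc_mean_mono[OF q p])
    show "of_bool (\<gamma> \<in> bounding q (A \<inter> box_plaquettes i d N)) \<le> (of_bool (\<gamma> \<in> bounding q A) :: real)" for A
      using bounding_mono[of "A \<inter> box_plaquettes i d N" A q] by auto
  qed simp_all
qed

text \<open>The counterpart of the free case with all inequalities reversed.\<close>

lemma wired_sandwich:
  assumes q: "q > 0" and p: "0 \<le> p" "p < 1" and NM: "N \<le> M" and j: "Suc j < d"
    and box: "\<gamma> \<in> bounding q (box_plaquettes (Suc j) d N)"
  defines "S \<equiv> box_plaquettes (Suc j) d" and "T \<equiv> wiring Wired (Suc j) d"
  shows "rc_mean q p (S M) (T M) (\<lambda>A. of_bool (\<gamma> \<in> bounding q (A \<inter> S N \<union> T N))) \<le>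
      rc_mean q p (S N) (T N) (\<lambda>A. of_bool (\<gamma> \<in> bounding q (A \<union> T N)))"
    and "rc_mean q p (S M) (T M) (\<lambda>A. of_bool (\<gamma> \<in> bounding q (A \<union> T M))) \<le>
      rc_mean q p (S M) (T M) (\<lambda>A. of_bool (\<gamma> \<in> bounding q (A \<inter> S N \<union> T N)))"
proof -
  have T: "T K = cells (Suc j) (box_boundary (centered_box d K))" for K
    by (simp add: T_def boundary_plaquettes_def)
  have TS: "T K \<subseteq> S K" for K unfolding T_def S_def by (rule boundary_plaquettes_subset)
  have fin: "finite (S K)" "finite (T K)" for K by (simp_all add: S_def T_def)
  have SM: "S N \<subseteq> S M" unfolding S_def by (rule box_plaquettes_mono[OF NM])
  show "rc_mean q p (S M) (T M) (\<lambda>A. of_bool (\<gamma> \<in> bounding q (A \<inter> S N \<union> T N))) \<le>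
      rc_mean q p (S N) (T N) (\<lambda>A. of_bool (\<gamma> \<in> bounding q (A \<union> T N)))"
  proof (rule rc_mean_ge_larger_volume_wired[OF q p fin(1) SM TS])
    show "T M \<subseteq> S M - S N \<union> T N"
      using TS[of M] wiring_restrict[OF NM, of Wired "Suc j" d] by (auto simp: S_def T_def)
    have inner: "\<not> inner_cell (centered_box d N) \<sigma>" if "\<sigma> \<in> S M - S N \<union> T N" for \<sigma>
      using that by (auto simp: inner_cell_iff S_def T cells_def)
    show "card (bounding q (A \<union> (S M - S N \<union> T N))) * card (bounding q (T N)) =
        card (bounding q (A \<union> T N)) * card (bounding q (S M - S N \<union> T N))" if "A \<subseteq> S N" for A
      unfolding T using card_bounding_glue[OF q, of j "centered_box d N" A "S M - S N \<union> T N"] j that fin inner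
      by (simp add: T S_def)
    show "of_bool (\<gamma> \<in> bounding q (A \<union> T N)) \<le> (of_bool (\<gamma> \<in> bounding q (B \<union> T N)) :: real)" if "A \<subseteq> B" for A B
      using that bounding_mono[of "A \<union> T N" "B \<union> T N" q] by auto
  qed simp
  show "rc_mean q p (S M) (T M) (\<lambda>A. of_bool (\<gamma> \<in> bounding q (A \<union> T M))) \<le>
      rc_mean q p (S M) (T M) (\<lambda>A. of_bool (\<gamma> \<in> bounding q (A \<inter> S N \<union> T N)))"
  proof (rule rc_mean_mono[OF q p fin])
    fix A assume "A \<subseteq> S M"
    then have "A \<subseteq> {\<sigma>. cell_dim \<sigma> = Suc j}" by (auto simp: S_def cells_def)
    then show "of_bool (\<gamma> \<in> bounding q (A \<union> T M)) \<le> (of_bool (\<gamma> \<in> bounding q (A \<inter> S N \<union> T N)) :: real)"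
      using wired_bounding_decreasing[OF q j NM box] by (auto simp: S_def T_def)
  qed
qed

section \<open>Passage to the infinite volume\<close>

lemma open_bool_singleton: "open {b :: bool}"
proof (cases b)
  case True
  then have "{b} = {False<..}" by auto
  then show ?thesis by simp
next
  case False
  then have "{b} = {..<True}" by auto
  then show ?thesis by simp
qed

text \<open>Weak convergence in the product topology applies to indicators of local events through this.\<close>

lemma continuous_finite_dependence:
  fixes g :: "('a \<Rightarrow> bool) \<Rightarrow> real"
  assumes F: "finite F" and dep: "\<And>\<omega> \<omega>'. (\<forall>\<sigma>\<in>F. \<omega> \<sigma> = \<omega>' \<sigma>) \<Longrightarrow> g \<omega> = g \<omega>'"
  shows "continuous_on UNIV g"
proof -
  have "(g \<longlongrightarrow> g \<omega>) (at \<omega>)" for \<omega> :: "'a \<Rightarrow> bool"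
  proof -
    define U where "U = (\<Inter>\<sigma>\<in>F. (\<lambda>\<omega>' :: 'a \<Rightarrow> bool. \<omega>' \<sigma>) -` {\<omega> \<sigma>})"
    have "open ((\<lambda>\<omega>' :: 'a \<Rightarrow> bool. \<omega>' \<sigma>) -` {\<omega> \<sigma>})" for \<sigma>
      by (rule open_vimage) (auto simp: open_bool_singleton)
    then have "open U" unfolding U_def using F by (intro open_INT) auto
    moreover have "\<omega> \<in> U" by (simp add: U_def)
    moreover have "g \<omega>' = g \<omega>" if "\<omega>' \<in> U" for \<omega>'
      using that by (intro dep) (simp add: U_def)
    ultimately have "\<forall>\<^sub>F \<omega>' in at \<omega>. g \<omega>' = g \<omega>"
      unfolding eventually_at_topological by blast
    then show ?thesis by (rule tendsto_eventually)
  qed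
  then show ?thesis by (simp add: continuous_on_def)
qed

text \<open>For cycles this is \<open>V_null\<close>; the condition on single chains makes it available for differences
  of cycles on the same footing.\<close>

definition bounding_event ::
    "boundary_condition \<Rightarrow> nat \<Rightarrow> region \<Rightarrow> nat \<Rightarrow> nat \<Rightarrow> (cell \<Rightarrow> int) \<Rightarrow> (cell \<Rightarrow> bool) set" where
  "bounding_event bc d X q j \<gamma> = subcomplex_event bc d X (\<lambda>P. \<gamma> \<in> bounding q (cells (Suc j) P))"

text \<open>Let \<open>m N\<close> be the probability of the event for the box of radius \<open>N\<close> under the law on that box, and
  \<open>e M N\<close> its probability under the law on the box of radius \<open>M\<close>. Weak convergence gives the limit of
  \<open>e M N\<close> in \<open>M\<close>, and \<open>m N \<le> e M N \<le> m M\<close> (free) or \<open>m M \<le> e M N \<le> m N\<close> (wired) for \<open>N \<le> M\<close>. Letting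
  first \<open>M\<close> and then \<open>N\<close> tend to infinity identifies the limit \<open>L\<close> of \<open>m\<close> with the probability of the
  event in infinite volume. The existence of \<open>L\<close> is assumed here; it comes from the gauge theory.\<close>

lemma prcm_lattice_limit:
  assumes q: "q \<ge> 2" and p: "0 \<le> p" "p < 1" and j: "Suc j < d"
    and \<gamma>: "\<gamma> \<in> chains_on q (cells j (lattice_cells d))"
    and \<mu>: "weak_limit (\<lambda>N. prcm_box bc (centered_box d N) p q (Suc j)) \<mu>"
    and L: "(\<lambda>N. rc_mean q p (box_plaquettes (Suc j) d N) (wiring bc (Suc j) d N)
      (\<lambda>A. of_bool (\<gamma> \<in> bounding q (A \<union> wiring bc (Suc j) d N)))) \<longlonglongrightarrow> L"
  shows "bounding_event bc d Lattice q j \<gamma> \<in> sets \<mu>"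
    and "measure \<mu> (bounding_event bc d Lattice q j \<gamma>) = L"
proof -
  let ?S = "box_plaquettes (Suc j) d" and ?T = "wiring bc (Suc j) d" and ?V = "bounding_event bc d Lattice q j \<gamma>"
  have q0: "q > 0" using q by simp
  interpret prob_space \<mu> using \<mu> by (simp add: weak_limit_def)
  have sets: "sets \<mu> = sets borel" using \<mu> by (simp add: weak_limit_def)
  then have space: "space \<mu> = UNIV" using sets_eq_imp_space_eq by fastforce
  define m where "m N = rc_mean q p (?S N) (?T N) (\<lambda>A. of_bool (\<gamma> \<in> bounding q (A \<union> ?T N)))" for N
  define e where "e M N = rc_mean q p (?S M) (?T M) (\<lambda>A. of_bool (\<gamma> \<in> bounding q (A \<inter> ?S N \<union> ?T N)))" for M N
  define g where "g N \<omega> = (of_bool (\<gamma> \<in> bounding q (cells (Suc j) (Collect \<omega>) \<inter> ?S N \<union> ?T N)) :: real)"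
    for N and \<omega> :: "cell \<Rightarrow> bool"
  have g_cont: "continuous_on UNIV (g N)" for N
  proof (rule continuous_finite_dependence[of "?S N"])
    fix \<omega> \<omega>' :: "cell \<Rightarrow> bool" assume "\<forall>\<sigma>\<in>?S N. \<omega> \<sigma> = \<omega>' \<sigma>"
    then have "cells (Suc j) (Collect \<omega>) \<inter> ?S N = cells (Suc j) (Collect \<omega>') \<inter> ?S N"
      by (auto simp: cells_def)
    then show "g N \<omega> = g N \<omega>'" by (simp add: g_def)
  qed simp
  have g_meas [measurable]: "g N \<in> borel_measurable \<mu>" for N
    unfolding measurable_cong_sets[OF sets refl] by (rule borel_measurable_continuous_onI[OF g_cont])
  have "bounded (range (g N))" for N
    by (rule boundedI[of _ 1]) (auto simp: g_def)
  then have "(\<lambda>M. measure_pmf.expectation (prcm_box bc (centered_box d M) p q (Suc j)) (g N)) \<longlonglongrightarrow> (\<integral>\<omega>. g N \<omega> \<partial>\<mu>)" for N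
    using \<mu> g_cont by (simp add: weak_limit_def)
  moreover have "measure_pmf.expectation (prcm_box bc (centered_box d M) p q (Suc j)) (g N) = e M N" for M N
    unfolding e_def g_def
    by (rule expectation_prcm(1)[OF q p, where h = "\<lambda>A. of_bool (\<gamma> \<in> bounding q (A \<inter> ?S N \<union> ?T N))"])
  ultimately have lim_e: "(\<lambda>M. e M N) \<longlonglongrightarrow> (\<integral>\<omega>. g N \<omega> \<partial>\<mu>)" for N by simp
  have ev: "\<forall>\<^sub>F N in sequentially. g N \<omega> = indicator ?V \<omega>" for \<omega> :: "cell \<Rightarrow> bool"
  proof -
    have Q: "cells (Suc j) (Collect \<omega>) \<subseteq> {\<sigma>. cell_dim \<sigma> = Suc j}" by (auto simp: cells_def)
    let ?P = "\<lambda>N. \<gamma> \<in> bounding q (cells (Suc j) (Collect \<omega>) \<union> ?T N)"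
    have V: "\<omega> \<in> ?V \<longleftrightarrow> (\<forall>\<^sub>F N in sequentially. ?P N)"
      by (simp add: bounding_event_def subcomplex_event_def cells_with_boundary)
    have 1: "\<forall>\<^sub>F N in sequentially. ?P N \<longleftrightarrow> \<gamma> \<in> bounding q (cells (Suc j) (Collect \<omega>) \<inter> ?S N \<union> ?T N)"
      and 2: "(\<forall>\<^sub>F N in sequentially. ?P N) \<or> (\<forall>\<^sub>F N in sequentially. \<not> ?P N)"
      using eventually_local[OF q0 j \<gamma> Q, of bc] by blast+
    show ?thesis
    proof (cases "\<omega> \<in> ?V")
      case True
      then have "\<forall>\<^sub>F N in sequentially. ?P N" using V by simp
      with 1 show ?thesis by eventually_elim (use True in \<open>simp add: g_def\<close>)
    next
      case False
      then have "\<forall>\<^sub>F N in sequentially. \<not> ?P N" using V 2 by simp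
      with 1 show ?thesis by eventually_elim (use False in \<open>simp add: g_def\<close>)
    qed
  qed
  then have g_lim: "(\<lambda>N. g N \<omega>) \<longlonglongrightarrow> indicator ?V \<omega>" for \<omega> by (rule tendsto_eventually)
  have ind_meas: "(indicator ?V :: _ \<Rightarrow> real) \<in> borel_measurable \<mu>"
    using g_lim by (rule borel_measurable_LIMSEQ_real[OF _ g_meas])
  then show "?V \<in> sets \<mu>"
    unfolding borel_measurable_indicator_iff space by simp
  have "(\<lambda>N. \<integral>\<omega>. g N \<omega> \<partial>\<mu>) \<longlonglongrightarrow> (\<integral>\<omega>. indicator ?V \<omega> \<partial>\<mu>)"
    by (rule integral_dominated_convergence[where w = "\<lambda>_. 1"])
      (use g_lim ind_meas g_meas in \<open>auto, simp add: g_def\<close>)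
  then have lim_g: "(\<lambda>N. \<integral>\<omega>. g N \<omega> \<partial>\<mu>) \<longlonglongrightarrow> measure \<mu> ?V" by (simp add: space)
  have L: "m \<longlonglongrightarrow> L" using L by (simp add: m_def[abs_def])
  show "measure \<mu> ?V = L"
  proof (cases bc)
    case Free
    have 1: "m N \<le> e M N" and 2: "e M N \<le> m M" if "N \<le> M" for N M
      using free_sandwich[OF q0 p that, of "Suc j" d \<gamma>] by (simp_all add: m_def e_def Free)
    have "m N \<le> (\<integral>\<omega>. g N \<omega> \<partial>\<mu>)" for N
      by (rule tendsto_lowerbound[OF lim_e]) (use 1 in \<open>auto simp: eventually_sequentially\<close>)
    moreover have "(\<integral>\<omega>. g N \<omega> \<partial>\<mu>) \<le> L" for N
      by (rule tendsto_le[OF _ L lim_e]) (use 2 in \<open>auto simp: eventually_sequentially\<close>)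
    ultimately show ?thesis
      by (intro antisym LIMSEQ_le[OF L lim_g] LIMSEQ_le_const2[OF lim_g]) auto
  next
    case Wired
    show ?thesis
    proof (cases "\<exists>N. \<gamma> \<in> bounding q (?S N)")
      case True
      then obtain N0 where "\<gamma> \<in> bounding q (?S N0)" by blast
      then have box: "\<gamma> \<in> bounding q (?S N)" if "N0 \<le> N" for N
        using bounding_mono[OF box_plaquettes_mono[OF that]] by blast
      have 1: "e M N \<le> m N" and 2: "m M \<le> e M N" if "N0 \<le> N" "N \<le> M" for N M
        using wired_sandwich[OF q0 p that(2) j box[OF that(1)]] by (simp_all add: m_def e_def Wired)
      have "(\<integral>\<omega>. g N \<omega> \<partial>\<mu>) \<le> m N" if "N0 \<le> N" for N
        by (rule tendsto_upperbound[OF lim_e]) (use 1 that in \<open>auto simp: eventually_sequentially\<close>)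
      moreover have "L \<le> (\<integral>\<omega>. g N \<omega> \<partial>\<mu>)" if "N0 \<le> N" for N
        by (rule tendsto_le[OF _ lim_e L]) (use 2 that in \<open>auto simp: eventually_sequentially\<close>)
      ultimately show ?thesis
        by (intro antisym LIMSEQ_le[OF lim_g L] LIMSEQ_le_const[OF lim_g]) auto
    next
      case False
      have sub: "?T N \<subseteq> ?S N" for N by (rule boundary_plaquettes_subset)
      have "\<gamma> \<notin> bounding q (A \<union> ?T N)" if "A \<subseteq> ?S N" for A N
        using False bounding_mono[of "A \<union> ?T N" "?S N" q] sub[of N] that by blast
      then have zero: "m N = 0" "g N \<omega> = 0" for N \<omega>
        by (auto simp: m_def rc_mean_def g_def)
      then have "m = (\<lambda>_. 0)" "(\<lambda>N. \<integral>\<omega>. g N \<omega> \<partial>\<mu>) = (\<lambda>_. 0)" by (auto simp: fun_eq_iff)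
      with L lim_g have "(\<lambda>_. 0) \<longlonglongrightarrow> L" "(\<lambda>_. 0) \<longlonglongrightarrow> measure \<mu> ?V" by simp_all
      then show ?thesis by (simp add: LIMSEQ_const_iff)
    qed
  qed
qed

lemma continuous_wilson:
  assumes "\<gamma> \<in> chains_on q A" "q > 0"
  shows "continuous_on UNIV (wilson \<gamma>)"
proof -
  have "\<gamma> \<sigma> \<ge> 0" for \<sigma> using assms(1,2) by (simp add: chains_on_def carrier_mod_functions_iff)
  then have eq: "wilson \<gamma> = (\<lambda>f. \<Prod>\<sigma> | \<gamma> \<sigma> \<noteq> 0. f \<sigma> ^ nat (\<gamma> \<sigma>))"
    by (simp add: fun_eq_iff wilson_def on_chain_def power_int_nonneg_exp)
  show ?thesis
    unfolding eq by (intro continuous_intros continuous_on_product_coordinates)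
qed

lemma wilson_borel_measurable:
  assumes "\<gamma> \<in> chains_on q A" "q > 0" "sets \<nu> = sets borel"
  shows "wilson \<gamma> \<in> borel_measurable \<nu>"
  unfolding measurable_cong_sets[OF assms(3) refl]
  by (rule borel_measurable_continuous_onI[OF continuous_wilson[OF assms(1,2)]])

lemma root_of_unity_norm: "q > 0 \<Longrightarrow> (z :: complex) ^ q = 1 \<Longrightarrow> norm z = 1"
  by (metis power_eq_1_iff less_irrefl)

lemma norm_on_chain:
  assumes "q > 0" "f \<in> root_spins q"
  shows "norm (on_chain f c) = 1"
proof -
  have "norm (f \<sigma>) = 1" for \<sigma>
    using assms root_of_unity_norm by (simp add: root_spins_def)
  then show ?thesis by (simp add: on_chain_def norm_power_int prod_norm[symmetric])
qed

text \<open>Weak convergence concerns bounded functions on all of \<open>cell \<Rightarrow> complex\<close>, whereas a Wilson variable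
  is bounded only on spin configurations. Truncation of the real and imaginary parts bridges this.\<close>

definition clamp :: "real \<Rightarrow> real" where
  "clamp x = max (- 1) (min 1 x)"

lemma clamp_eq: "\<bar>x\<bar> \<le> 1 \<Longrightarrow> clamp x = x"
  by (auto simp: clamp_def)

lemma abs_clamp_le: "\<bar>clamp x\<bar> \<le> 1"
  by (auto simp: clamp_def)

lemma continuous_clamp: "continuous_on UNIV g \<Longrightarrow> continuous_on UNIV (\<lambda>x. clamp (g x))"
  unfolding clamp_def by (intro continuous_intros)

lemma integral_wilson_eq_clamp:
  assumes M: "prob_space M" and q: "q > 0" and roots: "AE f in M. f \<in> root_spins q"
    and meas: "wilson \<gamma> \<in> borel_measurable M"
  shows "(\<integral>f. wilson \<gamma> f \<partial>M) =
    Complex (\<integral>f. clamp (Re (wilson \<gamma> f)) \<partial>M) (\<integral>f. clamp (Im (wilson \<gamma> f)) \<partial>M)"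
proof -
  interpret prob_space M by fact
  have norm: "AE f in M. norm (wilson \<gamma> f) = 1"
    using roots by eventually_elim (simp add: wilson_def norm_on_chain[OF q])
  have int: "integrable M (wilson \<gamma>)"
    by (rule integrable_const_bound[where B = 1]) (use norm meas in auto)
  have meas': "(\<lambda>f. Re (wilson \<gamma> f)) \<in> borel_measurable M" "(\<lambda>f. Im (wilson \<gamma> f)) \<in> borel_measurable M"
    using meas by simp_all
  have "(\<integral>f. Re (wilson \<gamma> f) \<partial>M) = (\<integral>f. clamp (Re (wilson \<gamma> f)) \<partial>M)"
  proof (rule integral_cong_AE)
    show "AE f in M. Re (wilson \<gamma> f) = clamp (Re (wilson \<gamma> f))"
      using norm by eventually_elim (metis abs_Re_le_cmod clamp_eq)
  qed (use meas' in \<open>simp_all add: clamp_def\<close>)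
  moreover have "(\<integral>f. Im (wilson \<gamma> f) \<partial>M) = (\<integral>f. clamp (Im (wilson \<gamma> f)) \<partial>M)"
  proof (rule integral_cong_AE)
    show "AE f in M. Im (wilson \<gamma> f) = clamp (Im (wilson \<gamma> f))"
      using norm by eventually_elim (metis abs_Im_le_cmod clamp_eq)
  qed (use meas' in \<open>simp_all add: clamp_def\<close>)
  ultimately show ?thesis using int by (simp add: complex_eq_iff integral_Re integral_Im)
qed

text \<open>The bounded continuous function \<open>min 1 (norm (f \<sigma> ^ q - 1))\<close> vanishes on the spin configurations of
  every box, so its mean under a weak limit is 0. The countably many cells are then treated
  simultaneously.\<close>

lemma plgt_limit_roots:
  assumes q: "q > 0" and \<nu>: "weak_limit (\<lambda>N. plgt_box bc (\<Lambda> N) \<beta> q j) \<nu>"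
  shows "AE f in \<nu>. f \<in> root_spins q"
proof -
  interpret prob_space \<nu> using \<nu> by (simp add: weak_limit_def)
  have sets: "sets \<nu> = sets borel" using \<nu> by (simp add: weak_limit_def)
  have "AE f in \<nu>. f \<sigma> ^ q = 1" for \<sigma>
  proof -
    define g :: "(cell \<Rightarrow> complex) \<Rightarrow> real" where "g f = min 1 (norm (f \<sigma> ^ q - 1))" for f
    have cont: "continuous_on UNIV g"
      unfolding g_def by (intro continuous_intros continuous_on_product_coordinates)
    have bnd: "norm (g f) \<le> 1" "0 \<le> g f" for f by (auto simp: g_def)
    have meas: "g \<in> borel_measurable \<nu>"
      unfolding measurable_cong_sets[OF sets refl] by (rule borel_measurable_continuous_onI[OF cont])
    have "bounded (range g)" by (rule boundedI[of _ 1]) (use bnd in auto)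
    then have "(\<lambda>N. measure_pmf.expectation (plgt_box bc (\<Lambda> N) \<beta> q j) g) \<longlonglongrightarrow> (\<integral>f. g f \<partial>\<nu>)"
      using \<nu> cont by (simp add: weak_limit_def)
    moreover have "measure_pmf.expectation (plgt_box bc (\<Lambda> N) \<beta> q j) g = 0" for N
    proof -
      have "AE f in measure_pmf (plgt_box bc (\<Lambda> N) \<beta> q j). g f = 0"
        using set_pmf_plgt_box[OF q] spin_cochains_root_spins
        by (fastforce simp: AE_measure_pmf_iff g_def root_spins_def)
      then show ?thesis by (intro integral_eq_zero_AE)
    qed
    ultimately have "(\<lambda>_ :: nat. 0) \<longlonglongrightarrow> (\<integral>f. g f \<partial>\<nu>)" by simp
    then have "(\<integral>f. g f \<partial>\<nu>) = 0" by (simp add: LIMSEQ_const_iff)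
    moreover have "integrable \<nu> g"
      by (rule integrable_const_bound[where B = 1]) (use bnd meas in auto)
    ultimately have "AE f in \<nu>. g f = 0"
      using integral_nonneg_eq_0_iff_AE[of \<nu> g] bnd(2) by simp
    then show ?thesis by eventually_elim (simp add: g_def min_def split: if_splits)
  qed
  then have "AE f in \<nu>. \<forall>\<sigma>. f \<sigma> ^ q = 1" by (simp add: AE_all_countable)
  then show ?thesis by (simp add: root_spins_def)
qed

lemma plgt_limit_wilson:
  assumes q: "q > 0" and \<nu>: "weak_limit (\<lambda>N. plgt_box bc (\<Lambda> N) \<beta> q j) \<nu>" and \<gamma>: "\<gamma> \<in> chains_on q A"
  shows "(\<lambda>N. measure_pmf.expectation (plgt_box bc (\<Lambda> N) \<beta> q j) (wilson \<gamma>)) \<longlonglongrightarrow> (\<integral>f. wilson \<gamma> f \<partial>\<nu>)"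
proof -
  have ps: "prob_space \<nu>" and sets: "sets \<nu> = sets borel" using \<nu> by (simp_all add: weak_limit_def)
  have meas: "wilson \<gamma> \<in> borel_measurable \<nu>" by (rule wilson_borel_measurable[OF \<gamma> q sets])
  have cont: "continuous_on UNIV (wilson \<gamma>)" by (rule continuous_wilson[OF \<gamma> q])
  have lim: "(\<lambda>N. measure_pmf.expectation (plgt_box bc (\<Lambda> N) \<beta> q j) (\<lambda>f. clamp (h (wilson \<gamma> f)))) \<longlonglongrightarrow> (\<integral>f. clamp (h (wilson \<gamma> f)) \<partial>\<nu>)"
    if "continuous_on UNIV h" for h
  proof -
    have "continuous_on UNIV (\<lambda>f. clamp (h (wilson \<gamma> f)))"
      by (intro continuous_clamp continuous_on_compose2[OF that cont]) auto
    moreover have "bounded (range (\<lambda>f. clamp (h (wilson \<gamma> f))))"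
      by (rule boundedI[of _ 1]) (auto simp: abs_clamp_le)
    ultimately show ?thesis using \<nu> by (simp add: weak_limit_def)
  qed
  have box: "measure_pmf.expectation (plgt_box bc (\<Lambda> N) \<beta> q j) (wilson \<gamma>) =
      Complex (measure_pmf.expectation (plgt_box bc (\<Lambda> N) \<beta> q j) (\<lambda>f. clamp (Re (wilson \<gamma> f))))
        (measure_pmf.expectation (plgt_box bc (\<Lambda> N) \<beta> q j) (\<lambda>f. clamp (Im (wilson \<gamma> f))))" for N
  proof (rule integral_wilson_eq_clamp[OF prob_space_measure_pmf q])
    show "AE f in measure_pmf (plgt_box bc (\<Lambda> N) \<beta> q j). f \<in> root_spins q"
      using set_pmf_plgt_box[OF q] spin_cochains_root_spins by (fastforce simp: AE_measure_pmf_iff)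
  qed simp
  have "continuous_on UNIV Re" "continuous_on UNIV Im" by (intro continuous_intros)+
  then show ?thesis
    unfolding box integral_wilson_eq_clamp[OF ps q plgt_limit_roots[OF q \<nu>] meas]
    by (intro tendsto_Complex lim)
qed

section \<open>Homology classes and correlations of Wilson loops\<close>

lemma homology_class_eq_coset:
  "homology_class q j P \<gamma> = bounding q (cells (Suc j) P) #>\<^bsub>mod_functions q\<^esub> \<gamma>"
  by (simp add: homology_class_def boundaries_eq_bounding r_coset_def cycle_group_def chain_group_def)

lemma homology_class_eq_one_iff:
  assumes q: "q > 0" and \<gamma>: "\<gamma> \<in> carrier (mod_functions q)"
  shows "homology_class q j P \<gamma> = \<one>\<^bsub>homology q j P\<^esub> \<longleftrightarrow> \<gamma> \<in> bounding q (cells (Suc j) P)"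
proof -
  interpret comm_group "mod_functions q :: (cell \<Rightarrow> int) monoid" by (rule comm_group_mod_functions[OF q])
  have "\<one>\<^bsub>homology q j P\<^esub> = bounding q (cells (Suc j) P)"
    by (simp add: homology_def boundaries_eq_bounding)
  then show ?thesis
    unfolding homology_class_eq_coset
    using coset_join1[OF _ \<gamma> subgroup_bounding[OF q]] coset_join2[OF \<gamma> subgroup_bounding[OF q]] by auto
qed

lemma homology_class_eq_iff:
  assumes q: "q > 0" and \<gamma>: "\<gamma> \<in> carrier (mod_functions q)" "\<gamma>' \<in> carrier (mod_functions q)"
  shows "homology_class q j P \<gamma> = homology_class q j P \<gamma>' \<longleftrightarrow>
    (\<lambda>\<sigma>. (\<gamma> \<sigma> - \<gamma>' \<sigma>) mod int q) \<in> bounding q (cells (Suc j) P)" (is "_ \<longleftrightarrow> ?d \<in> ?B")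
proof -
  interpret comm_group "mod_functions q :: (cell \<Rightarrow> int) monoid" by (rule comm_group_mod_functions[OF q])
  have B: "subgroup ?B (mod_functions q)" by (rule subgroup_bounding[OF q])
  have "\<gamma> \<in> ?B #>\<^bsub>mod_functions q\<^esub> \<gamma>' \<longleftrightarrow> ?d \<in> ?B"
  proof
    assume "\<gamma> \<in> ?B #>\<^bsub>mod_functions q\<^esub> \<gamma>'"
    then obtain b where b: "b \<in> ?B" "\<gamma> = (\<lambda>\<sigma>. (b \<sigma> + \<gamma>' \<sigma>) mod int q)" by (auto simp: r_coset_def)
    then have "?d = (\<lambda>\<sigma>. b \<sigma> mod int q)" by (simp add: mod_diff_left_eq)
    also have "\<dots> = b"
      using mod_functions_mod_eq[OF q subsetD[OF bounding_subset[OF q] b(1)]] by simp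
    finally show "?d \<in> ?B" using b(1) by simp
  next
    assume "?d \<in> ?B"
    moreover have "\<gamma> = (\<lambda>\<sigma>. (?d \<sigma> + \<gamma>' \<sigma>) mod int q)"
      using mod_functions_mod_eq[OF q \<gamma>(1)] by (simp add: mod_add_left_eq)
    ultimately show "\<gamma> \<in> ?B #>\<^bsub>mod_functions q\<^esub> \<gamma>'" unfolding r_coset_def mult_mod_functions by blast
  qed
  moreover have "?B #>\<^bsub>mod_functions q\<^esub> \<gamma> = ?B #>\<^bsub>mod_functions q\<^esub> \<gamma>' \<longleftrightarrow> \<gamma> \<in> ?B #>\<^bsub>mod_functions q\<^esub> \<gamma>'"
    using rcos_self[OF \<gamma>(1) B] repr_independence[OF _ \<gamma>(2) B] by auto
  ultimately show ?thesis unfolding homology_class_eq_coset by simp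
qed

text \<open>On a box both sides are the same mean of the random cluster weights. On the lattice, weak
  convergence of the gauge theory provides the limit of these means, and \<open>prcm_lattice_limit\<close>
  identifies it.\<close>

theorem integral_wilson_eq_measure:
  assumes q: "q \<ge> 2" and \<beta>: "\<beta> \<ge> 0" and j: "Suc j < d" and p: "p = 1 - exp (- \<beta>)"
    and \<gamma>: "\<gamma> \<in> chains_on q (cells j (region_cells d X))"
    and \<nu>: "is_plgt bc d X \<beta> q j \<nu>" and \<mu>: "is_prcm bc d X p q (Suc j) \<mu>"
  shows "(\<integral>f. wilson \<gamma> f \<partial>\<nu>) = complex_of_real (measure \<mu> (bounding_event bc d X q j \<gamma>))"
    and "bounding_event bc d X q j \<gamma> \<in> sets \<mu>"
proof -
  have q0: "q > 0" using q by simp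
  have p01: "0 \<le> p" "p < 1" using \<beta> p by auto
  have "(\<integral>f. wilson \<gamma> f \<partial>\<nu>) = complex_of_real (measure \<mu> (bounding_event bc d X q j \<gamma>)) \<and>
      bounding_event bc d X q j \<gamma> \<in> sets \<mu>"
  proof (cases X)
    case (Box \<Lambda>)
    let ?T = "boundary_plaquettes bc (Suc j) \<Lambda>"
    have \<nu>': "\<nu> = measure_pmf (plgt_box bc \<Lambda> \<beta> q j)" and \<mu>': "\<mu> = measure_pmf (prcm_box bc \<Lambda> p q (Suc j))"
      using \<nu> \<mu> by (simp_all add: is_plgt_def is_prcm_def Box)
    have \<gamma>': "\<gamma> \<in> chains_on q (cells j (box_cells \<Lambda>))" using \<gamma> by (simp add: region_cells_def Box)
    have ev: "indicator (bounding_event bc d X q j \<gamma>) =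
        (\<lambda>\<omega>. of_bool (\<gamma> \<in> bounding q (cells (Suc j) (Collect \<omega>) \<union> ?T)) :: real)"
      by (auto simp: fun_eq_iff bounding_event_def subcomplex_event_def Box cells_with_boundary split: split_indicator)
    have "measure \<mu> (bounding_event bc d X q j \<gamma>) = (\<integral>\<omega>. indicator (bounding_event bc d X q j \<gamma>) \<omega> \<partial>\<mu>)"
      by (simp add: \<mu>')
    also have "\<dots> = rc_mean q p (cells (Suc j) (box_cells \<Lambda>)) ?T (\<lambda>A. of_bool (\<gamma> \<in> bounding q (A \<union> ?T)))"
      unfolding ev \<mu>' by (rule expectation_prcm(1)[OF q p01, where h = "\<lambda>A. of_bool (\<gamma> \<in> bounding q (A \<union> ?T))"])
    finally show ?thesis using expectation_wilson[OF q p \<gamma>', of bc] by (simp add: \<nu>' \<mu>')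
  next
    case Lattice
    have \<nu>': "weak_limit (\<lambda>N. plgt_box bc (centered_box d N) \<beta> q j) \<nu>"
      and \<mu>': "weak_limit (\<lambda>N. prcm_box bc (centered_box d N) p q (Suc j)) \<mu>"
      using \<nu> \<mu> by (simp_all add: is_plgt_def is_prcm_def Lattice)
    have \<gamma>': "\<gamma> \<in> chains_on q (cells j (lattice_cells d))" using \<gamma> by (simp add: region_cells_def Lattice)
    define m where "m N = rc_mean q p (box_plaquettes (Suc j) d N) (wiring bc (Suc j) d N)
      (\<lambda>A. of_bool (\<gamma> \<in> bounding q (A \<union> wiring bc (Suc j) d N)))" for N
    have "{\<sigma>. \<gamma> \<sigma> \<noteq> 0} \<subseteq> lattice_cells d" using \<gamma>' by (auto simp: chains_on_def cells_def)
    then obtain N0 where N0: "{\<sigma>. \<gamma> \<sigma> \<noteq> 0} \<subseteq> box_cells (centered_box d N0)"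
      using finite_subset_centered_box[OF finite_chain[OF \<gamma>']] by blast
    have "complex_of_real (m N) = measure_pmf.expectation (plgt_box bc (centered_box d N) \<beta> q j) (wilson \<gamma>)"
      if "N0 \<le> N" for N
    proof -
      have "\<gamma> \<in> chains_on q (cells j (box_cells (centered_box d N)))"
        using \<gamma>' N0 centered_box_mono[OF that, of d] by (auto simp: chains_on_def cells_def)
      from expectation_wilson[OF q p this, of bc] show ?thesis by (simp add: m_def)
    qed
    then have "\<forall>\<^sub>F N in sequentially. measure_pmf.expectation (plgt_box bc (centered_box d N) \<beta> q j) (wilson \<gamma>) = complex_of_real (m N)"
      unfolding eventually_sequentially by (metis (no_types))
    from Lim_transform_eventually[OF plgt_limit_wilson[OF q0 \<nu>' \<gamma>'] this]
    have lim: "(\<lambda>N. complex_of_real (m N)) \<longlonglongrightarrow> (\<integral>f. wilson \<gamma> f \<partial>\<nu>)" .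
    have "m \<longlonglongrightarrow> Re (\<integral>f. wilson \<gamma> f \<partial>\<nu>)" using tendsto_Re[OF lim] by simp
    moreover have "(\<lambda>_ :: nat. 0) \<longlonglongrightarrow> Im (\<integral>f. wilson \<gamma> f \<partial>\<nu>)" using tendsto_Im[OF lim] by simp
    then have "Im (\<integral>f. wilson \<gamma> f \<partial>\<nu>) = 0" by (simp add: LIMSEQ_const_iff)
    moreover note prcm_lattice_limit[OF q p01 j \<gamma>' \<mu>' calculation(1)[unfolded m_def]]
    ultimately show ?thesis by (simp add: Lattice complex_eq_iff)
  qed
  then show "(\<integral>f. wilson \<gamma> f \<partial>\<nu>) = complex_of_real (measure \<mu> (bounding_event bc d X q j \<gamma>))"
    and "bounding_event bc d X q j \<gamma> \<in> sets \<mu>" by blast+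
qed


lemma V_null_eq_bounding_event:
  assumes "q > 0" "\<gamma> \<in> carrier (mod_functions q)"
  shows "V_null bc d X q j \<gamma> = bounding_event bc d X q j \<gamma>"
  unfolding V_null_def bounding_event_def homology_class_eq_one_iff[OF assms] ..

text \<open>On the lattice, \<open>V_pair\<close> asks that \<open>\<gamma>\<close> is not bounding for all large \<open>N\<close>, which is formally stronger
  than the complement of the event for \<open>\<gamma>\<close>; the two agree because the condition is eventually
  constant.\<close>

lemma V_pair_eq_bounding_event:
  assumes q: "q > 0" and j: "Suc j < d"
    and \<gamma>: "\<gamma> \<in> chains_on q (cells j (region_cells d X))" and \<gamma>': "\<gamma>' \<in> carrier (mod_functions q)"
  shows "V_pair bc d X q j \<gamma> \<gamma>' =
    bounding_event bc d X q j (\<lambda>\<sigma>. (\<gamma> \<sigma> - \<gamma>' \<sigma>) mod int q) - bounding_event bc d X q j \<gamma>"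
proof -
  have c: "\<gamma> \<in> carrier (mod_functions q)" using \<gamma> by (simp add: chains_on_def)
  show ?thesis
  proof (cases X)
    case (Box \<Lambda>)
    show ?thesis
      unfolding V_pair_def homology_class_eq_one_iff[OF q c] homology_class_eq_iff[OF q c \<gamma>']
      by (auto simp: bounding_event_def subcomplex_event_def Box)
  next
    case Lattice
    have ev: "(\<forall>\<^sub>F N in sequentially. \<gamma> \<in> bounding q (cells (Suc j) (with_boundary bc (centered_box d N) (Collect \<omega>)))) \<or>
        (\<forall>\<^sub>F N in sequentially. \<gamma> \<notin> bounding q (cells (Suc j) (with_boundary bc (centered_box d N) (Collect \<omega>))))" for \<omega>
      unfolding cells_with_boundary
      by (rule eventually_local(2)[OF q j]) (use \<gamma> in \<open>auto simp: region_cells_def Lattice cells_def\<close>)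
    have disj: "\<not> ((\<forall>\<^sub>F N in sequentially. P N) \<and> (\<forall>\<^sub>F N in sequentially. \<not> P N))" for P :: "nat \<Rightarrow> bool"
      using eventually_conj[of P sequentially "\<lambda>N. \<not> P N"] by auto
    show ?thesis
      unfolding V_pair_def homology_class_eq_one_iff[OF q c] homology_class_eq_iff[OF q c \<gamma>']
        bounding_event_def subcomplex_event_def Lattice region.case eventually_conj_iff
      using ev disj by blast
  qed
qed

lemma bounding_event_diff_Int:
  assumes q: "q > 0" and \<gamma>: "\<gamma> \<in> carrier (mod_functions q)" and \<gamma>': "\<gamma>' \<in> carrier (mod_functions q)"
  shows "bounding_event bc d X q j (\<lambda>\<sigma>. (\<gamma> \<sigma> - \<gamma>' \<sigma>) mod int q) \<inter> bounding_event bc d X q j \<gamma> =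
    bounding_event bc d X q j \<gamma> \<inter> bounding_event bc d X q j \<gamma>'"
proof -
  have iff: "(\<lambda>\<sigma>. (\<gamma> \<sigma> - \<gamma>' \<sigma>) mod int q) \<in> bounding q A \<longleftrightarrow> \<gamma>' \<in> bounding q A" if "\<gamma> \<in> bounding q A" for A
  proof
    show "(\<lambda>\<sigma>. (\<gamma> \<sigma> - \<gamma>' \<sigma>) mod int q) \<in> bounding q A" if "\<gamma>' \<in> bounding q A"
      by (rule bounding_diff[OF q \<open>\<gamma> \<in> bounding q A\<close> that])
    assume "(\<lambda>\<sigma>. (\<gamma> \<sigma> - \<gamma>' \<sigma>) mod int q) \<in> bounding q A"
    from bounding_diff[OF q that this] show "\<gamma>' \<in> bounding q A"
      by (simp add: mod_diff_right_eq mod_functions_mod_eq[OF q \<gamma>'])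
  qed
  show ?thesis
  proof (cases X)
    case (Box \<Lambda>)
    show ?thesis using iff by (auto simp: bounding_event_def subcomplex_event_def Box)
  next
    case Lattice
    have "(\<lambda>N. (\<lambda>\<sigma>. (\<gamma> \<sigma> - \<gamma>' \<sigma>) mod int q) \<in> bounding q (A N) \<and> \<gamma> \<in> bounding q (A N)) =
        (\<lambda>N. \<gamma> \<in> bounding q (A N) \<and> \<gamma>' \<in> bounding q (A N))" for A :: "nat \<Rightarrow> cell set"
      using iff by (auto simp: fun_eq_iff)
    then show ?thesis
      by (simp add: bounding_event_def subcomplex_event_def Lattice Int_def flip: eventually_conj_iff)
  qed
qed

theorem theorem6:
  fixes d i q :: nat and \<beta> p :: real and X :: region and bc :: boundary_condition
    and \<gamma> \<gamma>' :: "cell \<Rightarrow> int"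
    and \<nu> :: "(cell \<Rightarrow> complex) measure" and \<mu> :: "(cell \<Rightarrow> bool) measure"
  assumes "0 < i" and "i < d - 1"
    and "region_in_dim d X"
    and "q \<ge> 2" and "\<beta> \<ge> 0"
    and "\<gamma> \<in> cycles q (i - 1) (region_cells d X)" and "\<gamma>' \<in> cycles q (i - 1) (region_cells d X)"
    and "is_plgt bc d X \<beta> q (i - 1) \<nu>"
    and "p = 1 - exp (- \<beta>)" and "is_prcm bc d X p q i \<mu>"
  shows "covariance \<nu> (wilson \<gamma>) (\<lambda>f. inverse (wilson \<gamma>' f)) =
    complex_of_real (measure \<mu> (V_pair bc d X q (i - 1) \<gamma> \<gamma>')
      + event_covariance \<mu> (V_null bc d X q (i - 1) \<gamma>) (V_null bc d X q (i - 1) \<gamma>'))"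
proof -
  obtain j where i: "i = Suc j" using assms(1) by (cases i) auto
  have j: "Suc j < d" using assms(2) i by simp
  have q0: "q > 0" using assms(4) by simp
  define K where "K = cells j (region_cells d X)"
  have c: "\<gamma> \<in> chains_on q K" "\<gamma>' \<in> chains_on q K"
    using assms(6,7) by (simp_all add: cycles_def carrier_chain_group i K_def)
  then have carr: "\<gamma> \<in> carrier (mod_functions q)" "\<gamma>' \<in> carrier (mod_functions q)"
    by (simp_all add: chains_on_def)
  define \<delta> where "\<delta> = (\<lambda>\<sigma>. (\<gamma> \<sigma> - \<gamma>' \<sigma>) mod int q)"
  define \<epsilon> where "\<epsilon> = (\<lambda>\<sigma>. (- \<gamma>' \<sigma>) mod int q)"
  have \<delta>: "\<delta> \<in> chains_on q K" unfolding \<delta>_def by (rule chains_on_diff[OF q0 c])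
  have \<epsilon>: "\<epsilon> \<in> chains_on q K"
    unfolding \<epsilon>_def using chains_on_diff[OF q0 chains_on_zero[OF q0] c(2)] by simp
  have plgt: "is_plgt bc d X \<beta> q j \<nu>" and prcm: "is_prcm bc d X p q (Suc j) \<mu>"
    using assms(8,10) by (simp_all add: i)
  define V where "V = bounding_event bc d X q j"
  have mean: "(\<integral>f. wilson \<eta> f \<partial>\<nu>) = complex_of_real (measure \<mu> (V \<eta>))"
    and V_sets: "V \<eta> \<in> sets \<mu>" if "\<eta> \<in> chains_on q K" for \<eta>
    using integral_wilson_eq_measure[OF assms(4,5) j assms(9) that[unfolded K_def] plgt prcm]
    by (simp_all add: V_def)
  have roots: "AE f in \<nu>. f \<in> root_spins q"
  proof (cases X)
    case (Box \<Lambda>)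
    then show ?thesis
      using plgt set_pmf_plgt_box[OF q0] spin_cochains_root_spins by (fastforce simp: is_plgt_def AE_measure_pmf_iff)
  next
    case Lattice
    then show ?thesis using plgt plgt_limit_roots[OF q0] by (simp add: is_plgt_def)
  qed
  have meas: "wilson \<eta> \<in> borel_measurable \<nu>" if "\<eta> \<in> chains_on q K" for \<eta>
  proof (cases X)
    case (Box \<Lambda>)
    then show ?thesis using plgt by (simp add: is_plgt_def)
  next
    case Lattice
    then show ?thesis
      using plgt wilson_borel_measurable[OF that q0] by (simp add: is_plgt_def weak_limit_def)
  qed
  have "prob_space \<mu>"
    using prcm by (cases X) (auto simp: is_prcm_def weak_limit_def prob_space_measure_pmf)
  then interpret \<mu>: prob_space \<mu> .

  have "(\<integral>f. wilson \<gamma> f * inverse (wilson \<gamma>' f) \<partial>\<nu>) = (\<integral>f. wilson \<delta> f \<partial>\<nu>)"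
  proof (rule integral_cong_AE)
    show "AE f in \<nu>. wilson \<gamma> f * inverse (wilson \<gamma>' f) = wilson \<delta> f"
      using roots
    proof eventually_elim
      case (elim f)
      have nz: "\<And>\<sigma>. f \<sigma> \<noteq> 0" using root_spins_nonzero[OF q0 elim] .
      show ?case
        unfolding wilson_def \<delta>_def
        by (simp add: on_chain_mod[OF q0 elim finite_support_diff[OF c[THEN finite_chain]]]
            on_chain_diff[OF nz c[THEN finite_chain]])
    qed
  qed (use meas c \<delta> in simp_all)
  also have "\<dots> = complex_of_real (measure \<mu> (V \<delta>))" by (rule mean[OF \<delta>])
  finally have 1: "(\<integral>f. wilson \<gamma> f * inverse (wilson \<gamma>' f) \<partial>\<nu>) = complex_of_real (measure \<mu> (V \<delta>))" .
  have "(\<integral>f. inverse (wilson \<gamma>' f) \<partial>\<nu>) = (\<integral>f. wilson \<epsilon> f \<partial>\<nu>)"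
  proof (rule integral_cong_AE)
    show "AE f in \<nu>. inverse (wilson \<gamma>' f) = wilson \<epsilon> f"
      using roots
    proof eventually_elim
      case (elim f)
      have nz: "\<And>\<sigma>. f \<sigma> \<noteq> 0" using root_spins_nonzero[OF q0 elim] .
      have fin: "finite {\<sigma>. - \<gamma>' \<sigma> \<noteq> 0}" using finite_chain[OF c(2)] by simp
      have "on_chain f (\<lambda>\<sigma>. 0 - \<gamma>' \<sigma>) = on_chain f (\<lambda>_. 0) * inverse (on_chain f \<gamma>')"
        by (rule on_chain_diff[OF nz _ finite_chain[OF c(2)]]) simp
      then show ?case
        unfolding wilson_def \<epsilon>_def by (simp add: on_chain_mod[OF q0 elim fin])
    qed
  qed (use meas c \<epsilon> in simp_all)
  also have "\<dots> = complex_of_real (measure \<mu> (V \<epsilon>))" by (rule mean[OF \<epsilon>])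
  also have "V \<epsilon> = V \<gamma>'"
  proof -
    have "\<epsilon> \<in> bounding q A \<longleftrightarrow> \<gamma>' \<in> bounding q A" for A
      using bounding_uminus[OF q0, of \<gamma>' A] bounding_uminus[OF q0, of \<epsilon> A]
      by (auto simp: \<epsilon>_def mod_minus_eq mod_functions_mod_eq[OF q0 carr(2)])
    then show ?thesis by (simp add: V_def bounding_event_def)
  qed
  finally have 2: "(\<integral>f. inverse (wilson \<gamma>' f) \<partial>\<nu>) = complex_of_real (measure \<mu> (V \<gamma>'))" .

  have null: "V_null bc d X q (i - 1) \<gamma> = V \<gamma>" "V_null bc d X q (i - 1) \<gamma>' = V \<gamma>'"
    using V_null_eq_bounding_event[OF q0] carr by (simp_all add: V_def i)
  have pair: "V_pair bc d X q (i - 1) \<gamma> \<gamma>' = V \<delta> - V \<gamma>"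
    using V_pair_eq_bounding_event[OF q0 j c(1)[unfolded K_def] carr(2)] by (simp add: V_def \<delta>_def i)
  have Int: "V \<delta> \<inter> V \<gamma> = V \<gamma> \<inter> V \<gamma>'"
    unfolding V_def \<delta>_def by (rule bounding_event_diff_Int[OF q0 carr])
  have "measure \<mu> (V \<delta>) = measure \<mu> (V \<delta> - V \<gamma>) + measure \<mu> (V \<gamma> \<inter> V \<gamma>')"
    using \<mu>.finite_measure_Diff'[OF V_sets[OF \<delta>] V_sets[OF c(1)]] by (simp add: Int)
  moreover have "event_covariance \<mu> (V \<gamma>) (V \<gamma>') =
      measure \<mu> (V \<gamma> \<inter> V \<gamma>') - measure \<mu> (V \<gamma>) * measure \<mu> (V \<gamma>')"
    using V_sets[OF c(1)] V_sets[OF c(2)]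
    by (simp add: event_covariance_def covariance_def sets.Int_space_eq2 flip: indicator_inter_arith)
  ultimately have "measure \<mu> (V \<delta>) - measure \<mu> (V \<gamma>) * measure \<mu> (V \<gamma>') =
      measure \<mu> (V \<delta> - V \<gamma>) + event_covariance \<mu> (V \<gamma>) (V \<gamma>')" by simp
  then show ?thesis
    unfolding covariance_def 1 2 mean[OF c(1)] null pair by (simp only: flip: of_real_mult of_real_diff)
qed

end
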